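(* Suppose that $K$ is a simplicial complex with $\mathrm{Vert}(K)\subseteq [m]$. If $r = \pi(K) = p^k$ is a prime power ($p$ prime, $k\ge 1$) and $G = (\mathbb{Z}_p)^k$, acting freely on the set $[r]$, then $$\mathrm{Ind}_G(K^{\ast r}_\Delta)\geq m - \pi(K).$$
   Context: Notation: $[m]=\{1,\dots,m\}$. Simplicial complexes contain the empty face, and $\mathrm{Vert}(K)\subseteq[m]$ may be a strict inclusion. Partition number: for a simplicial complex $K\subseteq 2^{[m]}$, $\pi(K)$ is the minimum integer $\nu$ such that for each partition $A_1\uplus\cdots\uplus A_\nu=[m]$ of $[m]$ at least one of the sets $A_i$ is in $K$. Deleted join: $K^{\ast r}_\Delta$ is the simplicial complex on the vertex set $[m]\times[r]$ whose simplices are the $r$-tuples $(A_1,\dots,A_r)$ (identified with $\bigcup_i A_i\times\{i\}$) with $A_i\in K$ for all $i$ and $A_i\cap A_j=\emptyset$ for $i\neq j$. The action of $G$ on $[r]$ induces an action of $G$ on $K^{\ast r}_\Delta$ by permuting the coordinates of the $r$-tuples; complexes are identified with their geometric realizations. Index: for a finite group $G$ and a $G$-space $X$, the $G$-genus $\gamma_G(X)$ is the smallest $n\in\mathbb{N}_0$ such that there exist proper subgroups $H_1,\dots,H_n\subsetneq G$ and a continuous $G$-equivariant map $X\to G/H_1\ast\cdots\ast G/H_n$ (join of discrete orbits, with the diagonal $G$-action); $\gamma_G(\emptyset)=0$, and $\gamma_G(X)=\infty$ if no such $n$ exists. The equivariant index is $\mathrm{Ind}_G(X):=\gamma_G(X)-1$.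 *)

theory Defs
  imports
    "HOL-Analysis.Analysis"
    "HOL-Algebra.Group_Action"
    "HOL-Algebra.Left_Coset"
    "HOL-Algebra.Product_Groups"
    "HOL-Computational_Algebra.Primes"
begin

section \<open>Simplicial complexes and their geometric realizations\<close>

text \<open>
  The library's \<open>simplicial_complex\<close> is a geometric complex in a Euclidean space; here
  complexes are abstract, and the empty face is always present. An element of the
  vertex type need not be a vertex of the complex.
\<close>

definition abstract_complex :: "'v set set \<Rightarrow> bool"
  where "abstract_complex K \<longleftrightarrow>
    {} \<in> K \<and> (\<forall>\<sigma>\<in>K. finite \<sigma>) \<and> (\<forall>\<sigma>\<in>K. \<forall>\<tau>. \<tau> \<subseteq> \<sigma> \<longrightarrow> \<tau> \<in> K)"

definition Vert :: "'v set set \<Rightarrow> 'v set"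
  where "Vert K = \<Union>K"

text \<open>
  Points are given by their barycentric coordinates, extended by zero to the whole vertex type.
  The product topology is the usual topology of the realization when \<open>Vert K\<close> is finite,
  the only case considered here. The empty face contributes no point.
\<close>

definition geometric_realization :: "'v set set \<Rightarrow> ('v \<Rightarrow> real) topology"
  where "geometric_realization K = subtopology (powertop_real UNIV)
    {t. (\<forall>v. 0 \<le> t v) \<and> {v. t v \<noteq> 0} \<in> K \<and> (\<Sum>v | t v \<noteq> 0. t v) = 1}"

text \<open>
  The affine extension of a vertex map: the coordinate of the image point at \<open>w\<close> is the
  total weight of the vertices mapped to \<open>w\<close>.
\<close>

definition realize_map :: "('v \<Rightarrow> 'w) \<Rightarrow> ('v \<Rightarrow> real) \<Rightarrow> 'w \<Rightarrow> real"
  where "realize_map f t = (\<lambda>w. \<Sum>v | t v \<noteq> 0 \<and> f v = w. t v)"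


section \<open>Joins and deleted joins\<close>

definition tuple_simplex :: "nat \<Rightarrow> (nat \<Rightarrow> 'v set) \<Rightarrow> ('v \<times> nat) set"
  where "tuple_simplex n A = (\<Union>i\<in>{1..n}. A i \<times> {i})"

definition join_complex :: "nat \<Rightarrow> (nat \<Rightarrow> 'v set set) \<Rightarrow> ('v \<times> nat) set set"
  where "join_complex n L = {tuple_simplex n A | A. \<forall>i\<in>{1..n}. A i \<in> L i}"

definition deleted_join :: "nat \<Rightarrow> 'v set set \<Rightarrow> ('v \<times> nat) set set"
  where "deleted_join r K =
    {tuple_simplex r A | A. (\<forall>i\<in>{1..r}. A i \<in> K) \<and> disjoint_family_on A {1..r}}"

definition deleted_join_action ::
  "('g \<Rightarrow> nat \<Rightarrow> nat) \<Rightarrow> 'g \<Rightarrow> ('v \<times> nat \<Rightarrow> real) \<Rightarrow> 'v \<times> nat \<Rightarrow> real"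
  where "deleted_join_action \<phi> g = realize_map (\<lambda>(v, i). (v, \<phi> g i))"


section \<open>Partition number\<close>

text \<open>
  Parts may be empty, which makes no difference since the empty set is a face. The number of parts
  has to be positive: a nonempty set has no partition into zero parts, so zero would satisfy
  the condition vacuously.
\<close>

definition partition_number :: "nat \<Rightarrow> nat set set \<Rightarrow> nat"
  where "partition_number m K = (LEAST \<nu>. 1 \<le> \<nu> \<and>
    (\<forall>A. disjoint_family_on A {1..\<nu>} \<and> (\<Union>i\<in>{1..\<nu>}. A i) = {1..m} \<longrightarrow> (\<exists>i\<in>{1..\<nu>}. A i \<in> K)))"


section \<open>Genus and equivariant index\<close>

definition discrete_complex :: "'v set \<Rightarrow> 'v set set"
  where "discrete_complex V = insert {} ((\<lambda>v. {v}) ` V)"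

text \<open>
  The join \<open>G/H\<^sub>1 * \<dots> * G/H\<^sub>n\<close>. For a finite group the orbits are finite discrete spaces, so
  their join is the realization of the join of the corresponding zero-dimensional complexes; for
  \<open>n = 0\<close> it is empty.
\<close>

definition orbit_join ::
  "('g, 'b) monoid_scheme \<Rightarrow> nat \<Rightarrow> (nat \<Rightarrow> 'g set) \<Rightarrow> ('g set \<times> nat \<Rightarrow> real) topology"
  where "orbit_join G n H =
    geometric_realization (join_complex n (\<lambda>i. discrete_complex (lcosets\<^bsub>G\<^esub> (H i))))"

definition orbit_join_action ::
  "('g, 'b) monoid_scheme \<Rightarrow> 'g \<Rightarrow> ('g set \<times> nat \<Rightarrow> real) \<Rightarrow> 'g set \<times> nat \<Rightarrow> real"
  where "orbit_join_action G g = realize_map (\<lambda>(C, i). (g <#\<^bsub>G\<^esub> C, i))"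

definition equivariant_on ::
  "'g set \<Rightarrow> ('g \<Rightarrow> 'x \<Rightarrow> 'x) \<Rightarrow> ('g \<Rightarrow> 'y \<Rightarrow> 'y) \<Rightarrow> 'x set \<Rightarrow> ('x \<Rightarrow> 'y) \<Rightarrow> bool"
  where "equivariant_on \<Gamma> \<alpha> \<beta> S f \<longleftrightarrow> (\<forall>g\<in>\<Gamma>. \<forall>x\<in>S. f (\<alpha> g x) = \<beta> g (f x))"

text \<open>
  The \<open>G\<close>-space is the pair of the topology \<open>T\<close> and the action \<open>\<alpha>\<close> on its points. The infimum
  of the empty set is \<open>\<infinity>\<close>.
\<close>

definition genus ::
  "('g, 'b) monoid_scheme \<Rightarrow> 'x topology \<Rightarrow> ('g \<Rightarrow> 'x \<Rightarrow> 'x) \<Rightarrow> enat"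
  where "genus G T \<alpha> = Inf {enat n | n.
    \<exists>H f. (\<forall>i\<in>{1..n}. subgroup (H i) G \<and> H i \<noteq> carrier G) \<and>
      continuous_map T (orbit_join G n H) f \<and>
      equivariant_on (carrier G) \<alpha> (orbit_join_action G) (topspace T) f}"

text \<open>Extended reals are used because the index of the empty space is \<open>-1\<close>.\<close>

definition equivariant_index ::
  "('g, 'b) monoid_scheme \<Rightarrow> 'x topology \<Rightarrow> ('g \<Rightarrow> 'x \<Rightarrow> 'x) \<Rightarrow> ereal"
  where "equivariant_index G T \<alpha> = ereal_of_enat (genus G T \<alpha>) - 1"


section \<open>Groups\<close>

definition Zp_power :: "nat \<Rightarrow> nat \<Rightarrow> (nat \<Rightarrow> int) monoid"
  where "Zp_power p k = product_group {1..k} (\<lambda>_. integer_mod_group p)"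

definition free_action ::
  "('g, 'b) monoid_scheme \<Rightarrow> 'x set \<Rightarrow> ('g \<Rightarrow> 'x \<Rightarrow> 'x) \<Rightarrow> bool"
  where "free_action G E \<phi> \<longleftrightarrow>
    group_action G E \<phi> \<and> (\<forall>x\<in>E. stabilizer G \<phi> x = {\<one>\<^bsub>G\<^esub>})"

end

theory Submission
  imports
    Defs
    "HOL-Library.Sublist"
    "HOL-Library.Function_Algebras"
    "HOL-Computational_Algebra.Polynomial"
    "HOL-Number_Theory.Cong"
begin

text \<open>
  Let \<open>f\<close> be an equivariant map from the deleted join \<open>K\<^sub>\<Delta>\<close> of \<open>K\<close> to a join of \<open>n\<close> orbits \<open>G/H\<^sub>i\<close>
  with \<open>H\<^sub>i \<noteq> G\<close>; the claim is that \<open>n + r \<ge> m + 1\<close>. The deleted join of the full simplex on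
  \<open>[m]\<close> is the \<open>m\<close>-fold join \<open>X\<close> of the discrete set \<open>[r]\<close>. A point of \<open>X\<close> outside \<open>K\<^sub>\<Delta>\<close> determines the
  set of those \<open>i \<in> [r]\<close> for which its \<open>i\<close>-th column is not supported on a face of \<open>K\<close>. This set is
  nonempty, it is not \<open>[r]\<close> because \<open>\<pi>(K) = r\<close>, and it is moved by some element of \<open>G\<close> because a free
  action of a group of order \<open>r\<close> on \<open>[r]\<close> is transitive. Joined with \<open>f\<close>, this amounts
  to an equivariant map from \<open>X\<close> to a complex \<open>E\<close> without fixed points whose vertices lie on
  \<open>n + (r - 1)\<close> levels, at most one vertex of a simplex on each level
  (\<open>orbit_join_bound\<close>). It remains to see that a complex \<open>E\<close> with this property has at least \<open>m\<close>
  levels (\<open>no_equivariant_labelling\<close>, \<open>no_equivariant_pullback\<close>).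

  For \<open>G\<close> cyclic of prime order, \<open>G\<close> acts freely on \<open>E\<close> and this is Dold's theorem. It then has a
  proof by linear algebra: with a generator \<open>t\<close> and \<open>z = t - 1\<close>, the cochains of \<open>E\<close> modulo \<open>p\<close> form free
  modules over \<open>\<F>\<^sub>p[G] = \<F>\<^sub>p[z]/(z ^ p)\<close>, so that \<open>ker z = im z ^ (p - 1)\<close> and \<open>ker z ^ (p - 1) = im z\<close>, and a
  zigzag that alternates between coboundaries and these two operators carries the constant \<open>1\<close>
  from degree \<open>-1\<close> to the top degree of \<open>E\<close>; on \<open>X\<close>, which is acyclic below its top degree,
  the zigzag can be followed back and shows that \<open>1 = 0\<close>. For \<open>G = (\<int>/p)\<^sup>k\<close> the orbits of \<open>E\<close> need not be
  free, and no single element of \<open>G\<close> need act without fixed points on \<open>E\<close>. The remedy is to extend the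
  scalars to a field with many elements \<open>\<alpha> g\<close> that are linearly independent over \<open>\<F>\<^sub>p\<close> and to take
  \<open>z = \<Sum>g. \<alpha> g (g - 1)\<close>. Again \<open>z ^ p = 0\<close>, and on functions on any orbit \<open>G/H\<close> with \<open>H \<noteq> G\<close> all Jordan
  blocks of \<open>z\<close> have full size \<open>p\<close>: a nonzero homomorphism \<open>\<xi>\<close> from \<open>G\<close> to \<open>\<F>\<^sub>p\<close> that vanishes on \<open>H\<close> is a function
  on \<open>G/H\<close>, and multiplication by it, followed by a suitable element of the group algebra, is an operator
  \<open>D\<close> for which \<open>[z, D]\<close> is the scalar \<open>(\<Sum>g. \<alpha> g \<xi> g) ^ p \<noteq> 0\<close> (\<open>shift_op_exact\<close>). Hence the same zigzag works.

  Instead of a field of characteristic \<open>p\<close>, the coefficients are integer polynomials and all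
  identities are congruences modulo \<open>p\<close>; the scalars by which one would divide are carried along, and
  it suffices that \<open>p\<close> is a prime element. Continuity enters only through the uniform
  continuity of \<open>f\<close> on the compact space \<open>K\<^sub>\<Delta>\<close>: points of \<open>X\<close> are labelled by vertices of \<open>E\<close>, and
  cochains are pulled back along a fine iterated barycentric subdivision.
\<close>


section \<open>Cochains on lists\<close>

text \<open>
  A cochain is a function on lists of vertices, and one function carries the cochains of all
  degrees at once: the empty list is the empty face, so the complex is augmented. The recursion
  unfolds to the alternating sum over the lists with one entry deleted.
\<close>

fun coboundary :: "('v list \<Rightarrow> 'a::comm_ring_1) \<Rightarrow> 'v list \<Rightarrow> 'a" where
  "coboundary F [] = 0"
| "coboundary F (x # xs) = F xs - coboundary (\<lambda>ys. F (x # ys)) xs"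

lemma coboundary_diff:
  "coboundary (\<lambda>ys. F ys - F' ys) xs = coboundary F xs - coboundary F' xs"
  by (induction xs arbitrary: F F') simp_all

lemma coboundary_0 [simp]: "coboundary (\<lambda>_. 0) xs = 0"
  by (induction xs) simp_all

lemma coboundary_scale: "coboundary (\<lambda>ys. c * F ys) xs = c * coboundary F xs"
  by (induction xs arbitrary: F) (simp_all add: algebra_simps)

lemma coboundary_sum:
  "coboundary (\<lambda>ys. \<Sum>i\<in>I. F i ys) xs = (\<Sum>i\<in>I. coboundary (F i) xs)"
  by (induction xs arbitrary: F) (simp_all add: sum_subtractf)

lemma coboundary_map: "coboundary F (map h xs) = coboundary (\<lambda>ys. F (map h ys)) xs"
  by (induction xs arbitrary: F) simp_all

lemma coboundary_coboundary [simp]: "coboundary (coboundary F) xs = 0"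
  by (induction xs arbitrary: F) (simp_all add: coboundary_diff)

text \<open>
  Congruence modulo \<open>P\<close> is the relation used throughout, because no type of coefficients can be a
  field whose characteristic is a given variable. The case \<open>P = 0\<close> of this and of similar lemmas is
  the statement that the operator depends only on certain values.
\<close>

lemma coboundary_dvd:
  assumes "\<And>ys. subseq ys xs \<Longrightarrow> Suc (length ys) = length xs \<Longrightarrow> P dvd F ys"
  shows "P dvd coboundary F xs"
  using assms
proof (induction xs arbitrary: F)
  case (Cons x xs)
  have "P dvd coboundary (\<lambda>ys. F (x # ys)) xs"
    by (rule Cons.IH) (simp add: Cons.prems)
  moreover have "P dvd F xs"
    by (rule Cons.prems) auto
  ultimately show ?case by simp
qed simp

lemma coboundary_cong_dvd:
  assumes "\<And>ys. subseq ys xs \<Longrightarrow> Suc (length ys) = length xs \<Longrightarrow> P dvd F ys - F' ys"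
  shows "P dvd coboundary F xs - coboundary F' xs"
  using coboundary_dvd[of xs P "\<lambda>ys. F ys - F' ys"] assms by (simp add: coboundary_diff)

lemma coboundary_cong:
  assumes "\<And>ys. subseq ys xs \<Longrightarrow> Suc (length ys) = length xs \<Longrightarrow> F ys = F' ys"
  shows "coboundary F xs = coboundary F' xs"
  using coboundary_cong_dvd[of xs 0 F F'] assms by simp


section \<open>Acyclicity of the iterated join\<close>

text \<open>
  The simplices of the \<open>m\<close>-fold join of a discrete set \<open>I\<close>. Listing the factors in decreasing
  order puts the newest factor at the head, as the induction on \<open>m\<close> wants it.
\<close>

definition join_simplices :: "nat \<Rightarrow> 'i set \<Rightarrow> (nat \<times> 'i) list set" where
  "join_simplices m I =
    {xs. sorted_wrt (\<lambda>a b. fst b < fst a) xs \<and> set xs \<subseteq> {1..m} \<times> I}"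

lemma Nil_join_simplices [simp]: "[] \<in> join_simplices m I"
  by (simp add: join_simplices_def)

lemma set_subseq: "subseq ys xs \<Longrightarrow> set ys \<subseteq> set xs"
  by (auto dest: list_emb_set)

lemma subseq_sorted_wrt: "subseq ys xs \<Longrightarrow> sorted_wrt R xs \<Longrightarrow> sorted_wrt R ys"
  by (induction rule: list_emb.induct) (auto dest: set_subseq)

lemma subseq_join_simplices:
  "ys \<in> join_simplices m I" if "subseq ys xs" "xs \<in> join_simplices m I"
  using that subseq_sorted_wrt[of ys xs] set_subseq[of ys xs]
  by (auto simp: join_simplices_def)

lemma Cons_Suc_join_simplices:
  "(Suc m, i) # xs \<in> join_simplices (Suc m) I \<longleftrightarrow> i \<in> I \<and> xs \<in> join_simplices m I"
  by (fastforce simp: join_simplices_def)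

lemma join_simplices_Suc_cases:
  assumes "xs \<in> join_simplices (Suc m) I"
  obtains "xs \<in> join_simplices m I"
  | i ys where "xs = (Suc m, i) # ys" "i \<in> I" "ys \<in> join_simplices m I"
proof (cases xs)
  case Nil
  then show ?thesis using that by simp
next
  case (Cons a ys)
  show ?thesis
  proof (cases "fst a = Suc m")
    case True
    then have "xs = (Suc m, snd a) # ys" using Cons by (cases a) simp
    then show ?thesis using that assms Cons_Suc_join_simplices by metis
  next
    case False
    then have "xs \<in> join_simplices m I"
      using assms Cons by (fastforce simp: join_simplices_def)
    then show ?thesis using that by simp
  qed
qed

lemma length_join_simplices: "xs \<in> join_simplices m I \<Longrightarrow> length xs \<le> m"
proof (induction m arbitrary: xs)
  case (Suc m)
  from Suc.prems show ?case
    by (cases rule: join_simplices_Suc_cases) (auto dest!: Suc.IH)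
qed (simp add: join_simplices_def)

text \<open>
  A cocycle \<open>V\<close> on the join of \<open>m + 1\<close> factors consists of its restriction to the
  join of the first \<open>m\<close> factors, and of one cochain \<open>W i\<close> for each point \<open>i\<close> of the last factor.
  Being a cocycle means that this restriction is the coboundary of every \<open>W i\<close>. The \<open>W i\<close> then differ
  by cocycles of one degree less, so by coboundaries. For \<open>l = 0\<close> there is nothing in that degree, and
  the condition says that \<open>V\<close> vanishes on the empty face.
\<close>

lemma join_acyclic:
  fixes V :: "(nat \<times> 'i) list \<Rightarrow> 'a::comm_ring_1"
  assumes "I \<noteq> {}" "l < m"
    and "\<And>xs. xs \<in> join_simplices m I \<Longrightarrow> length xs = Suc l \<Longrightarrow> P dvd coboundary V xs"
  shows "\<exists>U. \<forall>xs\<in>join_simplices m I. length xs = l \<longrightarrow> P dvd V xs - coboundary U xs"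
  using assms(2,3)
proof (induction m arbitrary: l V)
  case (Suc m)
  obtain i0 where i0: "i0 \<in> I" using assms(1) by blast
  define W where "W i ys = V ((Suc m, i) # ys)" for i ys
  have W: "P dvd V ys - coboundary (W i) ys"
    if "i \<in> I" "ys \<in> join_simplices m I" "length ys = l" for i ys
    using Suc.prems(2)[of "(Suc m, i) # ys"] that by (simp add: Cons_Suc_join_simplices W_def[abs_def])
  show ?case
  proof (cases l)
    case 0
    have "P dvd V []" using W[of i0 "[]"] i0 0 by simp
    then show ?thesis using 0 by (intro exI[of _ "\<lambda>_. 0"]) auto
  next
    case (Suc l')
    have "\<exists>Q. \<forall>ys\<in>join_simplices m I. length ys = l' \<longrightarrow>
        P dvd (W i ys - W i0 ys) - coboundary Q ys" if "i \<in> I" for i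
    proof (rule Suc.IH)
      show "l' < m" using Suc Suc.prems by simp
      fix ys assume "ys \<in> join_simplices m I" "length ys = Suc l'"
      then have "P dvd (V ys - coboundary (W i0) ys) - (V ys - coboundary (W i) ys)"
        using W[of i ys] W[of i0 ys] that i0 Suc by (metis dvd_diff)
      then show "P dvd coboundary (\<lambda>ys. W i ys - W i0 ys) ys"
        by (simp add: coboundary_diff)
    qed
    then obtain Q where Q: "\<And>i ys. i \<in> I \<Longrightarrow> ys \<in> join_simplices m I \<Longrightarrow> length ys = l' \<Longrightarrow>
        P dvd (W i ys - W i0 ys) - coboundary (Q i) ys"
      by metis
    define U where "U xs = (case xs of [] \<Rightarrow> W i0 xs
      | a # ys \<Rightarrow> if fst a = Suc m then - Q (snd a) ys else W i0 xs)" for xs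
    have U_old: "U ys = W i0 ys" if "ys \<in> join_simplices m I" for ys
      using that by (cases ys) (auto simp: U_def join_simplices_def)
    have "P dvd V xs - coboundary U xs"
      if xs: "xs \<in> join_simplices (Suc m) I" "length xs = l" for xs
      using xs(1)
    proof (cases rule: join_simplices_Suc_cases)
      case 1
      have "coboundary U xs = coboundary (W i0) xs"
        by (rule coboundary_cong) (use 1 in \<open>auto intro: U_old subseq_join_simplices\<close>)
      then show ?thesis using W[OF i0 1 xs(2)] by simp
    next
      case (2 i ys)
      have "coboundary (\<lambda>zs. U ((Suc m, i) # zs)) ys = - coboundary (Q i) ys"
        using coboundary_scale[of "-1" "Q i" ys] by (simp add: U_def)
      then have "V xs - coboundary U xs = (W i ys - W i0 ys) - coboundary (Q i) ys"
        using 2 U_old by (simp add: W_def)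
      then show ?thesis using Q[OF 2(2,3)] xs(2) 2 Suc by simp
    qed
    then show ?thesis by blast
  qed
qed simp


section \<open>Barycentric subdivision of cochains\<close>

text \<open>
  The dual of the subdivision operator on chains, which sends a simplex to the cone, with apex a
  point \<open>b\<close> of the simplex, over the subdivision of its boundary. If the apexes \<open>b\<close> are taken in another
  vertex set, this is the pullback along a map from the subdivision to another complex.
\<close>

fun subdivide_aux :: "('v list \<Rightarrow> 'w) \<Rightarrow> nat \<Rightarrow> ('w list \<Rightarrow> 'a::comm_ring_1) \<Rightarrow> 'v list \<Rightarrow> 'a" where
  "subdivide_aux b 0 F xs = F []"
| "subdivide_aux b (Suc n) F xs = coboundary (subdivide_aux b n (\<lambda>ys. F (b xs # ys))) xs"

definition subdivide :: "('v list \<Rightarrow> 'w) \<Rightarrow> ('w list \<Rightarrow> 'a::comm_ring_1) \<Rightarrow> 'v list \<Rightarrow> 'a" where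
  "subdivide b F xs = subdivide_aux b (length xs) F xs"

lemma subdivide_aux_diff:
  "subdivide_aux b n (\<lambda>ys. F ys - F' ys) = (\<lambda>xs. subdivide_aux b n F xs - subdivide_aux b n F' xs)"
  by (induction n arbitrary: F F') (auto simp: coboundary_diff)

lemma subdivide_aux_scale:
  "subdivide_aux b n (\<lambda>ys. c * F ys) = (\<lambda>xs. c * subdivide_aux b n F xs)"
  by (induction n arbitrary: F) (auto simp: coboundary_scale)

lemma subdivide_aux_sum:
  "subdivide_aux b n (\<lambda>ys. \<Sum>i\<in>I. F i ys) = (\<lambda>xs. \<Sum>i\<in>I. subdivide_aux b n (F i) xs)"
  by (induction n arbitrary: F) (auto simp: coboundary_sum)

lemma subdivide_Nil [simp]: "subdivide b F [] = F []"
  by (simp add: subdivide_def)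

lemma subdivide_scale: "subdivide b (\<lambda>ys. c * F ys) = (\<lambda>xs. c * subdivide b F xs)"
  by (simp add: subdivide_def subdivide_aux_scale fun_eq_iff)

lemma subdivide_sum:
  "subdivide b (\<lambda>ys. \<Sum>i\<in>I. F i ys) = (\<lambda>xs. \<Sum>i\<in>I. subdivide b (F i) xs)"
  by (simp add: subdivide_def subdivide_aux_sum fun_eq_iff)

text \<open>
  The recursive formula for the coboundary is dual to the formula for the boundary of a cone; the
  boundary terms of the inner cones cancel by induction because the coboundary squares to zero.
\<close>

lemma coboundary_subdivide_aux:
  "length xs = Suc n \<Longrightarrow>
    coboundary (subdivide_aux b n F) xs = subdivide_aux b (Suc n) (coboundary F) xs"
proof (induction n arbitrary: F xs)
  case 0
  then show ?case by (cases xs) simp_all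
next
  case (Suc n)
  let ?F = "\<lambda>ys. F (b xs # ys)"
  have "subdivide_aux b (Suc (Suc n)) (coboundary F) xs =
      coboundary (subdivide_aux b (Suc n) F) xs -
      coboundary (subdivide_aux b (Suc n) (coboundary ?F)) xs"
    unfolding subdivide_aux.simps(2)[of b "Suc n"] coboundary.simps
      subdivide_aux_diff coboundary_diff ..
  also have "coboundary (subdivide_aux b (Suc n) (coboundary ?F)) xs =
      coboundary (coboundary (subdivide_aux b n ?F)) xs"
    by (rule coboundary_cong) (use Suc in \<open>simp del: subdivide_aux.simps\<close>)
  finally show ?case by (simp del: subdivide_aux.simps)
qed

lemma coboundary_subdivide: "coboundary (subdivide b F) = subdivide b (coboundary F)"
proof
  fix xs
  show "coboundary (subdivide b F) xs = subdivide b (coboundary F) xs"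
  proof (cases "length xs")
    case (Suc n)
    have "coboundary (subdivide b F) xs = coboundary (subdivide_aux b n F) xs"
      by (rule coboundary_cong) (use Suc in \<open>simp add: subdivide_def\<close>)
    then show ?thesis using Suc coboundary_subdivide_aux[OF Suc] by (simp add: subdivide_def)
  qed simp
qed

text \<open>The simplices of the subdivision are the flags of faces, listed from the largest down.\<close>

definition flag :: "'v list list \<Rightarrow> 'v list \<Rightarrow> bool" where
  "flag zss xs \<longleftrightarrow> length zss = length xs \<and> sorted_wrt (\<lambda>u w. subseq w u) zss \<and>
    (\<forall>u\<in>set zss. u \<noteq> [] \<and> subseq u xs)"

lemma subdivide_aux_dvd:
  assumes "n = length xs" "\<And>zss. flag zss xs \<Longrightarrow> P dvd F (map b zss)"
  shows "P dvd subdivide_aux b n F xs"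
  using assms
proof (induction n arbitrary: F xs)
  case 0
  then show ?case using 0(2)[of "[]"] by (simp add: flag_def)
next
  case (Suc n)
  have "P dvd coboundary (subdivide_aux b n (\<lambda>ys. F (b xs # ys))) xs"
  proof (rule coboundary_dvd, rule Suc.IH)
    fix ys zss assume ys: "subseq ys xs" "Suc (length ys) = length xs" and "flag zss ys"
    then have "flag (xs # zss) xs" 
      by (fastforce simp: flag_def intro: subseq_order.trans)
    then show "P dvd F (b xs # map b zss)" using Suc.prems(2)[of "xs # zss"] by simp
  qed (use Suc in auto)
  then show ?case by simp
qed

lemma subdivide_cong_dvd:
  assumes "\<And>zss. flag zss xs \<Longrightarrow> P dvd F (map b zss) - F' (map b zss)"
  shows "P dvd subdivide b F xs - subdivide b F' xs"
  using subdivide_aux_dvd[of "length xs" xs P "\<lambda>ys. F ys - F' ys" b] assms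
  by (simp add: subdivide_def subdivide_aux_diff)

lemma subdivide_map:
  assumes "\<And>ys. ys \<noteq> [] \<Longrightarrow> subseq ys xs \<Longrightarrow> b (map h ys) = h' (b ys)"
  shows "subdivide b F (map h xs) = subdivide b (\<lambda>ys. F (map h' ys)) xs"
proof -
  have "subdivide_aux b n F (map h xs) = subdivide_aux b n (\<lambda>ys. F (map h' ys)) xs"
    if "n = length xs" for n
    using assms that
  proof (induction n arbitrary: F xs)
    case (Suc n)
    then have "xs \<noteq> []" by auto
    with Suc.prems(1)[of xs] have b: "b (map h xs) = h' (b xs)" by simp
    have "subdivide_aux b (Suc n) F (map h xs) =
        coboundary (\<lambda>ys. subdivide_aux b n (\<lambda>ys. F (h' (b xs) # ys)) (map h ys)) xs"
      by (simp add: coboundary_map b)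
    also have "\<dots> = coboundary (subdivide_aux b n (\<lambda>ys. F (h' (b xs) # map h' ys))) xs"
      by (rule coboundary_cong, subst Suc.IH)
        (use Suc.prems in \<open>auto intro: subseq_order.trans\<close>)
    finally show ?case by simp
  qed simp
  then show ?thesis by (simp add: subdivide_def)
qed

text \<open>
  Iterated subdivision evaluates a cochain only on iterated flags, so a property \<open>Q t\<close> of
  the simplices after \<open>t\<close> steps that every flag inherits can be assumed in the end.
\<close>

lemma subdivide_pow_cong_dvd:
  assumes "\<And>t xs zss. Q t xs \<Longrightarrow> flag zss xs \<Longrightarrow> Q (Suc t) (map b zss)"
    and "\<And>ys. Q (t + s) ys \<Longrightarrow> P dvd F ys - F' ys"
    and "Q t xs"
  shows "P dvd (subdivide b ^^ s) F xs - (subdivide b ^^ s) F' xs"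
  using assms(2,3)
proof (induction s arbitrary: t xs)
  case (Suc s)
  have "P dvd subdivide b ((subdivide b ^^ s) F) xs - subdivide b ((subdivide b ^^ s) F') xs"
    by (rule subdivide_cong_dvd, rule Suc.IH[of "Suc t"])
      (use Suc.prems assms(1) in auto)
  then show ?case by simp
qed simp


section \<open>The Frobenius identity for commuting operators\<close>

lemma additive_of_nat:
  fixes A :: "'m::comm_ring_1 \<Rightarrow> 'm"
  assumes "\<And>x y. A (x + y) = A x + A y"
  shows "A (of_nat k * x) = of_nat k * A x"
proof -
  have "A 0 = 0" using assms[of 0 0] by simp
  then show ?thesis by (induction k) (simp_all add: assms algebra_simps)
qed

lemma additive_sum:
  fixes A :: "'m::comm_ring_1 \<Rightarrow> 'm"
  assumes "\<And>x y. A (x + y) = A x + A y"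
  shows "A (\<Sum>i\<in>I. f i) = (\<Sum>i\<in>I. A (f i))"
proof -
  have "A 0 = 0" using assms[of 0 0] by simp
  then show ?thesis by (induction I rule: infinite_finite_induct) (simp_all add: assms)
qed

lemma funpow_commute:
  assumes "\<And>x. A (B x) = B (A x)"
  shows "A ((B ^^ n) x) = (B ^^ n) (A x)"
  by (induction n) (simp_all add: assms)

lemma binomial_commuting_operators:
  fixes A B :: "'m::comm_ring_1 \<Rightarrow> 'm"
  assumes A: "\<And>x y. A (x + y) = A x + A y" and B: "\<And>x y. B (x + y) = B x + B y"
    and comm: "\<And>x. A (B x) = B (A x)"
  shows "((\<lambda>x. A x + B x) ^^ n) x = (\<Sum>j\<le>n. of_nat (n choose j) * (A ^^ j) ((B ^^ (n - j)) x))"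
proof (induction n)
  case (Suc n)
  define t where "t j = (A ^^ j) ((B ^^ (Suc n - j)) x)" for j
  have At: "A ((A ^^ j) ((B ^^ (n - j)) x)) = t (Suc j)" for j
    by (simp add: t_def)
  have Bt: "B ((A ^^ j) ((B ^^ (n - j)) x)) = t j" if "j \<le> n" for j
    using that funpow_commute[of B A j "(B ^^ (n - j)) x"] comm by (simp add: t_def Suc_diff_le)
  have "((\<lambda>x. A x + B x) ^^ Suc n) x =
      (\<Sum>j\<le>n. of_nat (n choose j) * t (Suc j)) + (\<Sum>j\<le>n. of_nat (n choose j) * t j)"
    by (simp add: Suc additive_sum[OF A] additive_sum[OF B] additive_of_nat[OF A]
        additive_of_nat[OF B] At Bt)
  also have "(\<Sum>j\<le>n. of_nat (n choose j) * t j) =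
      t 0 + (\<Sum>j\<le>n. of_nat (n choose Suc j) * t (Suc j))"
    using sum.atMost_Suc_shift[of "\<lambda>j. of_nat (n choose j) * t j" n] by (simp add: binomial_eq_0)
  also have "(\<Sum>j\<le>n. of_nat (n choose j) * t (Suc j)) +
      (t 0 + (\<Sum>j\<le>n. of_nat (n choose Suc j) * t (Suc j))) =
      t 0 + (\<Sum>j\<le>n. of_nat (Suc n choose Suc j) * t (Suc j))"
    by (simp add: sum.distrib algebra_simps)
  also have "\<dots> = (\<Sum>j\<le>Suc n. of_nat (Suc n choose j) * t j)"
    using sum.atMost_Suc_shift[of "\<lambda>j. of_nat (Suc n choose j) * t j" n] by simp
  finally show ?case by (simp add: t_def)
qed simp

lemma frobenius_commuting_operators:
  fixes A B :: "'m::comm_ring_1 \<Rightarrow> 'm"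
  assumes A: "\<And>x y. A (x + y) = A x + A y" and B: "\<And>x y. B (x + y) = B x + B y"
    and comm: "\<And>x. A (B x) = B (A x)" and p: "Factorial_Ring.prime p"
  shows "of_nat p dvd ((\<lambda>x. A x + B x) ^^ p) x - ((A ^^ p) x + (B ^^ p) x)"
proof -
  define t where "t j = (A ^^ j) ((B ^^ (p - j)) x)" for j
  have "p \<ge> 2" using p by (simp add: prime_ge_2_nat)
  then obtain q where q: "p = Suc q" "q \<ge> 1" by (cases p) auto
  have "((\<lambda>x. A x + B x) ^^ p) x = (\<Sum>j\<le>p. of_nat (p choose j) * t j)"
    using binomial_commuting_operators[of A B p x] A B comm by (simp add: t_def)
  also have "\<dots> = t 0 + t p + (\<Sum>j\<in>{1..q}. of_nat (p choose j) * t j)"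
  proof -
    have "{..p} = insert 0 (insert p {1..q})" using q by auto
    then show ?thesis using q by (simp add: add.assoc)
  qed
  finally have "((\<lambda>x. A x + B x) ^^ p) x - ((A ^^ p) x + (B ^^ p) x) =
      (\<Sum>j\<in>{1..q}. of_nat (p choose j) * t j)" by (simp add: t_def)
  moreover have "of_nat p dvd (of_nat (p choose j) * t j)" if "j \<in> {1..q}" for j
  proof -
    have "p dvd p choose j"
      using p that q by (intro dvd_choose_prime) auto
    then show ?thesis by (auto elim!: dvdE)
  qed
  ultimately show ?thesis by (auto intro: dvd_sum)
qed

lemma frobenius_sum_operators:
  fixes A :: "'i \<Rightarrow> 'm::comm_ring_1 \<Rightarrow> 'm"
  assumes "finite I" and A: "\<And>i x y. A i (x + y) = A i x + A i y"
    and comm: "\<And>i j x. i \<in> I \<Longrightarrow> j \<in> I \<Longrightarrow> A i (A j x) = A j (A i x)" and p: "Factorial_Ring.prime p"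
  shows "of_nat p dvd ((\<lambda>x. \<Sum>i\<in>I. A i x) ^^ p) x - (\<Sum>i\<in>I. (A i ^^ p) x)"
  using assms(1) comm
proof (induction I rule: finite_induct)
  case empty
  have "((\<lambda>x. 0) ^^ p) x = (0::'m)"
    using p by (cases p) auto
  then show ?case by simp
next
  case (insert i I)
  let ?B = "\<lambda>x. \<Sum>i\<in>I. A i x"
  have "of_nat p dvd ((\<lambda>x. A i x + ?B x) ^^ p) x - ((A i ^^ p) x + (?B ^^ p) x)"
    by (rule frobenius_commuting_operators)
      (use insert p A in \<open>auto simp: sum.distrib additive_sum\<close>)
  moreover have "of_nat p dvd (?B ^^ p) x - (\<Sum>i\<in>I. (A i ^^ p) x)"
    using insert by simp
  ultimately have "of_nat p dvd
      (((\<lambda>x. A i x + ?B x) ^^ p) x - ((A i ^^ p) x + (?B ^^ p) x)) +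
      ((?B ^^ p) x - (\<Sum>i\<in>I. (A i ^^ p) x))"
    by (rule dvd_add)
  then show ?case using insert by (simp add: algebra_simps)
qed

lemma frobenius_sum_ring:
  fixes a :: "'i \<Rightarrow> 'm::comm_ring_1"
  assumes "finite I" "Factorial_Ring.prime p"
  shows "of_nat p dvd (\<Sum>i\<in>I. a i) ^ p - (\<Sum>i\<in>I. a i ^ p)"
proof -
  have pow: "((\<lambda>x. c * x) ^^ n) 1 = c ^ n" for c :: 'm and n
    by (induction n) simp_all
  show ?thesis
    using frobenius_sum_operators[of I "\<lambda>i x. a i * x" p 1] assms
    by (simp add: distrib_left mult.left_commute pow sum_distrib_right[symmetric])
qed


section \<open>Nilpotent operators with a canonical conjugate\<close>

text \<open>
  Let \<open>z\<close> be an operator for which there is an operator \<open>D\<close> with \<open>[z, D] = c\<close>, a scalar. Modulo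
  \<open>p\<close> this makes every Jordan block of \<open>z\<close> of full size \<open>p\<close>: multiplying the formulas below by
  the inverse of a factorial, which is invertible modulo \<open>p\<close>, and of a power of \<open>c\<close>,
  one finds that \<open>ker z = im z ^ (p - 1)\<close> and
  \<open>ker z ^ (p - 1) = im z\<close>. All congruences are modulo an ideal \<open>N\<close>.
\<close>

locale conjugate_operators =
  fixes N :: "'m::comm_ring_1 \<Rightarrow> bool" and z D :: "'m \<Rightarrow> 'm" and c :: 'm
  assumes N_0: "N 0" and N_diff: "N x \<Longrightarrow> N y \<Longrightarrow> N (x - y)" and N_mult: "N x \<Longrightarrow> N (y * x)"
    and z_add: "z (x + y) = z x + z y" and D_add: "D (x + y) = D x + D y"
    and N_z: "N x \<Longrightarrow> N (z x)" and N_D: "N x \<Longrightarrow> N (D x)"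
    and z_c: "z (c * x) = c * z x" and D_c: "D (c * x) = c * D x"
    and commutator: "N (z (D x) - D (z x) - c * x)"
begin

lemma N_add: "N x \<Longrightarrow> N y \<Longrightarrow> N (x + y)"
  using N_diff[of x "0 - y"] N_diff[of 0 y] N_0 by simp

lemma z_diff: "z (x - y) = z x - z y"
  using z_add[of "x - y" y] by (simp add: algebra_simps)

lemma D_diff: "D (x - y) = D x - D y"
  using D_add[of "x - y" y] by (simp add: algebra_simps)

lemma z_scalar: "z (of_nat k * (c ^ j * x)) = of_nat k * (c ^ j * z x)"
proof -
  have "z (c ^ j * x) = c ^ j * z x" by (induction j) (simp_all add: z_c mult.assoc)
  then show ?thesis by (simp add: additive_of_nat[OF z_add])
qed

lemma D_scalar: "D (of_nat k * (c ^ j * x)) = of_nat k * (c ^ j * D x)"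
proof -
  have "D (c ^ j * x) = c ^ j * D x" by (induction j) (simp_all add: D_c mult.assoc)
  then show ?thesis by (simp add: additive_of_nat[OF D_add])
qed

lemma z_pow_diff: "(z ^^ n) (x - y) = (z ^^ n) x - (z ^^ n) y"
  by (induction n) (simp_all add: z_diff)

lemma z_pow_scalar: "(z ^^ n) (of_nat k * (c ^ j * x)) = of_nat k * (c ^ j * (z ^^ n) x)"
  by (induction n) (simp_all add: z_scalar)

lemma N_z_pow: "N x \<Longrightarrow> N ((z ^^ n) x)"
  by (induction n) (simp_all add: N_z)

lemma z_D_pow:
  assumes "N (z v)"
  shows "N (z ((D ^^ Suc j) v) - of_nat (Suc j) * (c ^ 1 * (D ^^ j) v))"
proof (induction j)
  case 0
  show ?case using N_add[OF commutator[of v] N_D[OF assms]] by simp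
next
  case (Suc j)
  let ?y = "(D ^^ Suc j) v"
  have "N (D (z ?y - of_nat (Suc j) * (c ^ 1 * (D ^^ j) v)))"
    using N_D[OF Suc] .
  then have "N (D (z ?y) - of_nat (Suc j) * (c ^ 1 * ?y))"
    unfolding D_diff D_scalar by simp
  from N_add[OF commutator[of ?y] this] show ?case
    by (simp add: algebra_simps)
qed

lemma kernel_z:
  assumes "N (z v)"
  shows "N ((z ^^ j) ((D ^^ j) v) - of_nat (fact j) * (c ^ j * v))"
proof (induction j)
  case 0
  show ?case using N_0 by simp
next
  case (Suc j)
  have "N ((z ^^ j) (z ((D ^^ Suc j) v) - of_nat (Suc j) * (c ^ 1 * (D ^^ j) v)))"
    by (rule N_z_pow, rule z_D_pow, rule assms)
  then have "N ((z ^^ Suc j) ((D ^^ Suc j) v) -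
      of_nat (Suc j) * (c * (z ^^ j) ((D ^^ j) v)))"
    unfolding z_pow_diff z_pow_scalar by (simp add: funpow_swap1)
  from N_add[OF this N_mult[OF Suc, of "of_nat (Suc j) * c"]] show ?case
    by (simp add: algebra_simps)
qed

lemma z_pow_D: "N ((z ^^ Suc k) (D v) - D ((z ^^ Suc k) v) - of_nat (Suc k) * (c ^ 1 * (z ^^ k) v))"
proof (induction k)
  case 0
  show ?case using commutator[of v] by simp
next
  case (Suc k)
  have "N (z ((z ^^ Suc k) (D v) - D ((z ^^ Suc k) v) - of_nat (Suc k) * (c ^ 1 * (z ^^ k) v)))"
    using N_z[OF Suc] .
  then have "N ((z ^^ Suc (Suc k)) (D v) - z (D ((z ^^ Suc k) v)) -
      of_nat (Suc k) * (c ^ 1 * (z ^^ Suc k) v))"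
    unfolding z_diff z_scalar by simp
  from N_add[OF this commutator[of "(z ^^ Suc k) v"]] show ?case
    by (simp add: algebra_simps)
qed

lemma kernel_z_pow:
  assumes "N ((z ^^ k) v)"
  shows "\<exists>w. N (of_nat (fact k) * (c ^ k * v) - z w)"
  using assms
proof (induction k arbitrary: v)
  case 0
  have "z 0 = 0" using z_add[of 0 0] by simp
  then show ?case using 0 by (intro exI[of _ 0]) simp
next
  case (Suc k)
  let ?u = "z (D v) - of_nat (Suc k) * (c ^ 1 * v)"
  have "N ((z ^^ Suc k) (D v) - of_nat (Suc k) * (c ^ 1 * (z ^^ k) v))"
    using N_add[OF z_pow_D[of k v] N_D[OF Suc.prems]] by (simp add: algebra_simps)
  then have "N ((z ^^ k) ?u)"
    unfolding z_pow_diff z_pow_scalar by (simp add: funpow_swap1)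
  then obtain w where w: "N (of_nat (fact k) * (c ^ k * ?u) - z w)"
    using Suc.IH by blast
  have "z (of_nat (fact k) * (c ^ k * D v) - w) = of_nat (fact k) * (c ^ k * z (D v)) - z w"
    by (simp add: z_diff z_scalar)
  then have "of_nat (fact (Suc k)) * (c ^ Suc k * v) - z (of_nat (fact k) * (c ^ k * D v) - w) =
      0 - (of_nat (fact k) * (c ^ k * ?u) - z w)"
    by (simp add: algebra_simps)
  then show ?case using N_diff[OF N_0 w] by metis
qed

end


section \<open>Elementary abelian groups\<close>

locale elementary_abelian = comm_group G for G (structure) +
  fixes p :: nat
  assumes finite_carrier: "finite (carrier G)"
    and prime_p: "Factorial_Ring.prime p"
    and exponent: "g \<in> carrier G \<Longrightarrow> g [^] p = \<one>"
begin

lemma pow_mod: "a [^] (n mod p) = a [^] n" if "a \<in> carrier G"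
proof -
  have "a [^] n = a [^] (p * (n div p) + n mod p)" by simp
  also have "\<dots> = (a [^] p) [^] (n div p) \<otimes> a [^] (n mod p)"
    unfolding nat_pow_mult[OF that, symmetric] nat_pow_pow[OF that] ..
  finally show ?thesis using that by (simp add: exponent)
qed

text \<open>
  Let \<open>M\<close> be maximal among the proper subgroups that contain \<open>H\<close>, and \<open>a \<notin> M\<close>. Then every element
  is \<open>a [^] j \<otimes> h\<close> with \<open>h \<in> M\<close> and a unique \<open>j < p\<close>, and \<open>j\<close> is a character modulo \<open>p\<close>.
\<close>

lemma exists_character:
  assumes H: "subgroup H G" "H \<noteq> carrier G"
  obtains \<xi> :: "'a \<Rightarrow> nat" where
    "\<And>g. g \<in> carrier G \<Longrightarrow> \<xi> g < p"
    "\<And>g h. g \<in> carrier G \<Longrightarrow> h \<in> carrier G \<Longrightarrow> \<xi> (g \<otimes> h) = (\<xi> g + \<xi> h) mod p"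
    "\<And>h. h \<in> H \<Longrightarrow> \<xi> h = 0"
    "\<exists>g\<in>carrier G. \<xi> g \<noteq> 0"
proof -
  let ?S = "{M. subgroup M G \<and> H \<subseteq> M \<and> M \<noteq> carrier G}"
  have "finite ?S"
    by (rule finite_subset[of _ "Pow (carrier G)"]) (auto simp: finite_carrier dest: subgroup.subset)
  moreover have "H \<in> ?S" using H by auto
  ultimately obtain M where M: "M \<in> ?S" and max: "\<And>M'. M' \<in> ?S \<Longrightarrow> M \<subseteq> M' \<Longrightarrow> M = M'"
    using finite_has_maximal[of ?S] by (metis (lifting) empty_iff)
  have sM: "subgroup M G" using M by simp
  then have MG: "M \<subseteq> carrier G" by (rule subgroup.subset)
  then obtain a where a: "a \<in> carrier G" "a \<notin> M" using M by auto
  let ?M' = "{a [^] j \<otimes> h | (j::nat) h. h \<in> M}"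
  have sM': "subgroup ?M' G"
  proof (rule subgroupI)
    show "?M' \<subseteq> carrier G" using a MG by auto
    show "?M' \<noteq> {}" using subgroup.one_closed[OF sM] by auto
  next
    fix x assume "x \<in> ?M'"
    then obtain j :: nat and h where x: "x = a [^] j \<otimes> h" "h \<in> M" by auto
    have "inv (a [^] j) = a [^] (j * (p - 1))"
    proof (rule inv_equality)
      have "j * (p - 1) + j = p * j"
        using prime_gt_0_nat[OF prime_p] by (simp add: algebra_simps diff_mult_distrib)
      then have "a [^] (j * (p - 1)) \<otimes> a [^] j = (a [^] p) [^] j"
        by (simp only: nat_pow_mult[OF a(1)] nat_pow_pow[OF a(1)])
      then show "a [^] (j * (p - 1)) \<otimes> a [^] j = \<one>"
        using a by (simp add: exponent)
    qed (use a in auto)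
    then have "inv x = a [^] (j * (p - 1)) \<otimes> inv h"
      using x a MG by (auto simp: inv_mult)
    then show "inv x \<in> ?M'" using x subgroup.m_inv_closed[OF sM] by blast
  next
    fix x y assume "x \<in> ?M'" "y \<in> ?M'"
    then obtain i j :: nat and h k where
      *: "x = a [^] i \<otimes> h" "h \<in> M" "y = a [^] j \<otimes> k" "k \<in> M" by auto
    then have "h \<in> carrier G" "k \<in> carrier G" using MG by auto
    then have "x \<otimes> y = a [^] (i + j) \<otimes> (h \<otimes> k)"
      using a * by (simp add: nat_pow_mult[symmetric] m_ac)
    then show "x \<otimes> y \<in> ?M'" using * subgroup.m_closed[OF sM] by blast
  qed
  have "M \<subseteq> ?M'"
  proof
    fix h assume "h \<in> M"
    then show "h \<in> ?M'" using MG by (intro CollectI exI[of _ "0::nat"] exI[of _ h]) auto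
  qed
  moreover have "a \<in> ?M'"
    using a subgroup.one_closed[OF sM] by (intro CollectI exI[of _ "1::nat"] exI[of _ \<one>]) auto
  moreover have "?M' \<in> ?S" if "?M' \<noteq> carrier G"
    using that sM' M \<open>M \<subseteq> ?M'\<close> by (intro CollectI conjI) auto
  ultimately have M': "?M' = carrier G"
    using max[of ?M'] a(2) by blast
  have ex: "\<exists>j h. j < p \<and> h \<in> M \<and> g = a [^] j \<otimes> h" if "g \<in> carrier G" for g
  proof -
    obtain j h where "g = a [^] (j::nat) \<otimes> h" "h \<in> M" using M' \<open>g \<in> carrier G\<close> by blast
    then show ?thesis using pow_mod[OF a(1), of j] prime_gt_0_nat[OF prime_p]
      by (intro exI[of _ "j mod p"] exI[of _ h]) auto
  qed
  have le: "j \<le> i" if eq: "a [^] i \<otimes> h = a [^] j \<otimes> k" and "h \<in> M" "k \<in> M" "i < p" "j < p"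
    for i j :: nat and h k
  proof (rule ccontr)
    assume "\<not> j \<le> i"
    define d where "d = j - i"
    have d: "0 < d" "d < p" "j = i + d" using \<open>\<not> j \<le> i\<close> that by (auto simp: d_def)
    have hk: "h \<in> carrier G" "k \<in> carrier G" using that MG by auto
    have "a [^] i \<otimes> h = a [^] i \<otimes> (a [^] d \<otimes> k)"
      using eq d a hk by (simp add: nat_pow_mult[symmetric] m_assoc)
    then have "h = a [^] d \<otimes> k" using a hk by simp
    then have "a [^] d = h \<otimes> inv k" using a hk by (simp add: inv_solve_right)
    then have adM: "a [^] d \<in> M"
      using that subgroup.m_closed[OF sM] subgroup.m_inv_closed[OF sM] by simp
    have "coprime d p"
      using d prime_p by (metis coprime_commute nat_dvd_not_less prime_imp_coprime)
    then obtain e where e: "[d * e = 1] (mod p)" using cong_solve_coprime_nat[of d p] by auto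
    have "(a [^] d) [^] e \<in> M"
      by (induction e) (use adM sM in \<open>auto intro: subgroup.m_closed subgroup.one_closed\<close>)
    moreover have "(a [^] d) [^] e = a"
      using a e pow_mod[OF a(1), of "d * e"] pow_mod[OF a(1), of 1]
      by (simp add: nat_pow_pow cong_def)
    ultimately show False using a by simp
  qed
  define \<xi> where "\<xi> g = (SOME j. j < p \<and> (\<exists>h\<in>M. g = a [^] j \<otimes> h))" for g
  have \<xi>: "\<xi> g < p \<and> (\<exists>h\<in>M. g = a [^] (\<xi> g) \<otimes> h)" if "g \<in> carrier G" for g
    unfolding \<xi>_def by (rule someI_ex) (use ex[OF that] in blast)
  have \<xi>_eq: "\<xi> (a [^] j \<otimes> h) = j mod p" if "h \<in> M" for j h
  proof -
    have *: "a [^] j \<otimes> h = a [^] (j mod p) \<otimes> h" using pow_mod[OF a(1)] by simp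
    have "a [^] j \<otimes> h \<in> carrier G" using a that MG by auto
    from \<xi>[OF this] obtain k where k: "k \<in> M" "\<xi> (a [^] j \<otimes> h) < p"
      "a [^] (j mod p) \<otimes> h = a [^] \<xi> (a [^] j \<otimes> h) \<otimes> k" unfolding *[symmetric] by blast
    have jp: "j mod p < p" using prime_gt_0_nat[OF prime_p] by simp
    show ?thesis
      using le[OF k(3) that k(1) jp k(2)] le[OF k(3)[symmetric] k(1) that k(2) jp] by simp
  qed
  show thesis
  proof (rule that)
    show "\<xi> g < p" if "g \<in> carrier G" for g using \<xi>[OF that] by simp
    show "\<xi> (g \<otimes> h) = (\<xi> g + \<xi> h) mod p" if gh: "g \<in> carrier G" "h \<in> carrier G" for g h
    proof -
      obtain k where k: "k \<in> M" "g = a [^] (\<xi> g) \<otimes> k" using \<xi>[OF gh(1)] by blast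
      obtain l where l: "l \<in> M" "h = a [^] (\<xi> h) \<otimes> l" using \<xi>[OF gh(2)] by blast
      have kl: "k \<in> carrier G" "l \<in> carrier G" using k l MG by auto
      have "g \<otimes> h = (a [^] (\<xi> g) \<otimes> k) \<otimes> (a [^] (\<xi> h) \<otimes> l)" using k l by simp
      also have "\<dots> = a [^] (\<xi> g + \<xi> h) \<otimes> (k \<otimes> l)"
        using a kl by (simp add: nat_pow_mult[symmetric] m_ac)
      finally show ?thesis
        using \<xi>_eq[OF subgroup.m_closed[OF sM k(1) l(1)]] by simp
    qed
    show "\<xi> h = 0" if "h \<in> H" for h
    proof -
      have "h \<in> M" using that M by auto
      then show ?thesis using \<xi>_eq[of h 0] MG by auto
    qed
    have "\<xi> a = 1 mod p"
      using \<xi>_eq[of \<one> 1] a subgroup.one_closed[OF sM] by simp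
    then show "\<exists>g\<in>carrier G. \<xi> g \<noteq> 0"
      using a prime_gt_1_nat[OF prime_p] by (intro bexI[of _ a]) auto
  qed
qed

end


section \<open>Shifted operators on functions on a set with group action\<close>

lemma sum_fun_apply: "(\<Sum>i\<in>I. f i) x = (\<Sum>i\<in>I. f i x)"
  by (induction I rule: infinite_finite_induct) simp_all

lemma dvd_diff_swap: "P dvd a - b \<Longrightarrow> P dvd b - a" for P :: "'c::comm_ring_1"
  by (metis dvd_minus_iff minus_diff_eq)

lemma not_of_nat_prime_dvd:
  assumes "prime_elem (of_nat p :: 'c::idom)" "Factorial_Ring.prime p" "\<not> p dvd k"
  shows "\<not> of_nat p dvd (of_nat k :: 'c)"
proof
  assume *: "of_nat p dvd (of_nat k :: 'c)"
  have "coprime (int p) (int k)" using assms(2,3) by (simp add: prime_imp_coprime)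
  then obtain a b where "a * int p + b * int k = 1"
    by (metis bezout_int coprime_iff_gcd_eq_1)
  then have "of_int a * of_nat p + of_int b * of_nat k = (1::'c)"
    by (metis of_int_1 of_int_add of_int_mult of_int_of_nat_eq)
  moreover have "of_nat p dvd of_int a * of_nat p + of_int b * (of_nat k :: 'c)"
    using * by simp
  ultimately have "of_nat p dvd (1::'c)" by simp
  then show False using assms(1) by (simp add: prime_elem_def)
qed

lemma prime_elem_dvd_prod:
  fixes P :: "'c::idom"
  assumes "prime_elem P" "finite A" "P dvd (\<Prod>a\<in>A. f a)"
  shows "\<exists>a\<in>A. P dvd f a"
  using assms(2,3)
  by (induction A rule: finite_induct)
    (use assms(1) in \<open>auto simp: prime_elem_def\<close>)

context elementary_abelian
begin

text \<open>
  Actions on whole types make the operators below commute as functions, not only up to their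
  values on an invariant set.
\<close>

definition acts :: "('a \<Rightarrow> 'x \<Rightarrow> 'x) \<Rightarrow> bool" where
  "acts \<rho> \<longleftrightarrow> (\<forall>x. \<rho> \<one> x = x) \<and>
    (\<forall>g\<in>carrier G. \<forall>h\<in>carrier G. \<forall>x. \<rho> (g \<otimes> h) x = \<rho> g (\<rho> h x))"

lemma acts_one: "acts \<rho> \<Longrightarrow> \<rho> \<one> x = x"
  by (simp add: acts_def)

lemma acts_mult:
  "acts \<rho> \<Longrightarrow> g \<in> carrier G \<Longrightarrow> h \<in> carrier G \<Longrightarrow> \<rho> (g \<otimes> h) x = \<rho> g (\<rho> h x)"
  by (simp add: acts_def)

lemma acts_commute:
  "acts \<rho> \<Longrightarrow> g \<in> carrier G \<Longrightarrow> h \<in> carrier G \<Longrightarrow> \<rho> g (\<rho> h x) = \<rho> h (\<rho> g x)"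
  by (metis acts_mult m_comm)

lemma acts_inv:
  "acts \<rho> \<Longrightarrow> g \<in> carrier G \<Longrightarrow> \<rho> (inv g) (\<rho> g x) = x"
  by (metis acts_mult acts_one inv_closed l_inv)

lemma acts_map: "acts \<rho> \<Longrightarrow> acts (\<lambda>g. map (\<rho> g))"
  by (auto simp: acts_def map_idI)

text \<open>
  An element of the group algebra, acting on functions. Its coefficients may vary from orbit to
  orbit.
\<close>

definition shift_op :: "('a \<Rightarrow> 'x \<Rightarrow> 'x) \<Rightarrow> ('x \<Rightarrow> 'a \<Rightarrow> 'c::comm_ring_1) \<Rightarrow> ('x \<Rightarrow> 'c) \<Rightarrow> 'x \<Rightarrow> 'c"
  where "shift_op \<rho> a F x = (\<Sum>g\<in>carrier G. a x g * F (\<rho> g x))"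

lemma shift_op_add: "shift_op \<rho> a (F + F') = shift_op \<rho> a F + shift_op \<rho> a F'"
  by (simp add: shift_op_def fun_eq_iff algebra_simps sum.distrib)

lemma shift_op_diff: "shift_op \<rho> a (F - F') = shift_op \<rho> a F - shift_op \<rho> a F'"
  by (simp add: shift_op_def fun_eq_iff algebra_simps sum_subtractf)

lemma shift_op_mult_invariant:
  assumes "\<And>g x. g \<in> carrier G \<Longrightarrow> c (\<rho> g x) = c x"
  shows "shift_op \<rho> a (c * F) = c * shift_op \<rho> a F"
  by (simp add: shift_op_def fun_eq_iff sum_distrib_left assms mult.left_commute)

lemma shift_op_commute:
  assumes "acts \<rho>"
    and a: "\<And>g h x. g \<in> carrier G \<Longrightarrow> h \<in> carrier G \<Longrightarrow> a (\<rho> h x) g = a x g"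
    and b: "\<And>g h x. g \<in> carrier G \<Longrightarrow> h \<in> carrier G \<Longrightarrow> b (\<rho> h x) g = b x g"
  shows "shift_op \<rho> a (shift_op \<rho> b F) = shift_op \<rho> b (shift_op \<rho> a F)"
proof
  fix x
  have "shift_op \<rho> a (shift_op \<rho> b F) x =
      (\<Sum>g\<in>carrier G. \<Sum>h\<in>carrier G. a x g * (b x h * F (\<rho> h (\<rho> g x))))"
    by (simp add: shift_op_def sum_distrib_left b)
  also have "\<dots> = (\<Sum>h\<in>carrier G. \<Sum>g\<in>carrier G. b x h * (a x g * F (\<rho> g (\<rho> h x))))"
    by (subst sum.swap, intro sum.cong refl)
      (simp add: acts_commute[OF assms(1)] mult.left_commute)
  also have "\<dots> = shift_op \<rho> b (shift_op \<rho> a F) x"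
    by (simp add: shift_op_def sum_distrib_left a)
  finally show "shift_op \<rho> a (shift_op \<rho> b F) x = shift_op \<rho> b (shift_op \<rho> a F) x" .
qed

lemma shift_op_dvd:
  assumes "\<And>g x. g \<in> carrier G \<Longrightarrow> x \<in> T \<Longrightarrow> \<rho> g x \<in> T"
    and "\<And>x. x \<in> T \<Longrightarrow> P dvd F x" and "x \<in> T"
  shows "P dvd shift_op \<rho> a F x"
  unfolding shift_op_def by (intro dvd_sum dvd_mult) (use assms in auto)

lemma shift_op_pow_dvd:
  assumes "\<And>g x. g \<in> carrier G \<Longrightarrow> x \<in> T \<Longrightarrow> \<rho> g x \<in> T"
    and "\<And>x. x \<in> T \<Longrightarrow> P dvd F x" and "x \<in> T"
  shows "P dvd (shift_op \<rho> a ^^ n) F x"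
  using assms(3)
proof (induction n arbitrary: x)
  case (Suc n)
  then show ?case using shift_op_dvd[of T \<rho> P "(shift_op \<rho> a ^^ n) F"] assms(1) by simp
qed (simp add: assms(2))

text \<open>
  The mixed terms of the \<open>p\<close>-th power are divisible by \<open>p\<close>, and \<open>g [^] p\<close> acts as the identity.
\<close>

lemma shift_op_frobenius:
  assumes \<rho>: "acts \<rho>"
    and a: "\<And>g h x. g \<in> carrier G \<Longrightarrow> h \<in> carrier G \<Longrightarrow> a (\<rho> h x) g = a x g"
  shows "of_nat p dvd (shift_op \<rho> a ^^ p) F x - (\<Sum>g\<in>carrier G. a x g) ^ p * F x"
proof -
  define A where "A g F = (\<lambda>x. a x g * F (\<rho> g x))" for g and F
  have "(A g ^^ n) F x = a x g ^ n * F (\<rho> (g [^] n) x)" if g: "g \<in> carrier G" for g n x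
    by (induction n arbitrary: x) (simp_all add: A_def acts_one[OF \<rho>] acts_mult[OF \<rho>] a g mult.assoc)
  then have A_pow: "(A g ^^ p) F x = a x g ^ p * F x" if "g \<in> carrier G" for g x
    using that by (simp add: exponent acts_one[OF \<rho>])
  have op: "(\<lambda>F. \<Sum>g\<in>carrier G. A g F) = shift_op \<rho> a"
    by (simp add: fun_eq_iff shift_op_def A_def sum_fun_apply)
  have "of_nat p dvd ((\<lambda>F. \<Sum>g\<in>carrier G. A g F) ^^ p) F - (\<Sum>g\<in>carrier G. (A g ^^ p) F)"
  proof (rule frobenius_sum_operators)
    show "A g (F + F') = A g F + A g F'" for g F F'
      by (simp add: A_def fun_eq_iff algebra_simps)
    show "A g (A h F) = A h (A g F)" if "g \<in> carrier G" "h \<in> carrier G" for g h F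
      using that by (simp add: A_def fun_eq_iff a acts_commute[OF \<rho>] mult.left_commute)
  qed (simp_all add: finite_carrier prime_p)
  then obtain R where R: "(shift_op \<rho> a ^^ p) F - (\<Sum>g\<in>carrier G. (A g ^^ p) F) = of_nat p * R"
    unfolding op by (auto elim: dvdE)
  have "(shift_op \<rho> a ^^ p) F x - (\<Sum>g\<in>carrier G. a x g ^ p * F x) = of_nat p * R x"
    using fun_cong[OF R, of x] by (simp add: sum_fun_apply A_pow)
  moreover have "of_nat p dvd ((\<Sum>g\<in>carrier G. a x g) ^ p - (\<Sum>g\<in>carrier G. a x g ^ p)) * F x"
    by (intro dvd_mult2 frobenius_sum_ring finite_carrier prime_p)
  ultimately have "of_nat p dvd
      ((shift_op \<rho> a ^^ p) F x - (\<Sum>g\<in>carrier G. a x g ^ p * F x)) -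
      ((\<Sum>g\<in>carrier G. a x g) ^ p - (\<Sum>g\<in>carrier G. a x g ^ p)) * F x"
    by (metis dvd_diff dvd_triv_left)
  then show ?thesis by (simp add: algebra_simps sum_distrib_left)
qed

definition nonzero_characters :: "('a \<Rightarrow> nat) set" where
  "nonzero_characters = {\<xi> \<in> carrier G \<rightarrow>\<^sub>E {..<p}. \<xi> \<one> = 0 \<and> (\<exists>g\<in>carrier G. \<xi> g \<noteq> 0)}"

lemma finite_nonzero_characters: "finite nonzero_characters"
  by (rule finite_subset[of _ "carrier G \<rightarrow>\<^sub>E {..<p}"])
    (auto simp: nonzero_characters_def finite_carrier intro: finite_PiE)

text \<open>
  On an orbit \<open>G/H\<close> with \<open>H\<close> a proper subgroup, a character vanishing on \<open>H\<close> is a function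
  \<open>\<theta>\<close> on the orbit, up to the choice of a base point.
\<close>

lemma exists_phase:
  assumes \<rho>: "acts \<rho>"
    and T: "\<And>g x. g \<in> carrier G \<Longrightarrow> x \<in> T \<Longrightarrow> \<rho> g x \<in> T"
    and nofix: "\<And>x. x \<in> T \<Longrightarrow> \<exists>g\<in>carrier G. \<rho> g x \<noteq> x"
  obtains \<theta> :: "'x \<Rightarrow> nat" and \<xi> :: "'x \<Rightarrow> 'a \<Rightarrow> nat" where
    "\<And>g x. g \<in> carrier G \<Longrightarrow> x \<in> T \<Longrightarrow> [\<theta> (\<rho> g x) = \<theta> x + \<xi> x g] (mod p)"
    "\<And>h x. h \<in> carrier G \<Longrightarrow> \<xi> (\<rho> h x) = \<xi> x"
    "\<And>x. x \<in> T \<Longrightarrow> \<xi> x \<in> nonzero_characters"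
proof -
  define stab where "stab x = {g \<in> carrier G. \<rho> g x = x}" for x
  have stab_shift: "stab (\<rho> h x) = stab x" if "h \<in> carrier G" for h x
  proof -
    have "\<rho> g (\<rho> h x) = \<rho> h x \<longleftrightarrow> \<rho> g x = x" if g: "g \<in> carrier G" for g
    proof
      assume "\<rho> g (\<rho> h x) = \<rho> h x"
      then have "\<rho> (inv h) (\<rho> h (\<rho> g x)) = \<rho> (inv h) (\<rho> h x)"
        using acts_commute[OF \<rho> g \<open>h \<in> carrier G\<close>, of x] by simp
      then show "\<rho> g x = x" using acts_inv[OF \<rho> \<open>h \<in> carrier G\<close>] by simp
    next
      assume "\<rho> g x = x"
      then show "\<rho> g (\<rho> h x) = \<rho> h x"
        using acts_commute[OF \<rho> g \<open>h \<in> carrier G\<close>, of x] by simp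
    qed
    then show ?thesis by (auto simp: stab_def)
  qed
  have stab_subgroup: "subgroup (stab x) G" for x
  proof (rule subgroupI)
    show "stab x \<noteq> {}" using acts_one[OF \<rho>] by (auto simp: stab_def)
    show "inv g \<in> stab x" if "g \<in> stab x" for g
      using that acts_inv[OF \<rho>, of g x] by (auto simp: stab_def)
  qed (auto simp: stab_def acts_mult[OF \<rho>])
  have stab_proper: "stab x \<noteq> carrier G" if "x \<in> T" for x
    using nofix[OF that] by (auto simp: stab_def)
  define is_char where "is_char H \<xi> \<longleftrightarrow> \<xi> \<in> nonzero_characters \<and> (\<forall>h\<in>H. \<xi> h = 0) \<and>
    (\<forall>g\<in>carrier G. \<forall>h\<in>carrier G. \<xi> (g \<otimes> h) = (\<xi> g + \<xi> h) mod p)" for H \<xi>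
  have ex_char: "\<exists>\<xi>. is_char H \<xi>" if H: "subgroup H G" "H \<noteq> carrier G" for H
  proof -
    obtain \<xi> where \<xi>: "\<And>g. g \<in> carrier G \<Longrightarrow> \<xi> g < p"
      "\<And>g h. g \<in> carrier G \<Longrightarrow> h \<in> carrier G \<Longrightarrow> \<xi> (g \<otimes> h) = (\<xi> g + \<xi> h) mod p"
      "\<And>h. h \<in> H \<Longrightarrow> \<xi> h = 0" "\<exists>g\<in>carrier G. \<xi> g \<noteq> 0"
      by (rule exists_character[OF H]) (rule that)
    have "is_char H (restrict \<xi> (carrier G))"
      using \<xi> subgroup.subset[OF H(1)] subgroup.one_closed[OF H(1)]
      by (auto simp: is_char_def nonzero_characters_def)
    then show ?thesis by blast
  qed
  define \<xi> where "\<xi> x = (if x \<in> T then (SOME \<xi>. is_char (stab x) \<xi>) else (\<lambda>_. 0))" for x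
  have \<xi>: "is_char (stab x) (\<xi> x)" if "x \<in> T" for x
    using someI_ex[OF ex_char[OF stab_subgroup stab_proper[OF that]]] that by (simp add: \<xi>_def)
  have T_iff: "\<rho> h x \<in> T \<longleftrightarrow> x \<in> T" if "h \<in> carrier G" for h x
    using T[of h x] T[of "inv h" "\<rho> h x"] that by (auto simp: acts_inv[OF \<rho>])
  have \<xi>_shift: "\<xi> (\<rho> h x) = \<xi> x" if "h \<in> carrier G" for h x
    using that by (simp add: \<xi>_def stab_shift T_iff)
  define orb where "orb x = (\<lambda>g. \<rho> g x) ` carrier G" for x
  have orb_shift: "orb (\<rho> h x) = orb x" if h: "h \<in> carrier G" for h x
  proof -
    have "orb (\<rho> h x) = (\<lambda>g. \<rho> (g \<otimes> h) x) ` carrier G"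
      unfolding orb_def by (intro image_cong refl) (simp add: acts_mult[OF \<rho>] h)
    also have "\<dots> = (\<lambda>g. \<rho> g x) ` ((\<lambda>g. g \<otimes> h) ` carrier G)"
      by (simp add: image_image)
    also have "(\<lambda>g. g \<otimes> h) ` carrier G = carrier G"
    proof
      show "carrier G \<subseteq> (\<lambda>g. g \<otimes> h) ` carrier G"
      proof
        fix g assume "g \<in> carrier G"
        then have "g = (g \<otimes> inv h) \<otimes> h" using h by (simp add: m_assoc)
        then show "g \<in> (\<lambda>g. g \<otimes> h) ` carrier G" using h \<open>g \<in> carrier G\<close> by blast
      qed
    qed (use h in auto)
    finally show ?thesis by (simp add: orb_def)
  qed
  define base where "base x = (SOME y. y \<in> orb x)" for x
  have base_shift: "base (\<rho> h x) = base x" if "h \<in> carrier G" for h x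
    using that by (simp add: base_def orb_shift)
  have "\<exists>g. g \<in> carrier G \<and> \<rho> g (base x) = x" for x
  proof -
    have "orb x \<noteq> {}" by (auto simp: orb_def)
    then have "base x \<in> orb x" unfolding base_def by (simp add: some_in_eq)
    then obtain k where "k \<in> carrier G" "base x = \<rho> k x" by (auto simp: orb_def)
    then show ?thesis using acts_inv[OF \<rho>] by (intro exI[of _ "inv k"]) auto
  qed
  then obtain pos where pos: "\<And>x. pos x \<in> carrier G" "\<And>x. \<rho> (pos x) (base x) = x"
    by metis
  define \<theta> where "\<theta> x = \<xi> x (pos x)" for x
  have "[\<theta> (\<rho> g x) = \<theta> x + \<xi> x g] (mod p)" if g: "g \<in> carrier G" and x: "x \<in> T" for g x
  proof -
    define s where "s = inv (g \<otimes> pos x) \<otimes> pos (\<rho> g x)"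
    have s: "s \<in> carrier G" using g pos by (simp add: s_def)
    have pos_g: "pos (\<rho> g x) = (g \<otimes> pos x) \<otimes> s"
      using g pos by (simp add: s_def m_assoc[symmetric])
    have "\<rho> (pos (\<rho> g x)) (base x) = \<rho> g x" using pos(2)[of "\<rho> g x"] base_shift[OF g] by simp
    also have "\<dots> = \<rho> (g \<otimes> pos x) (base x)" using pos[of x] g by (simp add: acts_mult[OF \<rho>])
    finally have "\<rho> (pos (\<rho> g x)) (base x) = \<rho> (g \<otimes> pos x) (base x)" .
    moreover have "\<rho> s (base x) = \<rho> (inv (g \<otimes> pos x)) (\<rho> (pos (\<rho> g x)) (base x))"
      unfolding s_def by (rule acts_mult[OF \<rho>]) (use g pos in auto)
    ultimately have "\<rho> s (base x) = base x"
      using acts_inv[OF \<rho>, of "g \<otimes> pos x" "base x"] g pos by simp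
    then have "s \<in> stab (base x)" using s by (simp add: stab_def)
    then have "s \<in> stab x" using stab_shift[OF pos(1)[of x], of "base x"] pos(2) by simp
    then have "\<xi> x s = 0" using \<xi>[OF x] by (simp add: is_char_def)
    then have "\<theta> (\<rho> g x) = ((\<xi> x g + \<xi> x (pos x)) mod p + 0) mod p"
      using \<xi>[OF x] g pos s by (simp add: \<theta>_def \<xi>_shift is_char_def pos_g)
    then show ?thesis by (simp add: \<theta>_def cong_def add.commute)
  qed
  moreover have "\<xi> x \<in> nonzero_characters" if "x \<in> T" for x
    using \<xi>[OF that] by (simp add: is_char_def)
  ultimately show thesis using that \<xi>_shift by blast
qed

text \<open>
  Multiplication by a phase \<open>\<theta>\<close> with character \<open>\<xi>\<close> has the commutator \<open>U = \<Sum>g. \<alpha> g * \<xi> g * g\<close> with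
  \<open>z = \<Sum>g. \<alpha> g * g\<close>. Modulo \<open>p\<close>, the operator \<open>U ^ p\<close> is the scalar \<open>(\<Sum>g. \<alpha> g * \<xi> g) ^ p\<close>, not zero by the
  choice of \<open>\<alpha>\<close>; hence the commutator of \<open>z\<close> with \<open>U ^ (p - 1) \<theta>\<close> is this scalar, and the formulas for
  conjugate operators apply. If the \<open>\<alpha> g\<close> add up to zero, so that \<open>z ^ p\<close> vanishes modulo \<open>p\<close>, the conclusion
  is that all Jordan blocks of \<open>z\<close> on functions on \<open>T\<close> have size \<open>p\<close>.
\<close>

lemma shift_op_exact:
  fixes \<alpha> :: "'a \<Rightarrow> 'c::idom" and \<rho> :: "'a \<Rightarrow> 'x \<Rightarrow> 'x"
  assumes \<rho>: "acts \<rho>"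
    and T: "\<And>g x. g \<in> carrier G \<Longrightarrow> x \<in> T \<Longrightarrow> \<rho> g x \<in> T"
    and nofix: "\<And>x. x \<in> T \<Longrightarrow> \<exists>g\<in>carrier G. \<rho> g x \<noteq> x"
    and P: "prime_elem (of_nat p :: 'c)"
    and \<alpha>: "\<And>\<xi>. \<xi> \<in> nonzero_characters \<Longrightarrow> \<not> of_nat p dvd (\<Sum>g\<in>carrier G. \<alpha> g * of_nat (\<xi> g))"
  defines "z \<equiv> shift_op \<rho> (\<lambda>_. \<alpha>)"
  obtains c where "\<not> of_nat p dvd c"
    "\<And>v. (\<And>x. x \<in> T \<Longrightarrow> of_nat p dvd z v x) \<Longrightarrow>
      \<exists>w. \<forall>x\<in>T. of_nat p dvd c * v x - (z ^^ (p - 1)) w x"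
    "\<And>v. (\<And>x. x \<in> T \<Longrightarrow> of_nat p dvd (z ^^ (p - 1)) v x) \<Longrightarrow>
      \<exists>w. \<forall>x\<in>T. of_nat p dvd c * v x - z w x"
proof -
  obtain \<theta> \<xi> where \<theta>: "\<And>g x. g \<in> carrier G \<Longrightarrow> x \<in> T \<Longrightarrow> [\<theta> (\<rho> g x) = \<theta> x + \<xi> x g] (mod p)"
    and \<xi>_shift: "\<And>h x. h \<in> carrier G \<Longrightarrow> \<xi> (\<rho> h x) = \<xi> x"
    and \<xi>: "\<And>x. x \<in> T \<Longrightarrow> \<xi> x \<in> nonzero_characters"
    by (rule exists_phase[OF \<rho> T nofix]) (assumption | rule that)+
  define c0 where "c0 \<xi> = (\<Sum>g\<in>carrier G. \<alpha> g * of_nat (\<xi> g))" for \<xi>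
  define C where "C = (\<Prod>\<xi>\<in>nonzero_characters. c0 \<xi> ^ p)"
  \<comment> \<open>The scalar \<open>c0 (\<xi> x) ^ p\<close> depends on the orbit of \<open>x\<close>; the factor \<open>q\<close> makes it the same everywhere.\<close>
  define q where "q x = (\<Prod>\<xi>\<in>nonzero_characters - {\<xi> x}. c0 \<xi> ^ p)" for x
  have q: "q x * c0 (\<xi> x) ^ p = C" if "x \<in> T" for x
    using prod.remove[OF finite_nonzero_characters \<xi>[OF that], of "\<lambda>\<xi>. c0 \<xi> ^ p"]
    by (simp add: C_def q_def mult.commute)
  have C: "\<not> of_nat p dvd C"
  proof
    assume "of_nat p dvd C"
    then obtain \<xi> where "\<xi> \<in> nonzero_characters" "of_nat p dvd c0 \<xi> ^ p"
      unfolding C_def using prime_elem_dvd_prod[OF P finite_nonzero_characters] by blast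
    then show False
      using \<alpha> prime_elem_dvd_power[OF P] unfolding c0_def by blast
  qed
  define U where "U = shift_op \<rho> (\<lambda>x g. \<alpha> g * of_nat (\<xi> x g))"
  define \<theta>' :: "'x \<Rightarrow> 'c" where "\<theta>' x = of_nat (\<theta> x)" for x
  define D where "D F = q * (U ^^ (p - 1)) (\<theta>' * F)" for F
  define N where "N F \<longleftrightarrow> (\<forall>x\<in>T. of_nat p dvd F x)" for F :: "'x \<Rightarrow> 'c"
  have p: "Suc (p - 1) = p" using prime_gt_0_nat[OF prime_p] by simp
  have z_U: "z ((U ^^ n) F) = (U ^^ n) (z F)" for n F
    by (rule funpow_commute) (simp add: z_def U_def shift_op_commute[OF \<rho>] \<xi>_shift)
  have U_diff: "(U ^^ n) (F - F') = (U ^^ n) F - (U ^^ n) F'" for n F F'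
    by (induction n) (simp_all only: funpow.simps comp_apply id_apply U_def shift_op_diff)
  have U_add: "(U ^^ n) (F + F') = (U ^^ n) F + (U ^^ n) F'" for n F F'
    by (induction n) (simp_all only: funpow.simps comp_apply id_apply U_def shift_op_add)
  have U_const: "(U ^^ n) ((\<lambda>_. k) * F) = (\<lambda>_. k) * (U ^^ n) F" for n F k
    by (induction n) (simp_all only: funpow.simps comp_apply id_apply U_def shift_op_mult_invariant)
  have z_q: "z (q * F) = q * z F" for F
    unfolding z_def by (rule shift_op_mult_invariant) (simp add: q_def \<xi>_shift)
  have N_U: "N ((U ^^ n) F)" if "N F" for n F
    using that T unfolding N_def U_def by (auto intro!: shift_op_pow_dvd[of T])
  have [simp]: "N 0" by (simp add: N_def)
  have N_minus: "N (F - F')" if "N F" "N F'" for F F'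
    using that by (simp add: N_def)
  have N_plus: "N (F + F')" if "N F" "N F'" for F F'
    using that by (simp add: N_def)
  have N_times: "N (F' * F)" if "N F" for F F'
    using that by (simp add: N_def)
  interpret conjugate_operators N z D "\<lambda>_. C"
  proof
    show "N (F - F')" if "N F" "N F'" for F F' using that by (rule N_minus)
    show "N (F' * F)" if "N F" for F F' using that by (rule N_times)
    show "z (F + F') = z F + z F'" for F F' by (simp add: z_def shift_op_add)
    show "D (F + F') = D F + D F'" for F F' by (simp add: D_def distrib_left U_add)
    show "N (z F)" if "N F" for F
      using that T unfolding N_def z_def by (auto intro!: shift_op_dvd[of T])
    show "N (D F)" if "N F" for F
      unfolding D_def using that by (intro N_times N_U)
    show "z ((\<lambda>_. C) * F) = (\<lambda>_. C) * z F" for F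
      unfolding z_def by (rule shift_op_mult_invariant) simp
    show "D ((\<lambda>_. C) * F) = (\<lambda>_. C) * D F" for F
    proof -
      have "\<theta>' * ((\<lambda>_. C) * F) = (\<lambda>_. C) * (\<theta>' * F)" by (rule mult.left_commute)
      then show ?thesis unfolding D_def by (simp only: U_const) (rule mult.left_commute)
    qed
    show "N (z (D F) - D (z F) - (\<lambda>_. C) * F)" for F
    proof -
      have "N (z (\<theta>' * F) - \<theta>' * z F - U F)"
        unfolding N_def
      proof
        fix x assume x: "x \<in> T"
        have "(z (\<theta>' * F) - \<theta>' * z F - U F) x =
            (\<Sum>g\<in>carrier G. \<alpha> g * F (\<rho> g x) * (\<theta>' (\<rho> g x) - (\<theta>' x + of_nat (\<xi> x g))))"
          by (simp add: z_def U_def shift_op_def sum_distrib_left sum_subtractf sum.distrib algebra_simps)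
        moreover have "of_nat p dvd \<theta>' (\<rho> g x) - (\<theta>' x + of_nat (\<xi> x g))" if "g \<in> carrier G" for g
        proof -
          have "int p dvd int (\<theta> (\<rho> g x)) - int (\<theta> x + \<xi> x g)"
            using \<theta>[OF that x] by (simp add: cong_iff_dvd_diff flip: cong_int_iff)
          then obtain k where "int (\<theta> (\<rho> g x)) - int (\<theta> x + \<xi> x g) = int p * k" by (auto elim: dvdE)
          then have "(of_int (int (\<theta> (\<rho> g x)) - int (\<theta> x + \<xi> x g)) :: 'c) = of_int (int p * k)" by simp
          then show ?thesis by (simp add: \<theta>'_def)
        qed
        ultimately show "of_nat p dvd (z (\<theta>' * F) - \<theta>' * z F - U F) x"
          by (auto intro!: dvd_sum)
      qed
      from N_U[OF this, of "p - 1"]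
      have "N ((U ^^ (p - 1)) (z (\<theta>' * F)) - (U ^^ (p - 1)) (\<theta>' * z F) - (U ^^ p) F)"
        unfolding U_diff by (metis funpow_Suc_right comp_apply p)
      from N_times[OF this, of q]
      have *: "N (z (D F) - D (z F) - q * (U ^^ p) F)"
        by (simp add: D_def z_q z_U algebra_simps)
      have "N (q * (U ^^ p) F - (\<lambda>_. C) * F)"
        unfolding N_def
      proof
        fix x assume "x \<in> T"
        have "of_nat p dvd q x * ((U ^^ p) F x - c0 (\<xi> x) ^ p * F x)"
          unfolding U_def c0_def by (intro dvd_mult shift_op_frobenius \<rho>) (simp add: \<xi>_shift)
        then show "of_nat p dvd (q * (U ^^ p) F - (\<lambda>_. C) * F) x"
          using q[OF \<open>x \<in> T\<close>] by (simp add: right_diff_distrib mult.assoc[symmetric])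
      qed
      have "(a - b) + (b - c) = a - c" for a b c :: "'x \<Rightarrow> 'c" by simp
      from N_plus[OF * \<open>N (q * (U ^^ p) F - (\<lambda>_. C) * F)\<close>, unfolded this] show ?thesis .
    qed
  qed simp
  let ?c = "of_nat (fact (p - 1)) * C ^ (p - 1)"
  have const: "(of_nat (fact (p - 1)) * ((\<lambda>_. C) ^ (p - 1) * v)) x = ?c * v x" for v :: "'x \<Rightarrow> 'c" and x
  proof -
    have "((\<lambda>_. C) ^ n :: 'x \<Rightarrow> 'c) x = C ^ n" for n by (induction n) simp_all
    then show ?thesis by (simp add: mult.assoc)
  qed
  have "\<not> p dvd fact (p - 1)"
    using prime_dvd_fact_iff[OF prime_p] prime_gt_0_nat[OF prime_p] by auto
  then have "\<not> of_nat p dvd (of_nat (fact (p - 1)) :: 'c)"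
    by (rule not_of_nat_prime_dvd[OF P prime_p])
  then have "\<not> of_nat p dvd ?c"
    using C P prime_elem_dvd_power[OF P] by (auto simp: prime_elem_dvd_mult_iff)
  then show thesis
  proof (rule that)
    fix v assume "\<And>x. x \<in> T \<Longrightarrow> of_nat p dvd z v x"
    then have "N (z v)" by (simp add: N_def)
    from kernel_z[OF this, of "p - 1"]
    have "\<forall>x\<in>T. of_nat p dvd (z ^^ (p - 1)) ((D ^^ (p - 1)) v) x - ?c * v x"
      by (simp only: N_def minus_apply const)
    then show "\<exists>w. \<forall>x\<in>T. of_nat p dvd ?c * v x - (z ^^ (p - 1)) w x"
      using dvd_diff_swap by blast
  next
    fix v assume "\<And>x. x \<in> T \<Longrightarrow> of_nat p dvd (z ^^ (p - 1)) v x"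
    then have "N ((z ^^ (p - 1)) v)" by (simp add: N_def)
    from kernel_z_pow[OF this]
    show "\<exists>w. \<forall>x\<in>T. of_nat p dvd ?c * v x - z w x"
      by (simp only: N_def minus_apply const)
  qed
qed

end

text \<open>
  Such coefficients exist over the polynomials: distinct powers of the indeterminate are linearly
  independent modulo \<open>p\<close>.
\<close>

lemma (in elementary_abelian) exists_generic_coefficients:
  obtains \<alpha> :: "'a \<Rightarrow> int poly" where "(\<Sum>g\<in>carrier G. \<alpha> g) = 0"
    "\<And>\<xi>. \<xi> \<in> nonzero_characters \<Longrightarrow> \<not> of_nat p dvd (\<Sum>g\<in>carrier G. \<alpha> g * of_nat (\<xi> g))"
proof -
  obtain idx :: "'a \<Rightarrow> nat" where idx: "inj_on idx (carrier G)"
    using finite_carrier finite_imp_inj_to_nat_seg by metis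
  let ?G = "carrier G - {\<one>}"
  define \<alpha> :: "'a \<Rightarrow> int poly" where
    "\<alpha> g = (if g = \<one> then - (\<Sum>g\<in>?G. monom 1 (idx g)) else monom 1 (idx g))" for g
  show thesis
  proof (rule that[of \<alpha>])
    show "(\<Sum>g\<in>carrier G. \<alpha> g) = 0"
      using sum.remove[OF finite_carrier one_closed, of \<alpha>] by (simp add: \<alpha>_def)
    fix \<xi> assume \<xi>: "\<xi> \<in> nonzero_characters"
    then obtain h where h: "h \<in> carrier G" "\<xi> h \<noteq> 0" "h \<noteq> \<one>"
      unfolding nonzero_characters_def by fastforce
    have "\<xi> h < p" using \<xi> h by (auto simp: nonzero_characters_def)
    have "(\<Sum>g\<in>carrier G. \<alpha> g * of_nat (\<xi> g)) = (\<Sum>g\<in>?G. monom 1 (idx g) * of_nat (\<xi> g))"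
      using sum.remove[OF finite_carrier one_closed, of "\<lambda>g. \<alpha> g * of_nat (\<xi> g)"] \<xi>
      by (simp add: \<alpha>_def nonzero_characters_def)
    moreover have "coeff (monom 1 (idx g) * of_nat (\<xi> g)) (idx h) = (if g = h then int (\<xi> g) else 0)"
      if "g \<in> carrier G" for g
      using that h(1) by (cases "g = h") (auto simp: of_nat_poly inj_on_eq_iff[OF idx])
    ultimately have "coeff (\<Sum>g\<in>carrier G. \<alpha> g * of_nat (\<xi> g)) (idx h) =
        (\<Sum>g\<in>?G. if g = h then int (\<xi> g) else 0)"
      by (simp add: coeff_sum)
    also have "\<dots> = int (\<xi> h)" using h finite_carrier by simp
    finally have "\<not> int p dvd coeff (\<Sum>g\<in>carrier G. \<alpha> g * of_nat (\<xi> g)) (idx h)"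
      using h(2) \<open>\<xi> h < p\<close> by (auto dest: zdvd_imp_le)
    then show "\<not> of_nat p dvd (\<Sum>g\<in>carrier G. \<alpha> g * of_nat (\<xi> g))"
      by (auto simp: of_nat_poly const_poly_dvd_iff)
  qed
qed

lemma (in elementary_abelian) prime_elem_of_nat_int_poly: "prime_elem (of_nat p :: int poly)"
  using prime_p by (simp add: of_nat_poly lift_prime_elem_poly)


section \<open>An equivariant pullback of cochains needs enough levels\<close>

text \<open>
  A label lies in one of the levels \<open>1, \<dots>, N\<close>; the simplices spanned by labels have one vertex in
  each of a set of levels. For the labels of each level forming one orbit, this is a join
  of orbits.
\<close>

definition level_simplices :: "('l \<Rightarrow> nat) \<Rightarrow> 'l set \<Rightarrow> 'l list set" where
  "level_simplices lev \<Lambda> = {ys. sorted_wrt (\<lambda>a b. lev a < lev b) ys \<and> set ys \<subseteq> \<Lambda>}"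

lemma subseq_level_simplices:
  "zs \<in> level_simplices lev \<Lambda>" if "subseq zs ys" "ys \<in> level_simplices lev \<Lambda>"
  using that subseq_sorted_wrt[of zs ys] set_subseq[of zs ys]
  by (auto simp: level_simplices_def)

lemma length_level_simplices:
  assumes "ys \<in> level_simplices lev \<Lambda>" "lev ` \<Lambda> \<subseteq> {1..N}"
  shows "length ys \<le> N"
proof -
  have "sorted_wrt (<) (map lev ys)"
    using assms(1) by (simp only: level_simplices_def sorted_wrt_map mem_Collect_eq)
  then have "length ys = card (set (map lev ys))"
    by (metis distinct_card length_map strict_sorted_iff)
  also have "\<dots> \<le> card {1..N}"
    by (rule card_mono) (use assms in \<open>auto simp: level_simplices_def\<close>)
  finally show ?thesis by simp
qed

context elementary_abelian
begin

lemma coboundary_shift_op: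
  "coboundary (shift_op (\<lambda>g. map (\<rho> g)) (\<lambda>_. \<alpha>) F) = shift_op (\<lambda>g. map (\<rho> g)) (\<lambda>_. \<alpha>) (coboundary F)"
proof
  fix xs
  show "coboundary (shift_op (\<lambda>g. map (\<rho> g)) (\<lambda>_. \<alpha>) F) xs =
      shift_op (\<lambda>g. map (\<rho> g)) (\<lambda>_. \<alpha>) (coboundary F) xs"
    unfolding shift_op_def[abs_def] by (simp add: coboundary_sum coboundary_scale coboundary_map)
qed

lemma coboundary_shift_op_pow:
  "coboundary ((shift_op (\<lambda>g. map (\<rho> g)) (\<lambda>_. \<alpha>) ^^ n) F) =
    (shift_op (\<lambda>g. map (\<rho> g)) (\<lambda>_. \<alpha>) ^^ n) (coboundary F)"
  by (induction n) (simp_all add: coboundary_shift_op)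

lemma shift_op_pow_diff: "(shift_op \<rho> a ^^ n) (F - F') = (shift_op \<rho> a ^^ n) F - (shift_op \<rho> a ^^ n) F'"
  by (induction n) (simp_all only: funpow.simps comp_apply id_apply shift_op_diff)

lemma shift_op_pow_add: "(shift_op \<rho> a ^^ n) (F + F') = (shift_op \<rho> a ^^ n) F + (shift_op \<rho> a ^^ n) F'"
  by (induction n) (simp_all only: funpow.simps comp_apply id_apply shift_op_add)

lemma shift_op_pow_const: "(shift_op \<rho> a ^^ n) ((\<lambda>_. k) * F) = (\<lambda>_. k) * (shift_op \<rho> a ^^ n) F"
  by (induction n) (simp_all only: funpow.simps comp_apply id_apply shift_op_mult_invariant)

lemma shift_op_Nil:
  assumes "(\<Sum>g\<in>carrier G. \<alpha> g) = 0" "n > 0"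
  shows "(shift_op (\<lambda>g. map (\<rho> g)) (\<lambda>_. \<alpha>) ^^ n) F [] = 0"
  using assms by (cases n) (simp_all add: shift_op_def sum_distrib_right[symmetric])

text \<open>
  All that is used of an equivariant map from the \<open>m\<close>-fold join to a complex on \<open>N\<close> levels is the
  pullback \<open>\<Phi>\<close> of cochains.

  Let \<open>z\<close> be as in \<open>shift_op_exact\<close>, and call a cochain \<open>v\<close> of degree \<open>l - 1\<close> on the labels good
  if its coboundary is annihilated by \<open>z\<close> (\<open>l\<close> even) or by \<open>z ^ (p - 1)\<close> (\<open>l\<close> odd). By
  exactness this coboundary is, up to a scalar, the image under the other operator of a
  cochain \<open>w\<close>, which is good in turn. On the join, which is acyclic, one concludes from the top
  degree downwards that the pullback of a good cochain is, again up to a scalar, the sum of a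
  coboundary and of an element of the image of this other operator. In degree \<open>-1\<close> the constant \<open>1\<close> is good, whereas
  coboundaries and the image of \<open>z\<close> vanish there.
\<close>

theorem no_equivariant_pullback:
  fixes \<Phi> :: "('l list \<Rightarrow> 'c::idom) \<Rightarrow> (nat \<times> 'i) list \<Rightarrow> 'c"
    and \<rho> :: "'a \<Rightarrow> 'l \<Rightarrow> 'l" and \<sigma> :: "'a \<Rightarrow> nat \<times> 'i \<Rightarrow> nat \<times> 'i"
  assumes P: "prime_elem (of_nat p :: 'c)"
    and \<alpha>0: "(\<Sum>g\<in>carrier G. \<alpha> g) = (0 :: 'c)"
    and \<alpha>: "\<And>\<xi>. \<xi> \<in> nonzero_characters \<Longrightarrow> \<not> of_nat p dvd (\<Sum>g\<in>carrier G. \<alpha> g * of_nat (\<xi> g))"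
    and \<rho>: "acts \<rho>" and \<sigma>: "acts \<sigma>"
    and \<Lambda>: "\<And>g l. g \<in> carrier G \<Longrightarrow> l \<in> \<Lambda> \<Longrightarrow> \<rho> g l \<in> \<Lambda> \<and> lev (\<rho> g l) = lev l"
    and nofix: "\<And>l. l \<in> \<Lambda> \<Longrightarrow> \<exists>g\<in>carrier G. \<rho> g l \<noteq> l"
    and lev: "lev ` \<Lambda> \<subseteq> {1..N}"
    and I: "I \<noteq> {}"
    and X: "\<And>g xs. g \<in> carrier G \<Longrightarrow> xs \<in> join_simplices m I \<Longrightarrow> map (\<sigma> g) xs \<in> join_simplices m I"
    and \<Phi>_scale: "\<And>c F. \<Phi> (\<lambda>ys. c * F ys) = (\<lambda>xs. c * \<Phi> F xs)"
    and \<Phi>_sum: "\<And>F. \<Phi> (\<lambda>ys. \<Sum>g\<in>carrier G. F g ys) = (\<lambda>xs. \<Sum>g\<in>carrier G. \<Phi> (F g) xs)"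
    and \<Phi>_Nil: "\<And>F. \<Phi> F [] = F []"
    and \<Phi>_cong: "\<And>P F F' xs. xs \<in> join_simplices m I \<Longrightarrow>
      (\<And>ys. ys \<in> level_simplices lev \<Lambda> \<Longrightarrow> length ys = length xs \<Longrightarrow> P dvd F ys - F' ys) \<Longrightarrow>
      P dvd \<Phi> F xs - \<Phi> F' xs"
    and \<Phi>_coboundary: "\<And>F xs. xs \<in> join_simplices m I \<Longrightarrow> coboundary (\<Phi> F) xs = \<Phi> (coboundary F) xs"
    and \<Phi>_equivariant: "\<And>g F xs. g \<in> carrier G \<Longrightarrow> xs \<in> join_simplices m I \<Longrightarrow>
      \<Phi> F (map (\<sigma> g) xs) = \<Phi> (\<lambda>ys. F (map (\<rho> g) ys)) xs"
  shows "m \<le> N"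
proof (rule ccontr)
  assume "\<not> m \<le> N"
  then have Nm: "N < m" by simp
  let ?X = "join_simplices m I" and ?E = "level_simplices lev \<Lambda>"
  define P :: 'c where "P = of_nat p"
  have p2: "p \<ge> 2" using prime_p by (simp add: prime_ge_2_nat)
  define z where "z = shift_op (\<lambda>g. map (\<rho> g)) (\<lambda>_. \<alpha>)"
  define y where "y = shift_op (\<lambda>g. map (\<sigma> g)) (\<lambda>_. \<alpha>)"
  define d where "d l = (if odd l then p - 1 else 1)" for l :: nat
  have d: "d l + d (Suc l) = p" "d l > 0" for l using p2 by (auto simp: d_def)
  have E: "map (\<rho> g) ys \<in> ?E" if "g \<in> carrier G" "ys \<in> ?E" for g ys
    using that \<Lambda> unfolding level_simplices_def
    by (auto simp: sorted_wrt_map subset_iff elim!: sorted_wrt_mono_rel[rotated])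
  have y_pow_p: "P dvd (y ^^ p) F xs" for F xs
    using shift_op_frobenius[OF acts_map[OF \<sigma>], of "\<lambda>_. \<alpha>" F xs] p2
    by (simp add: y_def P_def \<alpha>0 zero_power)
  have y_dvd: "P dvd (y ^^ n) F xs" if "xs \<in> ?X" "\<And>ys. ys \<in> ?X \<Longrightarrow> length ys = length xs \<Longrightarrow> P dvd F ys"
    for n F xs
    unfolding y_def
    by (rule shift_op_pow_dvd[of "{ys \<in> ?X. length ys = length xs}"]) (use that X in auto)
  have \<Phi>_z: "\<Phi> (z F) xs = y (\<Phi> F) xs" if "xs \<in> ?X" for F xs
    unfolding z_def y_def shift_op_def[abs_def]
    by (simp add: \<Phi>_sum \<Phi>_scale \<Phi>_equivariant that)
  have \<Phi>_z_pow: "\<Phi> ((z ^^ n) F) xs = (y ^^ n) (\<Phi> F) xs" if "xs \<in> ?X" for n F xs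
    using that
  proof (induction n arbitrary: xs)
    case (Suc n)
    have "y F1 xs = y F2 xs" if "\<And>g. g \<in> carrier G \<Longrightarrow> F1 (map (\<sigma> g) xs) = F2 (map (\<sigma> g) xs)"
      for F1 F2 using that by (simp add: y_def shift_op_def)
    from this[of "\<Phi> ((z ^^ n) F)" "(y ^^ n) (\<Phi> F)"]
    have "y (\<Phi> ((z ^^ n) F)) xs = y ((y ^^ n) (\<Phi> F)) xs" using Suc X by blast
    then show ?case using \<Phi>_z[OF Suc.prems] by simp
  qed simp
  have exact: "\<exists>c. \<not> P dvd c \<and> (\<forall>v. (\<forall>ys\<in>?E. length ys = Suc l \<longrightarrow> P dvd (z ^^ d l) v ys) \<longrightarrow>
      (\<exists>w. \<forall>ys\<in>?E. length ys = Suc l \<longrightarrow> P dvd c * v ys - (z ^^ d (Suc l)) w ys))" for l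
  proof -
    let ?T = "{ys \<in> ?E. length ys = Suc l}"
    have nofix': "\<exists>g\<in>carrier G. map (\<rho> g) ys \<noteq> ys" if ys: "ys \<in> ?T" for ys
    proof -
      obtain a zs where "ys = a # zs" using ys by (cases ys) auto
      then show ?thesis using ys nofix[of a] by (auto simp: level_simplices_def)
    qed
    show ?thesis
    proof (rule shift_op_exact[OF acts_map[OF \<rho>], of ?T \<alpha>])
      fix c assume c: "\<not> of_nat p dvd c"
        "\<And>v. (\<And>x. x \<in> ?T \<Longrightarrow> of_nat p dvd shift_op (\<lambda>g. map (\<rho> g)) (\<lambda>_. \<alpha>) v x) \<Longrightarrow>
          \<exists>w. \<forall>x\<in>?T. of_nat p dvd c * v x - (shift_op (\<lambda>g. map (\<rho> g)) (\<lambda>_. \<alpha>) ^^ (p - 1)) w x"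
        "\<And>v. (\<And>x. x \<in> ?T \<Longrightarrow> of_nat p dvd (shift_op (\<lambda>g. map (\<rho> g)) (\<lambda>_. \<alpha>) ^^ (p - 1)) v x) \<Longrightarrow>
          \<exists>w. \<forall>x\<in>?T. of_nat p dvd c * v x - shift_op (\<lambda>g. map (\<rho> g)) (\<lambda>_. \<alpha>) w x"
      note c' = c[folded z_def P_def]
      show ?thesis
      proof (intro exI[of _ c] conjI allI impI)
        show "\<not> P dvd c" by (rule c'(1))
        fix v assume v: "\<forall>ys\<in>?E. length ys = Suc l \<longrightarrow> P dvd (z ^^ d l) v ys"
        have "\<exists>w. \<forall>ys\<in>?T. P dvd c * v ys - (z ^^ d (Suc l)) w ys"
        proof (cases "odd l")
          case True
          then show ?thesis using v c'(3)[of v] by (simp add: d_def)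
        next
          case False
          then show ?thesis using v c'(2)[of v] by (simp add: d_def)
        qed
        then show "\<exists>w. \<forall>ys\<in>?E. length ys = Suc l \<longrightarrow> P dvd c * v ys - (z ^^ d (Suc l)) w ys"
          by auto
      qed
    qed (use E nofix' P \<alpha> in auto)
  qed
  have good: "\<forall>v. (\<forall>ys\<in>?E. length ys = Suc l \<longrightarrow> P dvd (z ^^ d l) (coboundary v) ys) \<longrightarrow>
    (\<exists>e U W. \<not> P dvd e \<and> (\<forall>xs\<in>?X. length xs = l \<longrightarrow>
      P dvd e * \<Phi> v xs - (coboundary U xs + (y ^^ d (Suc l)) W xs)))" if "l \<le> N" for l
    using that
  proof (induction l rule: inc_induct)
    case base
    show ?case
    proof (intro allI impI)
      fix v
      have "P dvd coboundary (\<Phi> v) xs" if "xs \<in> ?X" "length xs = Suc N" for xs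
      proof -
        have "0 dvd \<Phi> (coboundary v) xs - \<Phi> (\<lambda>_. 0 * 0) xs"
          by (rule \<Phi>_cong[OF that(1)]) (use that length_level_simplices[OF _ lev] in force)
        then show ?thesis
          using \<Phi>_scale[of 0 "\<lambda>_. 0"] by (simp add: \<Phi>_coboundary[OF that(1)])
      qed
      then obtain U where "\<forall>xs\<in>?X. length xs = N \<longrightarrow> P dvd \<Phi> v xs - coboundary U xs"
        using join_acyclic[OF I Nm] by blast
      moreover have "(y ^^ n) (\<lambda>_. 0) xs = 0" for n xs
        by (induction n arbitrary: xs) (simp_all add: y_def shift_op_def)
      moreover have "\<not> P dvd 1" using P by (simp add: P_def prime_elem_def)
      ultimately show "\<exists>e U W. \<not> P dvd e \<and> (\<forall>xs\<in>?X. length xs = N \<longrightarrow>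
          P dvd e * \<Phi> v xs - (coboundary U xs + (y ^^ d (Suc N)) W xs))"
        by (intro exI[of _ 1] exI[of _ U] exI[of _ "\<lambda>_. 0"]) simp
    qed
  next
    case (step l)
    show ?case
    proof (intro allI impI)
      fix v assume v: "\<forall>ys\<in>?E. length ys = Suc l \<longrightarrow> P dvd (z ^^ d l) (coboundary v) ys"
      obtain c where c: "\<not> P dvd c" and "\<exists>w. \<forall>ys\<in>?E. length ys = Suc l \<longrightarrow>
          P dvd c * coboundary v ys - (z ^^ d (Suc l)) w ys"
        using exact[of l] v by blast
      then obtain w where w: "\<And>ys. ys \<in> ?E \<Longrightarrow> length ys = Suc l \<Longrightarrow>
          P dvd c * coboundary v ys - (z ^^ d (Suc l)) w ys" by blast
      have "P dvd (z ^^ d (Suc l)) (coboundary w) ys" if ys: "ys \<in> ?E" "length ys = Suc (Suc l)" for ys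
      proof -
        have "P dvd coboundary (\<lambda>ys. c * coboundary v ys) ys - coboundary ((z ^^ d (Suc l)) w) ys"
          by (rule coboundary_cong_dvd, rule w)
            (use ys in \<open>auto intro: subseq_level_simplices\<close>)
        then show ?thesis
          unfolding z_def coboundary_shift_op_pow by (simp add: coboundary_scale)
      qed
      with step.IH obtain e U W where e: "\<not> P dvd e" and U: "\<And>xs. xs \<in> ?X \<Longrightarrow> length xs = Suc l \<Longrightarrow>
          P dvd e * \<Phi> w xs - (coboundary U xs + (y ^^ d (Suc (Suc l))) W xs)" by blast
      let ?D = "\<lambda>xs. (e * c) * \<Phi> v xs - (y ^^ d (Suc l)) U xs"
      have "P dvd coboundary ?D xs" if xs: "xs \<in> ?X" "length xs = Suc l" for xs
      proof -
        let ?Y = "y ^^ d (Suc l)"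
        have "P dvd ?Y ((\<lambda>_. e) * \<Phi> w - (coboundary U + (y ^^ d (Suc (Suc l))) W)) xs"
          by (rule y_dvd[OF xs(1)]) (use U xs in auto)
        moreover have "?Y ((y ^^ d (Suc (Suc l))) W) = (y ^^ p) W"
          using d(1)[of "Suc l"] by (metis comp_apply funpow_add)
        ultimately have "P dvd e * ?Y (\<Phi> w) xs - (?Y (coboundary U) xs + (y ^^ p) W xs)"
          unfolding y_def shift_op_pow_diff shift_op_pow_add shift_op_pow_const
          by simp
        from dvd_add[OF this y_pow_p[of W xs]]
        have 1: "P dvd e * ?Y (\<Phi> w) xs - ?Y (coboundary U) xs" by simp
        have "P dvd \<Phi> (\<lambda>ys. c * coboundary v ys) xs - \<Phi> ((z ^^ d (Suc l)) w) xs"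
          by (rule \<Phi>_cong) (use w xs in auto)
        then have "P dvd e * (c * coboundary (\<Phi> v) xs - ?Y (\<Phi> w) xs)"
          by (intro dvd_mult) (simp add: \<Phi>_scale \<Phi>_z_pow[OF xs(1)] \<Phi>_coboundary[OF xs(1)])
        from dvd_add[OF this 1]
        have "P dvd (e * c) * coboundary (\<Phi> v) xs - ?Y (coboundary U) xs"
          by (simp add: algebra_simps)
        then show ?thesis
          by (simp add: coboundary_diff coboundary_scale y_def coboundary_shift_op_pow)
      qed
      moreover have "l < m" using step Nm by simp
      ultimately obtain U' where "\<forall>xs\<in>?X. length xs = l \<longrightarrow> P dvd ?D xs - coboundary U' xs"
        using join_acyclic[OF I, of l m P ?D] by blast
      then have "\<forall>xs\<in>?X. length xs = l \<longrightarrow>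
          P dvd (e * c) * \<Phi> v xs - (coboundary U' xs + (y ^^ d (Suc l)) U xs)"
        by (simp add: algebra_simps)
      moreover have "\<not> P dvd e * c"
        using e c P by (auto simp: P_def prime_elem_def)
      ultimately show "\<exists>e U W. \<not> P dvd e \<and> (\<forall>xs\<in>?X. length xs = l \<longrightarrow>
          P dvd e * \<Phi> v xs - (coboundary U xs + (y ^^ d (Suc l)) W xs))" by blast
    qed
  qed
  have "\<exists>e U W. \<not> P dvd e \<and> (\<forall>xs\<in>?X. length xs = 0 \<longrightarrow>
      P dvd e * \<Phi> (\<lambda>_. 1) xs - (coboundary U xs + (y ^^ d (Suc 0)) W xs))"
  proof -
    have z_1: "z (\<lambda>_. 1) = (\<lambda>_. 0)" by (simp add: z_def shift_op_def fun_eq_iff \<alpha>0)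
    have "z (coboundary (\<lambda>_. 1)) ys = 0" for ys
      using coboundary_shift_op[of \<rho> \<alpha> "\<lambda>_. 1"] unfolding z_def[symmetric] z_1
      by (metis coboundary_0)
    then show ?thesis
      using good[of 0] by (simp add: d_def)
  qed
  then obtain e U W where "\<not> P dvd e"
    "P dvd e * \<Phi> (\<lambda>_. 1) [] - (coboundary U [] + (y ^^ d (Suc 0)) W [])" by force
  moreover have "(y ^^ d (Suc 0)) W [] = 0"
    unfolding y_def by (rule shift_op_Nil[OF \<alpha>0 d(2)])
  ultimately show False by (simp add: \<Phi>_Nil)
qed

end


section \<open>Pullback along a labelling of vertices\<close>

text \<open>
  Cochains on the simplices with strictly increasing levels are extended by zero. This
  is compatible with the coboundary also on a degenerate list, in which a label is repeated: the
  two faces that omit one of two equal neighbours cancel.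
\<close>

definition strict_part :: "('l \<Rightarrow> nat) \<Rightarrow> ('l list \<Rightarrow> 'a::comm_ring_1) \<Rightarrow> 'l list \<Rightarrow> 'a" where
  "strict_part lev v ys = (if sorted_wrt (\<lambda>a b. lev a < lev b) ys then v ys else 0)"

lemma coboundary_strict_part:
  assumes "sorted_wrt (\<lambda>a b. lev a \<le> lev b) ys"
    and "\<And>a b. a \<in> set ys \<Longrightarrow> b \<in> set ys \<Longrightarrow> lev a = lev b \<Longrightarrow> a = b"
  shows "coboundary (strict_part lev v) ys = strict_part lev (coboundary v) ys"
  using assms
proof (induction ys arbitrary: v)
  case (Cons x ys)
  show ?case
  proof (cases "sorted_wrt (\<lambda>a b. lev a < lev b) (x # ys)")
    case True
    have "coboundary (strict_part lev v) (x # ys) = coboundary v (x # ys)"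
      by (rule coboundary_cong) (simp add: strict_part_def subseq_sorted_wrt[OF _ True])
    then show ?thesis
      using True by (simp only: strict_part_def[of lev "coboundary v"] if_True)
  next
    case False
    then obtain y zs where ys: "ys = y # zs" by (cases ys) auto
    show ?thesis
    proof (cases "y = x")
      case True
      have "(\<lambda>t. strict_part lev v (x # x # t)) = (\<lambda>_. 0)"
        by (simp add: strict_part_def)
      then have "coboundary (\<lambda>t. strict_part lev v (x # t)) (x # zs) = strict_part lev v (x # zs)"
        by simp
      then have "coboundary (strict_part lev v) (x # ys) = 0"
        using ys True by simp
      then show ?thesis
        using False by (simp only: strict_part_def[of lev "coboundary v"] if_False)
    next
      case neq: False
      have "lev x \<le> lev y" using Cons.prems(1) ys by simp
      moreover have "lev x \<noteq> lev y" using Cons.prems(2)[of x y] neq ys by auto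
      ultimately have "lev x < lev y" by simp
      moreover have "lev y \<le> lev a" if "a \<in> set ys" for a
        using that Cons.prems(1) ys by auto
      ultimately have less: "lev x < lev a" if "a \<in> set ys" for a
        using that by (meson less_le_trans)
      then have not_strict: "\<not> sorted_wrt (\<lambda>a b. lev a < lev b) ys" using False by auto
      have "coboundary (\<lambda>t. strict_part lev v (x # t)) ys =
          coboundary (strict_part lev (\<lambda>t. v (x # t))) ys"
      proof (rule coboundary_cong)
        fix t assume "subseq t ys"
        then have "\<forall>a\<in>set t. lev x < lev a" using less set_subseq by blast
        then show "strict_part lev v (x # t) = strict_part lev (\<lambda>t. v (x # t)) t"
          by (simp add: strict_part_def)
      qed
      also have "\<dots> = strict_part lev (coboundary (\<lambda>t. v (x # t))) ys"
        by (rule Cons.IH) (use Cons.prems in auto)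
      also have "\<dots> = 0"
        using not_strict by (simp add: strict_part_def)
      finally have "coboundary (strict_part lev v) (x # ys) = 0"
        using not_strict by (simp add: strict_part_def[of lev v ys])
      then show ?thesis
        using False by (simp only: strict_part_def[of lev "coboundary v"] if_False)
    qed
  qed
qed (simp add: strict_part_def)

lemma arg_min_list_map:
  assumes "ls \<noteq> []" "\<And>l. lev (h l) = lev l"
  shows "arg_min_list lev (map h ls) = h (arg_min_list lev ls)"
  using assms by (induction lev ls rule: arg_min_list.induct) (simp_all add: Let_def)


section \<open>Barycentric subdivision of points\<close>

definition barycenter :: "('w \<Rightarrow> real) list \<Rightarrow> 'w \<Rightarrow> real" where
  "barycenter xs = (\<lambda>w. (\<Sum>x\<leftarrow>xs. x w) / real (length xs))"

text \<open>
  The invariant of iterated barycentric subdivision inside the simplex spanned by \<open>\<sigma>\<close>: every step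
  shrinks the coordinatewise distance of the vertices by a constant factor, and from the first
  step on the supports of the vertices form a chain.
\<close>

definition small_simplex :: "'w set \<Rightarrow> real \<Rightarrow> nat \<Rightarrow> nat \<Rightarrow> ('w \<Rightarrow> real) list \<Rightarrow> bool" where
  "small_simplex \<sigma> \<kappa> n t ys \<longleftrightarrow> length ys = n \<and>
    (\<forall>y\<in>set ys. (\<forall>w. 0 \<le> y w) \<and> (\<forall>w. w \<notin> \<sigma> \<longrightarrow> y w = 0) \<and> (\<Sum>w\<in>\<sigma>. y w) = 1) \<and>
    (\<forall>y\<in>set ys. \<forall>y'\<in>set ys. \<forall>w. \<bar>y w - y' w\<bar> \<le> \<kappa> ^ t) \<and>
    (t > 0 \<longrightarrow> (\<forall>y\<in>set ys. \<forall>y'\<in>set ys. {w. y w \<noteq> 0} \<subseteq> {w. y' w \<noteq> 0} \<or> {w. y' w \<noteq> 0} \<subseteq> {w. y w \<noteq> 0}))"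

lemma barycenter_distance_bound:
  fixes xs :: "('w \<Rightarrow> real) list"
  assumes "xs \<noteq> []" "\<And>x. x \<in> set xs \<Longrightarrow> \<bar>x w - a\<bar> \<le> d"
  shows "\<bar>barycenter xs w - a\<bar> \<le> d"
proof -
  have "\<bar>(\<Sum>x\<leftarrow>xs. x w) - real (length xs) * a\<bar> \<le> real (length xs) * d"
    using assms(2)
  proof (induction xs)
    case (Cons x xs)
    then have "\<bar>x w - a\<bar> \<le> d" "\<bar>(\<Sum>x\<leftarrow>xs. x w) - real (length xs) * a\<bar> \<le> real (length xs) * d"
      by auto
    then show ?case by (simp add: distrib_right abs_le_iff)
  qed simp
  moreover have "barycenter xs w - a = ((\<Sum>x\<leftarrow>xs. x w) - real (length xs) * a) / real (length xs)"
    using assms(1) by (simp add: barycenter_def diff_divide_distrib)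
  ultimately show ?thesis
    using assms(1) by (simp add: abs_divide divide_le_eq mult.commute)
qed

lemma barycenter_distance_vertex:
  fixes xs :: "('w \<Rightarrow> real) list"
  assumes "y \<in> set xs" "length xs \<le> m" "\<And>x x'. x \<in> set xs \<Longrightarrow> x' \<in> set xs \<Longrightarrow> \<bar>x w - x' w\<bar> \<le> d"
  shows "\<bar>barycenter xs w - y w\<bar> \<le> (1 - 1 / real m) * d"
proof -
  let ?n = "real (length xs)"
  have n: "?n > 0" using assms(1) by (cases xs) auto
  have "d \<ge> 0" using assms(3)[OF assms(1,1)] by simp
  have *: "\<bar>(\<Sum>x\<leftarrow>zs. x w) - real (length zs) * y w\<bar> \<le> real (length zs) * d" if "set zs \<subseteq> set xs" for zs
    using that
  proof (induction zs)
    case (Cons z zs)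
    then have "\<bar>z w - y w\<bar> \<le> d"
      "\<bar>(\<Sum>x\<leftarrow>zs. x w) - real (length zs) * y w\<bar> \<le> real (length zs) * d"
      using assms(3)[of z y] assms(1) by auto
    then show ?case by (simp add: distrib_right abs_le_iff)
  qed simp
  \<comment> \<open>The vertex \<open>y\<close> itself contributes nothing to the sum, which saves one of the \<open>n\<close> terms.\<close>
  obtain us vs where xs: "xs = us @ y # vs" using assms(1) by (meson split_list)
  have "\<bar>(\<Sum>x\<leftarrow>us @ vs. x w) - real (length (us @ vs)) * y w\<bar> \<le> real (length (us @ vs)) * d"
    by (rule *) (auto simp: xs)
  moreover have "(\<Sum>x\<leftarrow>xs. x w) - ?n * y w = (\<Sum>x\<leftarrow>us @ vs. x w) - real (length (us @ vs)) * y w"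
    by (simp add: xs algebra_simps)
  moreover have "real (length (us @ vs)) = ?n - 1" by (simp add: xs)
  ultimately have "\<bar>(\<Sum>x\<leftarrow>xs. x w) - ?n * y w\<bar> \<le> (?n - 1) * d" by simp
  moreover have "barycenter xs w - y w = ((\<Sum>x\<leftarrow>xs. x w) - ?n * y w) / ?n"
    using n by (simp add: barycenter_def diff_divide_distrib)
  ultimately have "\<bar>barycenter xs w - y w\<bar> \<le> (?n - 1) * d / ?n"
    using n by (simp add: abs_divide divide_right_mono)
  also have "\<dots> = (1 - 1 / ?n) * d" using n by (simp add: field_simps)
  also have "\<dots> \<le> (1 - 1 / real m) * d"
    using n assms(2) \<open>d \<ge> 0\<close> by (intro mult_right_mono diff_mono frac_le) auto
  finally show ?thesis .
qed

lemma barycenter_support: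
  assumes "xs \<noteq> []" "\<And>x. x \<in> set xs \<Longrightarrow> 0 \<le> x w"
  shows "barycenter xs w \<noteq> 0 \<longleftrightarrow> (\<exists>x\<in>set xs. x w \<noteq> 0)"
proof -
  have "(\<Sum>x\<leftarrow>xs. x w) = 0 \<longleftrightarrow> (\<forall>x\<in>set xs. x w = 0)"
    using assms(2) by (subst sum_list_nonneg_eq_0_iff) auto
  then show ?thesis using assms(1) by (auto simp: barycenter_def)
qed

lemma small_simplex_subdivide:
  assumes Q: "small_simplex \<sigma> (1 - 1 / real m) n t xs" and flag: "flag zss xs" and "n \<le> m"
  shows "small_simplex \<sigma> (1 - 1 / real m) n (Suc t) (map barycenter zss)"
proof -
  let ?\<kappa> = "1 - 1 / real m"
  have x: "0 \<le> x w" "w \<notin> \<sigma> \<Longrightarrow> x w = 0" "(\<Sum>w\<in>\<sigma>. x w) = 1" if "x \<in> set xs" for x w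
    using Q that by (auto simp: small_simplex_def)
  have dist: "\<bar>x w - x' w\<bar> \<le> ?\<kappa> ^ t" if "x \<in> set xs" "x' \<in> set xs" for x x' w
    using Q that by (auto simp: small_simplex_def)
  have u: "u \<noteq> []" "set u \<subseteq> set xs" "length u \<le> m" if "u \<in> set zss" for u
  proof -
    have sub: "subseq u xs" and len: "length xs \<le> m"
      using flag that Q \<open>n \<le> m\<close> by (auto simp: flag_def small_simplex_def)
    show "set u \<subseteq> set xs" by (rule set_subseq[OF sub])
    show "length u \<le> m" using list_emb_length[OF sub] len by (rule order_trans)
    show "u \<noteq> []" using flag that by (auto simp: flag_def)
  qed
  have nested: "set u \<subseteq> set u' \<or> set u' \<subseteq> set u" if uu: "u \<in> set zss" "u' \<in> set zss" for u u'
  proof -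
    obtain i j where ij: "i < length zss" "u = zss ! i" "j < length zss" "u' = zss ! j"
      using uu by (auto simp: in_set_conv_nth)
    have "sorted_wrt (\<lambda>u w. subseq w u) zss" using flag by (simp add: flag_def)
    then show ?thesis
      using ij set_subseq by (cases i j rule: linorder_cases) (auto dest: sorted_wrt_nth_less)
  qed
  have close: "\<bar>barycenter u w - barycenter u' w\<bar> \<le> ?\<kappa> ^ Suc t"
    if "u \<in> set zss" "u' \<in> set zss" "set u' \<subseteq> set u" for u u' w
  proof -
    have "\<bar>barycenter u' w - barycenter u w\<bar> \<le> ?\<kappa> * ?\<kappa> ^ t"
    proof (rule barycenter_distance_bound)
      fix y assume "y \<in> set u'"
      then have "\<bar>barycenter u w - y w\<bar> \<le> ?\<kappa> * ?\<kappa> ^ t"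
        using that u dist by (intro barycenter_distance_vertex) (blast | simp)+
      then show "\<bar>y w - barycenter u w\<bar> \<le> ?\<kappa> * ?\<kappa> ^ t" by simp
    qed (use u that in simp)
    then show ?thesis by (simp add: abs_minus_commute)
  qed
  have supp: "{w. barycenter u' w \<noteq> 0} \<subseteq> {w. barycenter u w \<noteq> 0}"
    if uu: "u \<in> set zss" "u' \<in> set zss" "set u' \<subseteq> set u" for u u'
  proof
    fix w assume "w \<in> {w. barycenter u' w \<noteq> 0}"
    then obtain y where "y \<in> set u'" "y w \<noteq> 0"
      using barycenter_support[of u' w] u[OF uu(2)] x(1) by blast
    then show "w \<in> {w. barycenter u w \<noteq> 0}"
      using barycenter_support[of u w] u[OF uu(1)] x(1) uu(3) by blast
  qed
  have point: "0 \<le> barycenter u w \<and> (w \<notin> \<sigma> \<longrightarrow> barycenter u w = 0) \<and> (\<Sum>w\<in>\<sigma>. barycenter u w) = 1"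
    if "u \<in> set zss" for u w
  proof (intro conjI impI)
    show "0 \<le> barycenter u w"
      unfolding barycenter_def using u[OF that] x(1)
      by (intro divide_nonneg_nonneg sum_list_nonneg) auto
    show "barycenter u w = 0" if "w \<notin> \<sigma>"
      using barycenter_support[of u w] u[OF \<open>u \<in> set zss\<close>] x that by blast
    have "(\<Sum>w\<in>\<sigma>. \<Sum>x\<leftarrow>u. x w) = real (length u)"
      using u(2)[OF that] x(3)
      by (induction u) (auto simp: sum.distrib)
    then show "(\<Sum>w\<in>\<sigma>. barycenter u w) = 1"
      using u(1)[OF that] by (simp add: barycenter_def flip: sum_divide_distrib)
  qed
  have len: "length (map barycenter zss) = n"
    using flag Q by (simp add: flag_def small_simplex_def)
  have close': "\<bar>barycenter u w - barycenter u' w\<bar> \<le> ?\<kappa> ^ Suc t"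
    if "u \<in> set zss" "u' \<in> set zss" for u u' w
    using nested[OF that] close[OF that] close[OF that(2,1)] by (metis abs_minus_commute)
  have supp': "{w. barycenter u w \<noteq> 0} \<subseteq> {w. barycenter u' w \<noteq> 0} \<or>
      {w. barycenter u' w \<noteq> 0} \<subseteq> {w. barycenter u w \<noteq> 0}"
    if "u \<in> set zss" "u' \<in> set zss" for u u'
    using nested[OF that] supp[OF that] supp[OF that(2,1)] by blast
  show ?thesis
    unfolding small_simplex_def using len point close' supp' by simp
qed

text \<open>
  Barycentric coordinates on the realization of the \<open>m\<close>-fold join of \<open>I\<close>.
\<close>

definition join_points :: "nat \<Rightarrow> 'i set \<Rightarrow> (nat \<times> 'i \<Rightarrow> real) set" where
  "join_points m I = {x. (\<forall>w. 0 \<le> x w) \<and>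
    (\<exists>xs\<in>join_simplices m I. (\<forall>w. w \<notin> set xs \<longrightarrow> x w = 0) \<and> (\<Sum>w\<in>set xs. x w) = 1)}"

definition vertex_point :: "'w \<Rightarrow> 'w \<Rightarrow> real" where
  "vertex_point w = (\<lambda>u. if u = w then 1 else 0)"

lemma small_simplex_vertices:
  "small_simplex (set xs) \<kappa> (length xs) 0 (map vertex_point xs)"
  by (auto simp: small_simplex_def vertex_point_def)

lemma small_simplex_join_points:
  assumes "small_simplex (set xs) \<kappa> n t ys" "xs \<in> join_simplices m I" "y \<in> set ys"
  shows "y \<in> join_points m I"
proof -
  have "(\<forall>w. 0 \<le> y w) \<and> (\<forall>w. w \<notin> set xs \<longrightarrow> y w = 0) \<and> (\<Sum>w\<in>set xs. y w) = 1"
    using assms(1,3) by (simp add: small_simplex_def)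
  then show ?thesis using assms(2) unfolding join_points_def by (intro CollectI conjI bexI[of _ xs]) auto
qed

lemma subdivide_pow_scale:
  fixes b :: "'v list \<Rightarrow> 'v"
  shows "(subdivide b ^^ s) (\<lambda>ys. c * F ys) = (\<lambda>xs. c * (subdivide b ^^ s) F xs)"
  by (induction s) (simp_all add: subdivide_scale)

lemma subdivide_pow_sum:
  fixes b :: "'v list \<Rightarrow> 'v"
  shows "(subdivide b ^^ s) (\<lambda>ys. \<Sum>i\<in>I. F i ys) = (\<lambda>xs. \<Sum>i\<in>I. (subdivide b ^^ s) (F i) xs)"
  by (induction s) (simp_all add: subdivide_sum)

lemma subdivide_pow_Nil:
  fixes b :: "'v list \<Rightarrow> 'v"
  shows "(subdivide b ^^ s) F [] = F []"
  by (induction s) simp_all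

lemma coboundary_subdivide_pow:
  fixes b :: "'v list \<Rightarrow> 'v"
  shows "coboundary ((subdivide b ^^ s) F) = (subdivide b ^^ s) (coboundary F)"
  by (induction s) (simp_all add: coboundary_subdivide)

lemma subdivide_pow_map:
  assumes "\<And>ys. b (map h ys) = h (b ys)"
  shows "(subdivide b ^^ s) F (map h xs) = (subdivide b ^^ s) (\<lambda>ys. F (map h ys)) xs"
proof (induction s arbitrary: xs)
  case (Suc s)
  have "subdivide b ((subdivide b ^^ s) F) (map h xs) =
      subdivide b (\<lambda>ys. (subdivide b ^^ s) F (map h ys)) xs"
    by (rule subdivide_map) (rule assms)
  then show ?case by (simp add: Suc)
qed simp


lemma small_simplex_distance:
  "small_simplex \<sigma> \<kappa> n t ys \<Longrightarrow> x \<in> set ys \<Longrightarrow> y \<in> set ys \<Longrightarrow> \<bar>x w - y w\<bar> \<le> \<kappa> ^ t"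
  by (simp add: small_simplex_def)

lemma small_simplex_nested:
  "small_simplex \<sigma> \<kappa> n t ys \<Longrightarrow> t > 0 \<Longrightarrow> x \<in> set ys \<Longrightarrow> y \<in> set ys \<Longrightarrow>
    {w. x w \<noteq> 0} \<subseteq> {w. y w \<noteq> 0} \<or> {w. y w \<noteq> 0} \<subseteq> {w. x w \<noteq> 0}"
  by (simp add: small_simplex_def)

context elementary_abelian
begin

text \<open>
  A labelling of the points of the join, equivariant but possibly discontinuous, takes the place of a
  continuous equivariant map. The last hypothesis says that close points of equal
  level have equal labels, provided that they are comparable by their supports. It ensures that a
  sufficiently fine subdivision of the join is mapped to the complex on the labels: one more
  subdivision, whose vertices are labelled by a label of minimal level in the corresponding
  simplex, makes the levels of every simplex weakly increasing.
\<close>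

theorem no_equivariant_labelling:
  fixes lb :: "(nat \<times> 'i \<Rightarrow> real) \<Rightarrow> 'l" and \<rho> :: "'a \<Rightarrow> 'l \<Rightarrow> 'l" and \<sigma> :: "'a \<Rightarrow> nat \<times> 'i \<Rightarrow> nat \<times> 'i"
  assumes \<rho>: "acts \<rho>" and \<sigma>: "acts \<sigma>"
    and \<rho>_\<Lambda>: "\<And>g l. g \<in> carrier G \<Longrightarrow> l \<in> \<Lambda> \<Longrightarrow> \<rho> g l \<in> \<Lambda>"
    and lev_\<rho>: "\<And>g l. lev (\<rho> g l) = lev l"
    and nofix: "\<And>l. l \<in> \<Lambda> \<Longrightarrow> \<exists>g\<in>carrier G. \<rho> g l \<noteq> l"
    and lev: "lev ` \<Lambda> \<subseteq> {1..N}"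
    and I: "I \<noteq> {}"
    and X: "\<And>g xs. g \<in> carrier G \<Longrightarrow> xs \<in> join_simplices m I \<Longrightarrow> map (\<sigma> g) xs \<in> join_simplices m I"
    and label: "\<And>x. x \<in> join_points m I \<Longrightarrow> lb x \<in> \<Lambda>"
    and equivariant: "\<And>g x. g \<in> carrier G \<Longrightarrow> x \<in> join_points m I \<Longrightarrow>
      lb (\<lambda>w. x (\<sigma> (inv g) w)) = \<rho> g (lb x)"
    and \<delta>: "\<delta> > 0"
    and close: "\<And>x y. x \<in> join_points m I \<Longrightarrow> y \<in> join_points m I \<Longrightarrow>
      {w. x w \<noteq> 0} \<subseteq> {w. y w \<noteq> 0} \<Longrightarrow> (\<And>w. \<bar>x w - y w\<bar> \<le> \<delta>) \<Longrightarrow>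
      lev (lb x) = lev (lb y) \<Longrightarrow> lb x = lb y"
  shows "m \<le> N"
proof (cases "m = 0")
  case False
  let ?\<kappa> = "1 - 1 / real m"
  have "0 \<le> ?\<kappa>" "?\<kappa> < 1" using False by (simp_all add: divide_le_eq)
  then obtain s' where s': "?\<kappa> ^ s' < \<delta>" using real_arch_pow_inv[OF \<delta>] by blast
  define s where "s = Suc s'"
  have "?\<kappa> ^ s \<le> ?\<kappa> ^ s'"
    unfolding s_def using \<open>0 \<le> ?\<kappa>\<close> \<open>?\<kappa> < 1\<close> by (intro power_decreasing) auto
  then have s: "s > 0" "?\<kappa> ^ s < \<delta>" using s' by (auto simp: s_def)
  define lab where "lab ys = arg_min_list lev (map lb ys)" for ys
  define \<Phi> where "\<Phi> F xs =
    (subdivide barycenter ^^ s) (subdivide lab (strict_part lev F)) (map vertex_point xs)"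
    for F :: "'l list \<Rightarrow> int poly" and xs :: "(nat \<times> 'i) list"
  define \<tau> where "\<tau> g x = (\<lambda>w. x (\<sigma> (inv g) w))" for g and x :: "nat \<times> 'i \<Rightarrow> real"
  have lab_in: "lab u \<in> lb ` set u" if "u \<noteq> []" for u
    using arg_min_list_in[of "map lb u" lev] that by (simp add: lab_def)
  have lev_lab: "lev (lab u) = Min (lev ` lb ` set u)" if "u \<noteq> []" for u
    using f_arg_min_list_f[of "map lb u" lev] that by (simp add: lab_def)
  have small: "P dvd (subdivide barycenter ^^ s) F (map vertex_point xs) -
      (subdivide barycenter ^^ s) F' (map vertex_point xs)"
    if xs: "xs \<in> join_simplices m I"
      and FF: "\<And>ys. small_simplex (set xs) ?\<kappa> (length xs) s ys \<Longrightarrow> P dvd F ys - F' ys"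
    for P :: "int poly" and F F' xs
  proof (rule subdivide_pow_cong_dvd[where Q = "small_simplex (set xs) ?\<kappa> (length xs)" and t = 0])
    show "small_simplex (set xs) ?\<kappa> (length xs) (Suc t) (map barycenter zss)"
      if "small_simplex (set xs) ?\<kappa> (length xs) t ys" "flag zss ys" for t ys zss
      using that length_join_simplices[OF xs] by (rule small_simplex_subdivide)
  qed (use FF small_simplex_vertices in auto)
  have labels: "map lab zss \<in> {ys. set ys \<subseteq> \<Lambda>}" "length (map lab zss) = length xs"
    if xs: "xs \<in> join_simplices m I" and ys: "small_simplex (set xs) ?\<kappa> (length xs) s ys"
      and zss: "flag zss ys" for xs ys zss
  proof -
    have "lab u \<in> \<Lambda>" if "u \<in> set zss" for u
    proof -
      have "u \<noteq> []" "set u \<subseteq> set ys"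
        using that zss set_subseq by (auto simp: flag_def)
      then obtain x where "x \<in> set ys" "lab u = lb x" using lab_in by blast
      then show ?thesis using label small_simplex_join_points[OF ys xs] by simp
    qed
    then show "map lab zss \<in> {ys. set ys \<subseteq> \<Lambda>}" by auto
    show "length (map lab zss) = length xs"
      using ys zss by (simp add: flag_def small_simplex_def)
  qed
  have strict: "coboundary (strict_part lev F) (map lab zss) = strict_part lev (coboundary F) (map lab zss)"
    if xs: "xs \<in> join_simplices m I" and ys: "small_simplex (set xs) ?\<kappa> (length xs) s ys"
      and zss: "flag zss ys"
    for xs ys zss and F :: "'l list \<Rightarrow> int poly"
  proof (rule coboundary_strict_part)
    have u: "u \<noteq> []" "set u \<subseteq> set ys" if "u \<in> set zss" for u
      using that zss set_subseq by (auto simp: flag_def)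
    have "sorted_wrt (\<lambda>u w. subseq w u) zss" using zss by (simp add: flag_def)
    then have "sorted_wrt (\<lambda>u w. lev (lab u) \<le> lev (lab w)) zss"
    proof (rule sorted_wrt_mono_rel[rotated])
      fix u w assume "u \<in> set zss" "w \<in> set zss" "subseq w u"
      then have "u \<noteq> []" "w \<noteq> []" "set w \<subseteq> set u" using u(1) set_subseq[of w u] by auto
      then show "lev (lab u) \<le> lev (lab w)"
        unfolding lev_lab[OF \<open>u \<noteq> []\<close>] lev_lab[OF \<open>w \<noteq> []\<close>] by (intro Min_antimono) auto
    qed
    then show "sorted_wrt (\<lambda>a b. lev a \<le> lev b) (map lab zss)"
      by (simp add: sorted_wrt_map)
    fix a b assume "a \<in> set (map lab zss)" "b \<in> set (map lab zss)" and eq: "lev a = lev b"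
    moreover have "c \<in> lb ` set ys" if c: "c \<in> set (map lab zss)" for c
    proof -
      obtain v where v: "v \<in> set zss" "c = lab v" using c by auto
      then have "c \<in> lb ` set v" using lab_in u(1) by simp
      then show ?thesis using image_mono[OF u(2)[OF v(1)]] by (rule rev_subsetD)
    qed
    ultimately have "a \<in> lb ` set ys" "b \<in> lb ` set ys" by simp_all
    then obtain x y where x: "x \<in> set ys" "a = lb x" and y: "y \<in> set ys" "b = lb y"
      by auto
    have pts: "x \<in> join_points m I" "y \<in> join_points m I"
      using small_simplex_join_points[OF ys xs] x y by auto
    have dist: "\<bar>x w - y w\<bar> \<le> \<delta>" for w
      using small_simplex_distance[OF ys x(1) y(1)] less_imp_le[OF s(2)] by (rule order_trans)
    have dist': "\<bar>y w - x w\<bar> \<le> \<delta>" for w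
      using small_simplex_distance[OF ys y(1) x(1)] less_imp_le[OF s(2)] by (rule order_trans)
    have "{w. x w \<noteq> 0} \<subseteq> {w. y w \<noteq> 0} \<or> {w. y w \<noteq> 0} \<subseteq> {w. x w \<noteq> 0}"
      by (rule small_simplex_nested[OF ys s(1) x(1) y(1)])
    then show "a = b"
      using close[OF pts _ dist] close[OF pts(2,1) _ dist'] eq unfolding x(2) y(2) by auto
  qed
  obtain \<alpha> :: "'a \<Rightarrow> int poly" where \<alpha>: "(\<Sum>g\<in>carrier G. \<alpha> g) = 0"
    "\<And>\<xi>. \<xi> \<in> nonzero_characters \<Longrightarrow> \<not> of_nat p dvd (\<Sum>g\<in>carrier G. \<alpha> g * of_nat (\<xi> g))"
    by (rule exists_generic_coefficients) (rule that)
  show ?thesis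
  proof (rule no_equivariant_pullback[OF prime_elem_of_nat_int_poly \<alpha> \<rho> \<sigma> _ nofix lev I X])
    show "\<Phi> (\<lambda>ys. c * F ys) = (\<lambda>xs. c * \<Phi> F xs)" for c F
    proof -
      have "strict_part lev (\<lambda>ys. c * F ys) = (\<lambda>ys. c * strict_part lev F ys)"
        by (simp add: strict_part_def fun_eq_iff)
      then show ?thesis by (simp add: \<Phi>_def[abs_def] subdivide_scale subdivide_pow_scale)
    qed
    show "\<Phi> (\<lambda>ys. \<Sum>g\<in>carrier G. F g ys) = (\<lambda>xs. \<Sum>g\<in>carrier G. \<Phi> (F g) xs)" for F
    proof -
      have "strict_part lev (\<lambda>ys. \<Sum>g\<in>carrier G. F g ys) = (\<lambda>ys. \<Sum>g\<in>carrier G. strict_part lev (F g) ys)"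
        by (simp add: strict_part_def fun_eq_iff)
      then show ?thesis by (simp add: \<Phi>_def[abs_def] subdivide_sum subdivide_pow_sum)
    qed
    show "\<Phi> F [] = F []" for F
      by (simp add: \<Phi>_def subdivide_pow_Nil strict_part_def)
    show "P dvd \<Phi> F xs - \<Phi> F' xs" if xs: "xs \<in> join_simplices m I"
      and F: "\<And>ys. ys \<in> level_simplices lev \<Lambda> \<Longrightarrow> length ys = length xs \<Longrightarrow> P dvd F ys - F' ys" for P F F' xs
      unfolding \<Phi>_def
    proof (rule small[OF xs], rule subdivide_cong_dvd)
      fix ys zss assume "small_simplex (set xs) ?\<kappa> (length xs) s ys" "flag zss ys"
      note labels[OF xs this]
      then show "P dvd strict_part lev F (map lab zss) - strict_part lev F' (map lab zss)"
        using F[of "map lab zss"] by (auto simp: strict_part_def level_simplices_def)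
    qed
    show "coboundary (\<Phi> F) xs = \<Phi> (coboundary F) xs" if xs: "xs \<in> join_simplices m I" for F xs
    proof -
      have "0 dvd (subdivide barycenter ^^ s) (subdivide lab (coboundary (strict_part lev F))) (map vertex_point xs) -
          (subdivide barycenter ^^ s) (subdivide lab (strict_part lev (coboundary F))) (map vertex_point xs)"
        by (rule small[OF xs], rule subdivide_cong_dvd) (simp add: strict[OF xs])
      moreover have "coboundary (\<Phi> F) xs =
          (subdivide barycenter ^^ s) (subdivide lab (coboundary (strict_part lev F))) (map vertex_point xs)"
        unfolding \<Phi>_def[abs_def] coboundary_map[symmetric] coboundary_subdivide_pow coboundary_subdivide ..
      ultimately show ?thesis by (simp add: \<Phi>_def)
    qed
    show "\<Phi> F (map (\<sigma> g) xs) = \<Phi> (\<lambda>ys. F (map (\<rho> g) ys)) xs"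
      if g: "g \<in> carrier G" and xs: "xs \<in> join_simplices m I" for g F xs
    proof -
      have "\<sigma> (inv g) (\<sigma> g w) = w" "\<sigma> g (\<sigma> (inv g) w) = w" for w
        using acts_inv[OF \<sigma> g, of w] acts_inv[OF \<sigma>, of "inv g" w] g by simp_all
      then have "u = \<sigma> g w \<longleftrightarrow> \<sigma> (inv g) u = w" for u w
        by metis
      then have "vertex_point (\<sigma> g w) = \<tau> g (vertex_point w)" for w
        unfolding vertex_point_def \<tau>_def by (intro ext) presburger
      then have vertices: "map vertex_point (map (\<sigma> g) xs) = map (\<tau> g) (map vertex_point xs)"
        by simp
      have bary: "barycenter (map (\<tau> g) ys) = \<tau> g (barycenter ys)" for ys
        by (simp add: barycenter_def \<tau>_def o_def)
      have "\<Phi> F (map (\<sigma> g) xs) = (subdivide barycenter ^^ s)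
          (\<lambda>ys. subdivide lab (strict_part lev F) (map (\<tau> g) ys)) (map vertex_point xs)"
        unfolding \<Phi>_def vertices by (rule subdivide_pow_map) (rule bary)
      moreover have "0 dvd (subdivide barycenter ^^ s)
          (\<lambda>ys. subdivide lab (strict_part lev F) (map (\<tau> g) ys)) (map vertex_point xs) -
          (subdivide barycenter ^^ s) (subdivide lab (strict_part lev (\<lambda>ys. F (map (\<rho> g) ys))))
          (map vertex_point xs)"
      proof (rule small[OF xs])
        fix ys assume ys: "small_simplex (set xs) ?\<kappa> (length xs) s ys"
        have "lab (map (\<tau> g) u) = \<rho> g (lab u)" if "u \<noteq> []" "subseq u ys" for u
        proof -
          have labels_u: "map lb (map (\<tau> g) u) = map (\<rho> g) (map lb u)"
            using set_subseq[OF that(2)] small_simplex_join_points[OF ys xs] equivariant[OF g]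
            by (auto simp: \<tau>_def)
          have "map lb u \<noteq> []" using that(1) by simp
          then show ?thesis
            unfolding lab_def labels_u by (rule arg_min_list_map) (rule lev_\<rho>)
        qed
        then have "subdivide lab (strict_part lev F) (map (\<tau> g) ys) =
            subdivide lab (\<lambda>ys. strict_part lev F (map (\<rho> g) ys)) ys"
          by (rule subdivide_map)
        moreover have "(\<lambda>ys. strict_part lev F (map (\<rho> g) ys)) =
            strict_part lev (\<lambda>ys. F (map (\<rho> g) ys))"
          by (simp add: strict_part_def sorted_wrt_map lev_\<rho> fun_eq_iff)
        ultimately show "0 dvd subdivide lab (strict_part lev F) (map (\<tau> g) ys) -
            subdivide lab (strict_part lev (\<lambda>ys. F (map (\<rho> g) ys))) ys" by simp
      qed
      ultimately show ?thesis by (simp add: \<Phi>_def)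
    qed
  qed (use \<rho>_\<Lambda> lev_\<rho> in auto)
qed simp

end


section \<open>Realizations of complexes\<close>

lemma topspace_geometric_realization:
  "topspace (geometric_realization L) =
    {t. (\<forall>v. 0 \<le> t v) \<and> {v. t v \<noteq> 0} \<in> L \<and> (\<Sum>v | t v \<noteq> 0. t v) = 1}"
  by (simp add: geometric_realization_def)

lemma realize_map_unique:
  assumes "\<And>w. t w \<noteq> 0 \<Longrightarrow> h w = h v \<Longrightarrow> w = v"
  shows "realize_map h t (h v) = t v"
proof (cases "t v = 0")
  case True
  then have "{w. t w \<noteq> 0 \<and> h w = h v} = {}" using assms by auto
  then show ?thesis by (simp only: realize_map_def True sum.empty)
next
  case False
  then have "{w. t w \<noteq> 0 \<and> h w = h v} = {v}" using assms by auto
  then show ?thesis by (simp add: realize_map_def)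
qed

lemma realize_map_eq_0:
  assumes "\<And>v. t v \<noteq> 0 \<Longrightarrow> h v \<noteq> w"
  shows "realize_map h t w = 0"
proof -
  have "{v. t v \<noteq> 0 \<and> h v = w} = {}" using assms by auto
  then show ?thesis by (simp only: realize_map_def sum.empty)
qed

text \<open>The realization is a finite union of closed subsets of a cube, which is compact by Tychonoff.\<close>

lemma compact_topspace_geometric_realization:
  fixes L :: "'v set set"
  assumes "finite L" "\<And>\<tau>. \<tau> \<in> L \<Longrightarrow> finite \<tau>" "\<And>\<tau> \<tau>'. \<tau> \<in> L \<Longrightarrow> \<tau>' \<subseteq> \<tau> \<Longrightarrow> \<tau>' \<in> L"
  shows "compact (topspace (geometric_realization L))"
proof -
  define C where "C \<tau> = {t. \<forall>v. 0 \<le> t v} \<inter> {t. \<forall>v. v \<notin> \<tau> \<longrightarrow> t v = 0} \<inter> {t. (\<Sum>v\<in>\<tau>. t v) = (1::real)}"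
    for \<tau> :: "'v set"
  have cont: "continuous_on UNIV (\<lambda>t::'v \<Rightarrow> real. t v)" for v by simp
  have "compactin (product_topology (\<lambda>_. euclideanreal) UNIV) (PiE UNIV (\<lambda>_::'v. {0..1::real}))"
    by (subst compactin_PiE) auto
  then have box: "compact (PiE UNIV (\<lambda>_::'v. {0..1::real}))"
    by (simp add: euclidean_product_topology)
  have "compact (C \<tau>)" if "\<tau> \<in> L" for \<tau>
  proof -
    have fin: "finite \<tau>" using assms(2) that .
    have "closed {t::'v \<Rightarrow> real. 0 \<le> t v}" "closed {t::'v \<Rightarrow> real. t v = 0}" for v
      by (intro closed_Collect_le closed_Collect_eq cont continuous_on_const)+
    then have "closed (C \<tau>)"
      unfolding C_def
      by (intro closed_Int closed_Collect_all closed_Collect_imp closed_Collect_eq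
          continuous_on_sum cont continuous_on_const) auto
    moreover have "C \<tau> \<subseteq> PiE UNIV (\<lambda>_. {0..1})"
    proof
      fix t assume t: "t \<in> C \<tau>"
      have "t v \<le> 1" for v
      proof (cases "v \<in> \<tau>")
        case True
        then have "t v \<le> (\<Sum>v\<in>\<tau>. t v)"
          using t fin by (intro member_le_sum) (auto simp: C_def)
        then show ?thesis using t by (simp add: C_def)
      qed (use t in \<open>simp add: C_def\<close>)
      then show "t \<in> PiE UNIV (\<lambda>_. {0..1})" using t by (auto simp: C_def)
    qed
    ultimately show ?thesis using box by (metis compact_Int_closed inf.absorb_iff2)
  qed
  then have "compact (\<Union>\<tau>\<in>L. C \<tau>)" using assms(1) by blast
  also have "(\<Union>\<tau>\<in>L. C \<tau>) = topspace (geometric_realization L)"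
  proof (intro equalityI subsetI)
    fix t assume "t \<in> (\<Union>\<tau>\<in>L. C \<tau>)"
    then obtain \<tau> where \<tau>: "\<tau> \<in> L" and t: "t \<in> C \<tau>" by blast
    have sub: "{v. t v \<noteq> 0} \<subseteq> \<tau>" using t by (auto simp: C_def)
    have "(\<Sum>v | t v \<noteq> 0. t v) = (\<Sum>v\<in>\<tau>. t v)"
      by (rule sum.mono_neutral_left) (use assms(2)[OF \<tau>] sub in auto)
    then show "t \<in> topspace (geometric_realization L)"
      using t assms(3)[OF \<tau> sub] by (auto simp: topspace_geometric_realization C_def)
  next
    fix t assume "t \<in> topspace (geometric_realization L)"
    then show "t \<in> (\<Union>\<tau>\<in>L. C \<tau>)"
      by (intro UN_I[of "{v. t v \<noteq> 0}"]) (auto simp: topspace_geometric_realization C_def)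
  qed
  finally show ?thesis .
qed

text \<open>
  The distance of functions is the sum of truncated coordinate distances with the weights
  \<open>(1/2) ^ n\<close>, so it is at most twice their uniform distance.
\<close>

lemma uniformly_continuous_coordinates:
  fixes h :: "('w::countable \<Rightarrow> real) \<Rightarrow> real"
  assumes "compact L" "continuous_on L h" "\<epsilon> > 0"
  shows "\<exists>\<delta>>0. \<forall>x\<in>L. \<forall>y\<in>L. (\<forall>w. \<bar>x w - y w\<bar> \<le> \<delta>) \<longrightarrow> \<bar>h x - h y\<bar> < \<epsilon>"
proof -
  have "uniformly_continuous_on L h" using assms(1,2) by (rule compact_uniformly_continuous[rotated])
  then obtain d where d: "d > 0" "\<And>x y. x \<in> L \<Longrightarrow> y \<in> L \<Longrightarrow> dist y x < d \<Longrightarrow> dist (h y) (h x) < \<epsilon>"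
    using assms(3) unfolding uniformly_continuous_on_def by metis
  have "\<bar>h x - h y\<bar> < \<epsilon>" if xy: "x \<in> L" "y \<in> L" "\<And>w. \<bar>x w - y w\<bar> \<le> d / 4" for x y
  proof -
    let ?a = "\<lambda>n. (1/2)^n * min (dist (x (from_nat n)) (y (from_nat n))) 1 :: real"
    have geometric: "summable (\<lambda>n. (1/2)^n * (d / 4) :: real)"
      by (intro summable_mult2 summable_geometric) simp
    have le: "?a n \<le> (1/2)^n * (d / 4)" for n
    proof (rule mult_left_mono)
      have "dist (x (from_nat n)) (y (from_nat n)) \<le> d / 4"
        using xy(3)[of "from_nat n"] by (simp add: dist_real_def)
      then show "min (dist (x (from_nat n)) (y (from_nat n))) 1 \<le> d / 4"
        by (rule min.coboundedI1)
    qed simp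
    have "dist x y = (\<Sum>n. ?a n)" by (simp add: dist_fun_def)
    also have "\<dots> \<le> (\<Sum>n. (1/2)^n * (d / 4))"
      by (intro suminf_le le geometric summable_comparison_test'[OF geometric, of 0])
        (use le in auto)
    also have "\<dots> = d / 2"
      by (subst suminf_mult2[symmetric]) (simp_all add: suminf_geometric)
    finally have "dist x y < d" using d(1) by simp
    then show ?thesis using d(2)[OF xy(2,1)] by (simp add: dist_real_def)
  qed
  then show ?thesis using d(1) by (intro exI[of _ "d / 4"]) auto
qed


section \<open>Columns of a point of the join\<close>

text \<open>
  A point of the \<open>m\<close>-fold join of \<open>[r]\<close> is a point of the deleted join of the full simplex: its
  \<open>r\<close> columns have disjoint supports. It lies in the deleted join of \<open>K\<close> unless some columns are not
  supported on faces.
\<close>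

definition column_support :: "(nat \<times> nat \<Rightarrow> real) \<Rightarrow> nat \<Rightarrow> nat set" where
  "column_support x i = {v. x (v, i) \<noteq> 0}"

definition nonfaces :: "nat set set \<Rightarrow> nat \<Rightarrow> (nat \<times> nat \<Rightarrow> real) \<Rightarrow> nat set" where
  "nonfaces K r x = {i \<in> {1..r}. column_support x i \<notin> K}"

lemma join_simplices_unique:
  assumes "xs \<in> join_simplices m I" "(v, i) \<in> set xs" "(v, j) \<in> set xs"
  shows "i = j"
proof -
  have "sorted_wrt (\<lambda>a b. fst b < fst a) xs" using assms(1) by (simp add: join_simplices_def)
  then show ?thesis using assms(2,3)
    by (induction xs) auto
qed

lemma join_points_D:
  assumes "x \<in> join_points m {1..r}"
  shows "0 \<le> x w" "x (v, i) \<noteq> 0 \<Longrightarrow> v \<in> {1..m} \<and> i \<in> {1..r}"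
    "x (v, i) \<noteq> 0 \<Longrightarrow> x (v, j) \<noteq> 0 \<Longrightarrow> i = j" "(\<Sum>w | x w \<noteq> 0. x w) = 1"
proof -
  obtain xs where xs: "xs \<in> join_simplices m {1..r}" and supp: "\<And>w. w \<notin> set xs \<Longrightarrow> x w = 0"
    and sum: "(\<Sum>w\<in>set xs. x w) = 1" and nonneg: "\<And>w. 0 \<le> x w"
    using assms unfolding join_points_def by blast
  show "0 \<le> x w" by (rule nonneg)
  show "v \<in> {1..m} \<and> i \<in> {1..r}" if "x (v, i) \<noteq> 0"
    using supp[of "(v, i)"] that xs unfolding join_simplices_def by blast
  show "i = j" if "x (v, i) \<noteq> 0" "x (v, j) \<noteq> 0"
    using join_simplices_unique[OF xs, of v i j] supp[of "(v, i)"] supp[of "(v, j)"] that by blast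
  have "(\<Sum>w | x w \<noteq> 0. x w) = (\<Sum>w\<in>set xs. x w)"
    by (rule sum.mono_neutral_left) (use supp in auto)
  then show "(\<Sum>w | x w \<noteq> 0. x w) = 1" using sum by simp
qed

lemma nonfaces_empty_iff:
  assumes x: "x \<in> join_points m {1..r}"
  shows "nonfaces K r x = {} \<longleftrightarrow> x \<in> topspace (geometric_realization (deleted_join r K))"
proof
  assume "nonfaces K r x = {}"
  then have "\<forall>i\<in>{1..r}. column_support x i \<in> K" by (auto simp: nonfaces_def)
  moreover have "disjoint_family_on (column_support x) {1..r}"
    using join_points_D(3)[OF x] by (auto simp: disjoint_family_on_def column_support_def)
  moreover have "{w. x w \<noteq> 0} = tuple_simplex r (column_support x)"
    using join_points_D(2)[OF x] by (auto simp: tuple_simplex_def column_support_def)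
  ultimately have "{w. x w \<noteq> 0} \<in> deleted_join r K" by (auto simp: deleted_join_def)
  then show "x \<in> topspace (geometric_realization (deleted_join r K))"
    using join_points_D(1,4)[OF x] by (simp add: topspace_geometric_realization)
next
  assume "x \<in> topspace (geometric_realization (deleted_join r K))"
  then obtain A where A: "{w. x w \<noteq> 0} = tuple_simplex r A" "\<forall>i\<in>{1..r}. A i \<in> K"
    by (auto simp: topspace_geometric_realization deleted_join_def)
  have "column_support x i = A i" if "i \<in> {1..r}" for i
  proof -
    have "x (v, i) \<noteq> 0 \<longleftrightarrow> (v, i) \<in> tuple_simplex r A" for v
      using A(1) by (metis mem_Collect_eq)
    then show ?thesis using that by (auto simp: column_support_def tuple_simplex_def)
  qed
  then show "nonfaces K r x = {}" using A(2) by (auto simp: nonfaces_def)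
qed

text \<open>
  If no column were supported on a face, adding the uncovered elements of \<open>[m]\<close> to the first column would
  give a partition of \<open>[m]\<close> into \<open>r\<close> nonfaces.
\<close>

lemma nonfaces_proper:
  assumes x: "x \<in> join_points m {1..r}" and K: "abstract_complex K" and r: "1 \<le> r"
    and part: "\<And>A. disjoint_family_on A {1..r} \<Longrightarrow> (\<Union>i\<in>{1..r}. A i) = {1..m} \<Longrightarrow> \<exists>i\<in>{1..r}. A i \<in> K"
  shows "nonfaces K r x \<noteq> {1..r}"
proof -
  define B where "B i = (if i = 1 then column_support x 1 \<union> ({1..m} - (\<Union>j\<in>{1..r}. column_support x j)) else column_support x i)" for i
  have col: "column_support x i \<subseteq> {1..m}" for i using join_points_D(2)[OF x] by (auto simp: column_support_def)
  have disj: "column_support x i \<inter> column_support x j = {}" if "i \<noteq> j" for i j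
    using join_points_D(3)[OF x] that by (auto simp: column_support_def)
  have "disjoint_family_on B {1..r}"
    unfolding disjoint_family_on_def
  proof (intro ballI impI)
    fix i j assume ij: "i \<in> {1..r}" "j \<in> {1..r}" "i \<noteq> j"
    then show "B i \<inter> B j = {}" using disj[OF ij(3)] by (auto simp: B_def)
  qed
  moreover have "(\<Union>i\<in>{1..r}. B i) = {1..m}"
  proof
    show "(\<Union>i\<in>{1..r}. B i) \<subseteq> {1..m}" using col by (auto simp: B_def split: if_splits)
    show "{1..m} \<subseteq> (\<Union>i\<in>{1..r}. B i)"
    proof
      fix v assume v: "v \<in> {1..m}"
      show "v \<in> (\<Union>i\<in>{1..r}. B i)"
      proof (cases "v \<in> (\<Union>j\<in>{1..r}. column_support x j)")
        case True
        then obtain j where "j \<in> {1..r}" "v \<in> column_support x j" by blast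
        then show ?thesis by (intro UN_I[of j]) (auto simp: B_def)
      next
        case False
        then show ?thesis using v r by (intro UN_I[of 1]) (auto simp: B_def)
      qed
    qed
  qed
  ultimately obtain i where i: "i \<in> {1..r}" "B i \<in> K" using part by blast
  have "column_support x i \<subseteq> B i" by (auto simp: B_def)
  then have "column_support x i \<in> K" using i K by (auto simp: abstract_complex_def)
  then show ?thesis using i unfolding nonfaces_def by blast
qed

lemma nonfaces_mono:
  assumes "abstract_complex K" "{w. x w \<noteq> 0} \<subseteq> {w. y w \<noteq> 0}"
  shows "nonfaces K r x \<subseteq> nonfaces K r y"
proof -
  have "column_support x i \<subseteq> column_support y i" for i using assms(2) by (auto simp: column_support_def)
  then show ?thesis using assms(1) by (auto simp: nonfaces_def abstract_complex_def)
qed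


section \<open>Points of the join of orbits\<close>

text \<open>
  At most \<open>n\<close> coordinates of a point are nonzero, so one of them exceeds \<open>1 / (n + 1)\<close>; for \<open>n = 0\<close> there
  are no points.
\<close>

lemma orbit_join_D:
  assumes "t \<in> topspace (orbit_join G n H)"
  shows "0 \<le> t w" "t (C, i) \<noteq> 0 \<Longrightarrow> i \<in> {1..n} \<and> C \<in> lcosets\<^bsub>G\<^esub> (H i)"
    "t (C, i) \<noteq> 0 \<Longrightarrow> t (C', i) \<noteq> 0 \<Longrightarrow> C = C'"
    "\<exists>C i. t (C, i) > 1 / (real n + 1)"
proof -
  obtain A where A: "{w. t w \<noteq> 0} = tuple_simplex n A"
    and disc: "\<And>i. i \<in> {1..n} \<Longrightarrow> A i \<in> discrete_complex (lcosets\<^bsub>G\<^esub> (H i))"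
    and nonneg: "\<And>w. 0 \<le> t w" and sum: "(\<Sum>w | t w \<noteq> 0. t w) = 1"
    using assms by (auto simp: orbit_join_def topspace_geometric_realization join_complex_def)
  have iff: "t (C, i) \<noteq> 0 \<longleftrightarrow> i \<in> {1..n} \<and> C \<in> A i" for C i
    using A unfolding set_eq_iff tuple_simplex_def by auto
  show "0 \<le> t w" by (rule nonneg)
  show in_orbits: "i \<in> {1..n} \<and> C \<in> lcosets\<^bsub>G\<^esub> (H i)" if "t (C, i) \<noteq> 0" for C i
    using that iff[of C i] disc[of i] by (auto simp: discrete_complex_def)
  show unique: "C = C'" if "t (C, i) \<noteq> 0" "t (C', i) \<noteq> 0" for C C' i
    using that iff[of C i] iff[of C' i] disc[of i] by (auto simp: discrete_complex_def)
  show "\<exists>C i. t (C, i) > 1 / (real n + 1)"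
  proof (rule ccontr)
    assume "\<not> ?thesis"
    then have le: "t w \<le> 1 / (real n + 1)" for w by (cases w) (auto simp: not_less)
    have inj: "inj_on snd {w. t w \<noteq> 0}"
    proof (rule inj_onI)
      fix w w' assume "w \<in> {w. t w \<noteq> 0}" "w' \<in> {w. t w \<noteq> 0}" "snd w = snd w'"
      then show "w = w'" using unique[of "fst w" "snd w" "fst w'"] by (cases w; cases w') auto
    qed
    have sub: "snd ` {w. t w \<noteq> 0} \<subseteq> {1..n}" using in_orbits by auto
    have "card {w. t w \<noteq> 0} \<le> n"
      using card_inj_on_le[OF inj sub] by simp
    have "(\<Sum>w | t w \<noteq> 0. t w) \<le> real (card {w. t w \<noteq> 0}) * (1 / (real n + 1))"
      by (rule sum_bounded_above) (rule le)
    also have "\<dots> \<le> real n * (1 / (real n + 1))"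
      using \<open>card {w. t w \<noteq> 0} \<le> n\<close> by (intro mult_right_mono) auto
    also have "\<dots> < 1" by (simp add: field_simps)
    finally show False using sum by simp
  qed
qed


section \<open>The lower bound for the number of orbits\<close>

context elementary_abelian
begin

lemma l_coset_inj:
  assumes "g \<in> carrier G" "C \<subseteq> carrier G" "C' \<subseteq> carrier G" "g <# C = g <# C'"
  shows "C = C'"
proof -
  have "inv g <# (g <# D) = D" if "D \<subseteq> carrier G" for D
    using that assms(1) by (simp add: lcos_m_assoc lcos_mult_one)
  then show ?thesis using assms by metis
qed

lemma lcosets_subset: "subgroup H G \<Longrightarrow> C \<in> lcosets H \<Longrightarrow> C \<subseteq> carrier G"
  using subgroup.subset by (fastforce simp: LCOSETS_def l_coset_def)

lemma l_coset_lcosets: "subgroup H G \<Longrightarrow> g \<in> carrier G \<Longrightarrow> C \<in> lcosets H \<Longrightarrow> g <# C \<in> lcosets H"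
  by (auto simp: LCOSETS_def lcos_m_assoc[OF subgroup.subset])

lemma finite_lcosets: "finite (lcosets H)"
  by (simp add: LCOSETS_def finite_carrier)

lemma proper_coset_moved:
  assumes H: "subgroup H G" "H \<noteq> carrier G" and C: "C \<in> lcosets H"
  shows "\<exists>g\<in>carrier G. g <# C \<noteq> C"
proof -
  obtain a where a: "a \<in> carrier G" "C = a <# H" using C by (auto simp: LCOSETS_def)
  have HG: "H \<subseteq> carrier G" by (rule subgroup.subset[OF H(1)])
  then obtain g where g: "g \<in> carrier G" "g \<notin> H" using H(2) by auto
  have "g <# C \<noteq> C"
  proof
    assume "g <# C = C"
    moreover have "a \<in> C"
      unfolding a(2) l_coset_def using subgroup.one_closed[OF H(1)] a(1) by force
    ultimately have "g \<otimes> a \<in> C" by (force simp: l_coset_def)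
    then obtain h where h: "h \<in> H" "g \<otimes> a = a \<otimes> h" by (auto simp: a(2) l_coset_def)
    then have "h \<in> carrier G" using HG by auto
    then have "g = h" using h(2) a(1) g(1) m_comm[of g a] by simp
    then show False using g h by simp
  qed
  then show ?thesis using g by blast
qed

text \<open>
  A continuous equivariant map \<open>f\<close> from the deleted join of \<open>K\<close> to a join of \<open>n\<close> orbits labels the
  points of the deleted join by orbit elements of large weight. A point \<open>x\<close> outside the
  deleted join is labelled by the set of its columns not supported on faces: this set is
  neither empty nor, by the partition property, all of \<open>[r]\<close>, so it has \<open>r - 1\<close> possible sizes,
  and it grows with the support of \<open>x\<close>. In total there are \<open>n + r - 1\<close> levels, and no
  label is fixed by \<open>G\<close>.
\<close>

theorem orbit_join_bound:
  fixes K :: "nat set set" and \<phi> :: "'a \<Rightarrow> nat \<Rightarrow> nat"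
  assumes K: "abstract_complex K" "Vert K \<subseteq> {1..m}" and r: "1 \<le> r"
    and part: "\<And>A. disjoint_family_on A {1..r} \<Longrightarrow> (\<Union>i\<in>{1..r}. A i) = {1..m} \<Longrightarrow> \<exists>i\<in>{1..r}. A i \<in> K"
    and \<phi>: "group_action G {1..r} \<phi>"
    and trans: "\<And>i j. i \<in> {1..r} \<Longrightarrow> j \<in> {1..r} \<Longrightarrow> \<exists>g\<in>carrier G. \<phi> g i = j"
    and H: "\<And>i. i \<in> {1..n} \<Longrightarrow> subgroup (H i) G \<and> H i \<noteq> carrier G"
    and f: "continuous_map (geometric_realization (deleted_join r K)) (orbit_join G n H) f"
    and equi: "equivariant_on (carrier G) (deleted_join_action \<phi>) (orbit_join_action G)
      (topspace (geometric_realization (deleted_join r K))) f"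
  shows "m + 1 \<le> n + r"
proof -
  interpret \<phi>: group_action G "{1..r}" \<phi> by (rule \<phi>)
  have H1: "subgroup (H i) G" and H2: "H i \<noteq> carrier G" if "i \<in> {1..n}" for i
    using H[OF that] by simp_all
  let ?L = "topspace (geometric_realization (deleted_join r K))"
  let ?PT = "join_points m {1..r}"
  let ?S = "nonfaces K r"
  define \<epsilon> where "\<epsilon> = 1 / (real n + 1)"
  have \<epsilon>: "\<epsilon> > 0" by (simp add: \<epsilon>_def)
  define \<sigma> where "\<sigma> g w = (fst w, if snd w \<in> {1..r} then \<phi> g (snd w) else snd w)" for g and w :: "nat \<times> nat"
  define \<rho> where "\<rho> g l = (fst l, case snd l of
      Inl C \<Rightarrow> Inl (if C \<subseteq> carrier G then g <# C else C)
    | Inr S \<Rightarrow> Inr (if S \<subseteq> {1..r} then \<phi> g ` S else S))" for g and l :: "nat \<times> ('a set + nat set)"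
  define \<Lambda> :: "(nat \<times> ('a set + nat set)) set" where
    "\<Lambda> = {(i, Inl C) | i C. i \<in> {1..n} \<and> C \<in> lcosets (H i)} \<union>
      {(n + card S, Inr S) | S. S \<subseteq> {1..r} \<and> 0 < card S \<and> card S < r}"
  have \<phi>_in: "\<phi> g i \<in> {1..r}" if "g \<in> carrier G" "i \<in> {1..r}" for g i
    using \<phi>.element_image[OF that refl] .
  have \<phi>_one: "\<phi> \<one> i = i" if "i \<in> {1..r}" for i
    using \<phi>.id_eq_one that by (metis restrict_apply')
  have \<phi>_inv: "\<phi> (inv g) (\<phi> g i) = i" "\<phi> g (\<phi> (inv g) i) = i" if "g \<in> carrier G" "i \<in> {1..r}" for g i
    using that \<phi>_one \<phi>.composition_rule[of i "inv g" g] \<phi>.composition_rule[of i g "inv g"] by simp_all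
  have \<phi>_image: "\<phi> g ` S \<subseteq> {1..r}" "card (\<phi> g ` S) = card S" if "g \<in> carrier G" "S \<subseteq> {1..r}" for g S
    using that \<phi>_in card_image[OF inj_on_subset[OF \<phi>.inj_prop[OF that(1)] that(2)]] by auto
  have \<sigma>: "acts \<sigma>"
    unfolding acts_def \<sigma>_def using \<phi>_one \<phi>.composition_rule \<phi>_in by auto
  have lcos_G: "g <# C \<subseteq> carrier G" if "g \<in> carrier G" "C \<subseteq> carrier G" for g C
    using that by (auto simp: l_coset_def)
  have \<rho>: "acts \<rho>"
    unfolding acts_def
  proof (intro conjI ballI allI)
    fix l :: "nat \<times> ('a set + nat set)"
    have "\<phi> \<one> ` S = S" if "S \<subseteq> {1..r}" for S
    proof -
      have "\<phi> \<one> ` S = (\<lambda>i. i) ` S"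
        by (rule image_cong[OF refl]) (use \<phi>_one that in blast)
      then show ?thesis by simp
    qed
    then show "\<rho> \<one> l = l"
      by (cases l) (auto simp: \<rho>_def lcos_mult_one split: sum.splits)
    fix g h assume g: "g \<in> carrier G" and h: "h \<in> carrier G"
    have "\<phi> (g \<otimes> h) ` S = \<phi> g ` \<phi> h ` S" if "S \<subseteq> {1..r}" for S
      unfolding image_image
      by (rule image_cong[OF refl]) (rule \<phi>.composition_rule[OF _ g h], use that in auto)
    then show "\<rho> (g \<otimes> h) l = \<rho> g (\<rho> h l)"
      using lcos_m_assoc[OF _ g h] lcos_G[OF h] \<phi>_image(1)[OF h]
      by (cases "snd l") (simp_all add: \<rho>_def)
  qed
  have \<rho>_\<Lambda>: "\<rho> g l \<in> \<Lambda>" if g: "g \<in> carrier G" and l: "l \<in> \<Lambda>" for g l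
  proof (cases "snd l")
    case (Inl C)
    then obtain i where i: "l = (i, Inl C)" "i \<in> {1..n}" "C \<in> lcosets (H i)" using l by (auto simp: \<Lambda>_def)
    then have "C \<subseteq> carrier G" "g <# C \<in> lcosets (H i)"
      using H lcosets_subset l_coset_lcosets g by auto
    then show ?thesis using i by (simp add: \<rho>_def \<Lambda>_def)
  next
    case (Inr S)
    then have "l = (n + card S, Inr S)" "S \<subseteq> {1..r}" "0 < card S" "card S < r" using l by (auto simp: \<Lambda>_def)
    then show ?thesis using \<phi>_image[OF g] by (simp add: \<rho>_def \<Lambda>_def)
  qed
  have nofix: "\<exists>g\<in>carrier G. \<rho> g l \<noteq> l" if l: "l \<in> \<Lambda>" for l
  proof (cases "snd l")
    case (Inl C)
    then obtain i where i: "l = (i, Inl C)" "i \<in> {1..n}" "C \<in> lcosets (H i)" using l by (auto simp: \<Lambda>_def)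
    obtain g where "g \<in> carrier G" "g <# C \<noteq> C"
      using proper_coset_moved[OF H1[OF i(2)] H2[OF i(2)] i(3)] by blast
    moreover have "C \<subseteq> carrier G" by (rule lcosets_subset[OF H1[OF i(2)] i(3)])
    ultimately show ?thesis using i by (auto simp: \<rho>_def)
  next
    case (Inr S)
    then have S: "l = (n + card S, Inr S)" "S \<subseteq> {1..r}" "0 < card S" "card S < r" using l by (auto simp: \<Lambda>_def)
    then obtain i where i: "i \<in> S" by (metis card_gt_0_iff ex_in_conv)
    have "S \<noteq> {1..r}" using S(4) by auto
    then obtain j where j: "j \<in> {1..r}" "j \<notin> S" using S(2) by blast
    obtain g where g: "g \<in> carrier G" "\<phi> g i = j"
      using trans[OF subsetD[OF S(2) i] j(1)] by blast
    then have "\<phi> g ` S \<noteq> S" using i j by blast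
    then show ?thesis using g S by (auto simp: \<rho>_def)
  qed
  have lev_\<Lambda>: "fst ` \<Lambda> \<subseteq> {1..n + r - 1}" using r by (auto simp: \<Lambda>_def)
  have X: "map (\<sigma> g) xs \<in> join_simplices m {1..r}" if "g \<in> carrier G" "xs \<in> join_simplices m {1..r}" for g xs
  proof -
    have "sorted_wrt (\<lambda>a b. fst b < fst a) (map (\<sigma> g) xs)"
      using that(2) by (simp add: join_simplices_def sorted_wrt_map \<sigma>_def)
    moreover have "\<sigma> g w \<in> {1..m} \<times> {1..r}" if "w \<in> {1..m} \<times> {1..r}" for w
      using that \<phi>_in[OF \<open>g \<in> carrier G\<close>] by (cases w) (simp add: \<sigma>_def)
    moreover have "set xs \<subseteq> {1..m} \<times> {1..r}" using that(2) by (simp add: join_simplices_def)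
    ultimately have "sorted_wrt (\<lambda>a b. fst b < fst a) (map (\<sigma> g) xs)"
      "set (map (\<sigma> g) xs) \<subseteq> {1..m} \<times> {1..r}"
      unfolding set_map by blast+
    then show ?thesis unfolding join_simplices_def by blast
  qed

  \<comment> \<open>A point \<open>x\<close> of the deleted join is labelled by the first level on which \<open>f x\<close> has a weight above \<open>\<epsilon>\<close>.
    Only one orbit element of this level has nonzero weight at all, so the label is unique.\<close>
  have f_in: "f x \<in> topspace (orbit_join G n H)" if "x \<in> ?L" for x
    using f that continuous_map_image_subset_topspace by blast
  note f_D = orbit_join_D[OF f_in, folded \<epsilon>_def]
  define is_lab where "is_lab x i C \<longleftrightarrow> f x (C, i) > \<epsilon> \<and> (\<forall>i'<i. \<forall>C'. \<not> f x (C', i') > \<epsilon>)" for x i C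
  have lab_exists: "\<exists>i C. is_lab x i C" if "x \<in> ?L" for x
  proof -
    have "\<exists>i C. f x (C, i) > \<epsilon>" using f_D(4)[OF that] by blast
    then obtain i where "\<exists>C. f x (C, i) > \<epsilon>" "\<forall>i'<i. \<not> (\<exists>C. f x (C, i') > \<epsilon>)"
      using exists_least_iff[of "\<lambda>i. \<exists>C. f x (C, i) > \<epsilon>"] by blast
    then show ?thesis unfolding is_lab_def by blast
  qed
  have lab_unique: "i = i' \<and> C = C'" if "x \<in> ?L" "is_lab x i C" "is_lab x i' C'" for x i i' C C'
  proof -
    have "i = i'" using that(2,3) unfolding is_lab_def by (metis linorder_neqE_nat)
    moreover have "f x (C, i) \<noteq> 0" "f x (C', i') \<noteq> 0" using that(2,3) \<epsilon> by (auto simp: is_lab_def)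
    ultimately show ?thesis using f_D(3)[OF that(1)] by blast
  qed
  have "\<exists>iC. x \<in> ?L \<longrightarrow> is_lab x (fst iC) (snd iC)" for x using lab_exists by (metis fst_conv snd_conv)
  then obtain lab where lab: "\<And>x. x \<in> ?L \<Longrightarrow> is_lab x (fst (lab x)) (snd (lab x))" by metis
  define lb where "lb x = (if ?S x = {} then (fst (lab x), Inl (snd (lab x)))
    else (n + card (?S x), Inr (?S x)))" for x
  have L_iff: "?S x = {} \<longleftrightarrow> x \<in> ?L" if "x \<in> ?PT" for x
    using nonfaces_empty_iff[OF that] .
  have lab_D: "fst (lab x) \<in> {1..n}" "snd (lab x) \<in> lcosets (H (fst (lab x)))" if "x \<in> ?L" for x
    using f_D(2)[OF that, of "snd (lab x)" "fst (lab x)"] lab[OF that] \<epsilon> by (auto simp: is_lab_def)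
  have label: "lb x \<in> \<Lambda>" if x: "x \<in> ?PT" for x
  proof (cases "?S x = {}")
    case True
    then show ?thesis using lab_D[of x] L_iff[OF x] by (simp add: lb_def \<Lambda>_def)
  next
    case False
    have "?S x \<subseteq> {1..r}" by (auto simp: nonfaces_def)
    moreover have "?S x \<noteq> {1..r}" by (rule nonfaces_proper[OF x K(1) r part])
    ultimately have "card (?S x) < card {1..r}" by (intro psubset_card_mono) auto
    moreover have "0 < card (?S x)" using False \<open>?S x \<subseteq> {1..r}\<close> by (simp add: card_gt_0_iff finite_subset)
    ultimately show ?thesis using False \<open>?S x \<subseteq> {1..r}\<close> by (simp add: lb_def \<Lambda>_def)
  qed

  have equivariant: "lb (\<lambda>w. x (\<sigma> (inv g) w)) = \<rho> g (lb x)" if g: "g \<in> carrier G" and x: "x \<in> ?PT" for g x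
  proof -
    let ?x = "\<lambda>w. x (\<sigma> (inv g) w)"
    have col: "column_support ?x i = column_support x (\<phi> (inv g) i)" if "i \<in> {1..r}" for i
      using that by (simp add: column_support_def \<sigma>_def)
    have S: "?S ?x = \<phi> g ` ?S x"
    proof (intro equalityI subsetI)
      fix i assume i: "i \<in> ?S ?x"
      then have "\<phi> (inv g) i \<in> ?S x" using col \<phi>_in[of "inv g" i] g by (auto simp: nonfaces_def)
      moreover have "\<phi> g (\<phi> (inv g) i) = i" using \<phi>_inv(2)[OF g] i by (auto simp: nonfaces_def)
      ultimately show "i \<in> \<phi> g ` ?S x" by (metis imageI)
    next
      fix i assume "i \<in> \<phi> g ` ?S x"
      then obtain j where j: "i = \<phi> g j" "j \<in> {1..r}" "column_support x j \<notin> K" by (auto simp: nonfaces_def)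
      then show "i \<in> ?S ?x" using col[of i] \<phi>_in[OF g] \<phi>_inv(1)[OF g] by (auto simp: nonfaces_def)
    qed
    show ?thesis
    proof (cases "?S x = {}")
      case False
      moreover have "?S x \<subseteq> {1..r}" by (auto simp: nonfaces_def)
      ultimately show ?thesis using \<phi>_image[OF g] by (simp add: lb_def \<rho>_def S)
    next
      case True
      then have xL: "x \<in> ?L" using L_iff[OF x] by simp
      have act: "deleted_join_action \<phi> g x = ?x"
      proof
        fix w :: "nat \<times> nat"
        obtain u j where w: "w = (u, j)" by (cases w)
        show "deleted_join_action \<phi> g x w = ?x w"
        proof (cases "j \<in> {1..r}")
          case True
          let ?q = "(u, \<phi> (inv g) j)"
          have "realize_map (\<lambda>(v, i). (v, \<phi> g i)) x ((\<lambda>(v, i). (v, \<phi> g i)) ?q) = x ?q"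
          proof (rule realize_map_unique)
            fix q assume q: "x q \<noteq> 0" "(\<lambda>(v, i). (v, \<phi> g i)) q = (\<lambda>(v, i). (v, \<phi> g i)) ?q"
            obtain v i where vi: "q = (v, i)" by (cases q)
            have "i \<in> {1..r}" using join_points_D(2)[OF x] q(1) vi by blast
            then show "q = ?q"
              using q(2) vi \<phi>_inv[OF g] True by auto
          qed
          then show ?thesis
            using True \<phi>_inv(2)[OF g True] by (simp add: deleted_join_action_def w \<sigma>_def)
        next
          case False
          have "realize_map (\<lambda>(v, i). (v, \<phi> g i)) x w = 0"
          proof (rule realize_map_eq_0)
            fix q assume q: "x q \<noteq> 0"
            obtain v i where vi: "q = (v, i)" by (cases q)
            have "i \<in> {1..r}" using join_points_D(2)[OF x] q vi by blast
            then show "(\<lambda>(v, i). (v, \<phi> g i)) q \<noteq> w" using \<phi>_in[OF g] False by (auto simp: vi w)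
          qed
          moreover have "x (u, j) = 0" using join_points_D(2)[OF x, of u j] False by blast
          ultimately show ?thesis using False by (auto simp: deleted_join_action_def w \<sigma>_def)
        qed
      qed
      have fx: "f ?x = orbit_join_action G g (f x)"
        using equi g xL unfolding equivariant_on_def act[symmetric] by blast
      have sub: "C \<subseteq> carrier G" if "f x (C, i) \<noteq> 0" for C i
        using f_D(2)[OF xL that] lcosets_subset[OF H1[of i]] by blast
      have val: "f ?x (g <# C, i) = f x (C, i)" if "C \<subseteq> carrier G" for C i
      proof -
        have "realize_map (\<lambda>(C, i). (g <# C, i)) (f x) ((\<lambda>(C, i). (g <# C, i)) (C, i)) = f x (C, i)"
        proof (rule realize_map_unique)
          fix q assume q: "f x q \<noteq> 0" "(\<lambda>(C, i). (g <# C, i)) q = (\<lambda>(C, i). (g <# C, i)) (C, i)"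
          obtain D j where "q = (D, j)" by (cases q)
          then show "q = (C, i)" using q sub[of D j] l_coset_inj[OF g _ that, of D] by auto
        qed
        then show ?thesis by (simp add: fx orbit_join_action_def)
      qed
      have large: "\<exists>C. f x (C, i) > \<epsilon>" if "f ?x (C', i) > \<epsilon>" for C' i
      proof -
        have "realize_map (\<lambda>(C, i). (g <# C, i)) (f x) (C', i) \<noteq> 0"
          using that \<epsilon> by (simp add: fx orbit_join_action_def)
        then obtain q where q: "f x q \<noteq> 0" "(\<lambda>(C, i). (g <# C, i)) q = (C', i)"
          using realize_map_eq_0[of "f x" "\<lambda>(C, i). (g <# C, i)" "(C', i)"] by blast
        then obtain C where "q = (C, i)" "C' = g <# C" by (cases q) auto
        then show ?thesis using val[of C i] sub q that by auto
      qed
      have C: "snd (lab x) \<subseteq> carrier G" by (rule lcosets_subset[OF H1[OF lab_D(1)[OF xL]] lab_D(2)[OF xL]])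
      have "is_lab ?x (fst (lab x)) (g <# snd (lab x))"
        unfolding is_lab_def
      proof (intro conjI allI impI notI)
        show "f ?x (g <# snd (lab x), fst (lab x)) > \<epsilon>"
          using lab[OF xL] by (simp only: val[OF C] is_lab_def)
        fix i C' assume "i < fst (lab x)" "f ?x (C', i) > \<epsilon>"
        then show False using large[of C' i] lab[OF xL] by (auto simp: is_lab_def)
      qed
      moreover have S_empty: "?S ?x = {}" using True S by simp
      moreover have x'L: "?x \<in> ?L"
      proof -
        have "?x \<in> ?PT"
        proof -
          obtain xs where xs: "xs \<in> join_simplices m {1..r}" "\<And>w. w \<notin> set xs \<Longrightarrow> x w = 0"
            "(\<Sum>w\<in>set xs. x w) = 1" "\<And>w. 0 \<le> x w"
            using x unfolding join_points_def by blast
          have inv: "\<sigma> (inv g) (\<sigma> g w) = w" "\<sigma> g (\<sigma> (inv g) w) = w" for w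
            using acts_inv[OF \<sigma> g, of w] acts_inv[OF \<sigma>, of "inv g" w] g by simp_all
          have inj: "inj_on (\<sigma> g) (set xs)"
            by (rule inj_on_inverseI[of _ "\<sigma> (inv g)"]) (rule inv(1))
          have "(\<Sum>w\<in>\<sigma> g ` set xs. ?x w) = (\<Sum>w\<in>set xs. x w)"
            by (simp only: sum.reindex[OF inj] o_def inv(1))
          moreover have "?x w = 0" if "w \<notin> \<sigma> g ` set xs" for w
            using xs(2)[of "\<sigma> (inv g) w"] that inv(2)[of w] by (metis imageI)
          ultimately show ?thesis
            unfolding join_points_def using xs X[OF g xs(1)]
            by (intro CollectI conjI allI bexI[of _ "map (\<sigma> g) xs"]) auto
        qed
        then show ?thesis using L_iff S_empty by blast
      qed
      ultimately have "fst (lab ?x) = fst (lab x)" "snd (lab ?x) = g <# snd (lab x)"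
        using lab_unique[OF x'L lab[OF x'L]] by auto
      then show ?thesis using True S_empty C by (simp add: lb_def \<rho>_def)
    qed
  qed

  have "compact ?L"
  proof (rule compact_topspace_geometric_realization)
    show fin: "finite \<tau>" if "\<tau> \<in> deleted_join r K" for \<tau>
      using that K(1) by (auto simp: deleted_join_def tuple_simplex_def abstract_complex_def)
    have "deleted_join r K \<subseteq> Pow ({1..m} \<times> {1..r})"
      using K(2) by (fastforce simp: deleted_join_def tuple_simplex_def Vert_def)
    then show "finite (deleted_join r K)" by (rule finite_subset) simp
    show "\<tau>' \<in> deleted_join r K" if \<tau>: "\<tau> \<in> deleted_join r K" "\<tau>' \<subseteq> \<tau>" for \<tau> \<tau>'
    proof -
      obtain A where A: "\<tau> = tuple_simplex r A" "\<forall>i\<in>{1..r}. A i \<in> K" "disjoint_family_on A {1..r}"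
        using \<tau>(1) by (auto simp: deleted_join_def)
      define A' where "A' i = {v. (v, i) \<in> \<tau>'}" for i
      have A'_sub: "A' i \<subseteq> A i" for i using \<tau>(2) by (auto simp: A'_def A(1) tuple_simplex_def)
      have "\<forall>i\<in>{1..r}. A' i \<in> K"
        using A(2) A'_sub K(1) unfolding abstract_complex_def by blast
      moreover have "disjoint_family_on A' {1..r}"
        using A(3) A'_sub unfolding disjoint_family_on_def by blast
      moreover have "\<tau>' = tuple_simplex r A'"
        using \<tau>(2) by (auto simp: A'_def A(1) tuple_simplex_def)
      ultimately show ?thesis unfolding deleted_join_def by blast
    qed
  qed
  have cont: "continuous_on ?L (\<lambda>x. f x w)" for w
  proof -
    have top: "geometric_realization (deleted_join r K) = top_of_set ?L"
      unfolding geometric_realization_def by (simp add: euclidean_product_topology)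
    have "continuous_map (geometric_realization (deleted_join r K)) (powertop_real UNIV) f"
      using f unfolding orbit_join_def geometric_realization_def[of "join_complex _ _"]
      by (rule continuous_map_into_fulltopology)
    then have "continuous_map (geometric_realization (deleted_join r K)) euclideanreal (\<lambda>x. f x w)"
      unfolding continuous_map_componentwise_UNIV by blast
    then show ?thesis
      unfolding continuous_map_iff_continuous[symmetric] top[symmetric] .
  qed
  define W where "W = (\<Union>i\<in>{1..n}. (lcosets (H i)) \<times> {i})"
  have "finite W" by (simp add: W_def finite_lcosets)
  have "\<exists>\<delta>>0. \<forall>x\<in>?L. \<forall>y\<in>?L. (\<forall>w. \<bar>x w - y w\<bar> \<le> \<delta>) \<longrightarrow> (\<forall>u\<in>V. \<bar>f x u - f y u\<bar> < \<epsilon>)"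
    if "finite V" for V
    using that
  proof (induction V rule: finite_induct)
    case empty
    show ?case by (intro exI[of _ 1]) simp
  next
    case (insert u V)
    then obtain \<delta>1 where \<delta>1: "\<delta>1 > 0" "\<And>x y. x \<in> ?L \<Longrightarrow> y \<in> ?L \<Longrightarrow> (\<And>w. \<bar>x w - y w\<bar> \<le> \<delta>1) \<Longrightarrow>
        (\<forall>u\<in>V. \<bar>f x u - f y u\<bar> < \<epsilon>)" by blast
    obtain \<delta>2 where \<delta>2: "\<delta>2 > 0" "\<And>x y. x \<in> ?L \<Longrightarrow> y \<in> ?L \<Longrightarrow> (\<And>w. \<bar>x w - y w\<bar> \<le> \<delta>2) \<Longrightarrow>
        \<bar>f x u - f y u\<bar> < \<epsilon>"
      using uniformly_continuous_coordinates[OF \<open>compact ?L\<close> cont[of u] \<epsilon>] by blast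
    show ?case
      by (intro exI[of _ "min \<delta>1 \<delta>2"]) (use \<delta>1 \<delta>2 in auto)
  qed
  from this[OF \<open>finite W\<close>] obtain \<delta> where \<delta>: "\<delta> > 0" "\<And>x y u. x \<in> ?L \<Longrightarrow> y \<in> ?L \<Longrightarrow>
      (\<And>w. \<bar>x w - y w\<bar> \<le> \<delta>) \<Longrightarrow> u \<in> W \<Longrightarrow> \<bar>f x u - f y u\<bar> < \<epsilon>" by blast
  have close: "lb x = lb y" if x: "x \<in> ?PT" and y: "y \<in> ?PT"
    and supp: "{w. x w \<noteq> 0} \<subseteq> {w. y w \<noteq> 0}" and near: "\<And>w. \<bar>x w - y w\<bar> \<le> \<delta>"
    and level: "fst (lb x) = fst (lb y)" for x y
  proof -
    have pos: "0 < card (?S z)" if "?S z \<noteq> {}" for z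
      using that by (simp add: card_gt_0_iff nonfaces_def)
    consider "?S x = {}" "?S y = {}" | "?S x = {}" "?S y \<noteq> {}" | "?S x \<noteq> {}" "?S y = {}"
      | "?S x \<noteq> {}" "?S y \<noteq> {}" by blast
    then show ?thesis
    proof cases
      case 1
      \<comment> \<open>Different labels on level \<open>i\<close> would make \<open>f y (C, i)\<close> vanish, whereas \<open>f x (C, i) > \<epsilon>\<close>.\<close>
      then have xL: "x \<in> ?L" and yL: "y \<in> ?L" using L_iff x y by auto
      define i where "i = fst (lab x)"
      define C where "C = snd (lab x)"
      have i: "fst (lab y) = i" using level 1 by (simp add: lb_def i_def)
      have fxC: "f x (C, i) > \<epsilon>" using lab[OF xL] by (simp add: is_lab_def i_def C_def)
      have fyC: "f y (snd (lab y), i) > \<epsilon>" using lab[OF yL] by (simp add: is_lab_def i)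
      have "(C, i) \<in> W" using lab_D[OF xL] by (auto simp: W_def i_def C_def)
      then have "\<bar>f x (C, i) - f y (C, i)\<bar> < \<epsilon>" using \<delta>(2)[OF xL yL near] by blast
      then have "f y (C, i) \<noteq> 0" using fxC by auto
      then have "snd (lab y) = C" using f_D(3)[OF yL, of "snd (lab y)" i C] fyC \<epsilon> by auto
      then show ?thesis using 1 i by (simp add: lb_def i_def C_def)
    next
      case 2
      then have "x \<in> ?L" using L_iff x by auto
      from lab_D(1)[OF this] show ?thesis using 2 level pos[of y] by (simp add: lb_def)
    next
      case 3
      then have "y \<in> ?L" using L_iff y by auto
      from lab_D(1)[OF this] show ?thesis using 3 level pos[of x] by (simp add: lb_def)
    next
      case 4
      \<comment> \<open>The sets of nonfaces are nested, so equal as soon as they have the same size.\<close>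
      have "?S x \<subseteq> ?S y" by (rule nonfaces_mono[OF K(1) supp])
      moreover have "card (?S x) = card (?S y)" using 4 level by (simp add: lb_def)
      moreover have "finite (?S y)" by (simp add: nonfaces_def)
      ultimately have "?S x = ?S y" by (metis card_subset_eq)
      then show ?thesis using 4 by (simp add: lb_def)
    qed
  qed
  have "m \<le> n + r - 1"
  proof (rule no_equivariant_labelling)
    show "acts \<rho>" "acts \<sigma>" by (rule \<rho>, rule \<sigma>)
    show "\<rho> g l \<in> \<Lambda>" if "g \<in> carrier G" "l \<in> \<Lambda>" for g l using that by (rule \<rho>_\<Lambda>)
    show "fst (\<rho> g l) = fst l" for g l by (simp add: \<rho>_def)
    show "\<exists>g\<in>carrier G. \<rho> g l \<noteq> l" if "l \<in> \<Lambda>" for l using that by (rule nofix)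
    show "fst ` \<Lambda> \<subseteq> {1..n + r - 1}" by (rule lev_\<Lambda>)
    show "{1..r} \<noteq> {}" using r by simp
    show "map (\<sigma> g) xs \<in> join_simplices m {1..r}"
      if "g \<in> carrier G" "xs \<in> join_simplices m {1..r}" for g xs using that by (rule X)
    show "lb x \<in> \<Lambda>" if "x \<in> ?PT" for x using that by (rule label)
    show "lb (\<lambda>w. x (\<sigma> (inv g) w)) = \<rho> g (lb x)" if "g \<in> carrier G" "x \<in> ?PT" for g x
      using that by (rule equivariant)
    show "\<delta> > 0" by (rule \<delta>(1))
    show "lb x = lb y" if "x \<in> ?PT" "y \<in> ?PT" "{w. x w \<noteq> 0} \<subseteq> {w. y w \<noteq> 0}"
      "\<And>w. \<bar>x w - y w\<bar> \<le> \<delta>" "fst (lb x) = fst (lb y)" for x y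
      using that by (rule close)
  qed
  then show ?thesis using r by linarith
qed

end


section \<open>The elementary abelian group and its free actions\<close>

lemma carrier_Zp_power: "p > 0 \<Longrightarrow> carrier (Zp_power p k) = {1..k} \<rightarrow>\<^sub>E {0..<int p}"
  by (simp add: Zp_power_def carrier_integer_mod_group)

lemma elementary_abelian_Zp_power:
  assumes p: "Factorial_Ring.prime p"
  shows "elementary_abelian (Zp_power p k) p"
proof -
  let ?G = "Zp_power p k"
  have p0: "p > 0" using p by (rule prime_gt_0_nat)
  have mult: "x \<otimes>\<^bsub>?G\<^esub> y = (\<lambda>i\<in>{1..k}. (x i + y i) mod int p)" for x y
    by (simp add: Zp_power_def)
  have one: "\<one>\<^bsub>?G\<^esub> = (\<lambda>i\<in>{1..k}. 0)" by (simp add: Zp_power_def)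
  interpret group ?G by (simp add: Zp_power_def)
  have pow: "x [^]\<^bsub>?G\<^esub> n = (\<lambda>i\<in>{1..k}. (int n * x i) mod int p)" for x and n :: nat
    by (induction n) (auto simp: one mult fun_eq_iff algebra_simps mod_simps)
  show ?thesis
  proof (intro elementary_abelian.intro elementary_abelian_axioms.intro)
    show "comm_group ?G"
      by (rule group_comm_groupI) (simp add: mult add.commute)
    show "finite (carrier ?G)" by (simp add: carrier_Zp_power[OF p0] finite_PiE)
    show "Factorial_Ring.prime p" by (rule p)
    show "g [^]\<^bsub>?G\<^esub> p = \<one>\<^bsub>?G\<^esub>" for g by (simp add: pow one)
  qed
qed

lemma card_carrier_Zp_power: "p > 0 \<Longrightarrow> card (carrier (Zp_power p k)) = p ^ k"
  by (simp add: carrier_Zp_power card_PiE)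

text \<open>A free orbit has as many elements as the group.\<close>

lemma free_action_transitive:
  assumes "group G" "finite (carrier G)" and free: "free_action G E \<phi>"
    and card: "card E = card (carrier G)" "finite E" and ij: "i \<in> E" "j \<in> E"
  shows "\<exists>g\<in>carrier G. \<phi> g i = j"
proof -
  interpret G: group G by (rule assms(1))
  interpret group_action G E \<phi> using free by (simp add: free_action_def)
  have "inj_on (\<lambda>g. \<phi> g i) (carrier G)"
  proof (rule inj_onI)
    fix g h assume gh: "g \<in> carrier G" "h \<in> carrier G" "\<phi> g i = \<phi> h i"
    have "\<phi> (inv\<^bsub>G\<^esub> h \<otimes>\<^bsub>G\<^esub> g) i = \<phi> (inv\<^bsub>G\<^esub> h) (\<phi> h i)"
      using gh ij by (simp add: composition_rule)
    also have "\<dots> = i" using orbit_sym_aux[OF gh(2) ij(1) refl] .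
    finally have "inv\<^bsub>G\<^esub> h \<otimes>\<^bsub>G\<^esub> g \<in> stabilizer G \<phi> i" using gh by (simp add: stabilizer_def)
    then have "inv\<^bsub>G\<^esub> h \<otimes>\<^bsub>G\<^esub> g = \<one>\<^bsub>G\<^esub>" using free ij by (simp add: free_action_def)
    then show "g = h" using gh by (metis G.inv_equality G.inv_inv G.inv_closed)
  qed
  then have "card ((\<lambda>g. \<phi> g i) ` carrier G) = card E" using card by (simp add: card_image)
  moreover have "(\<lambda>g. \<phi> g i) ` carrier G \<subseteq> E" using element_image ij by blast
  ultimately have "(\<lambda>g. \<phi> g i) ` carrier G = E" using card(2) by (metis card_subset_eq)
  then show ?thesis using ij(2) by (metis imageE)
qed

lemma partition_number_property:
  fixes K :: "nat set set" and m :: nat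
  assumes K: "abstract_complex K"
  defines "\<nu> \<equiv> partition_number m K"
  shows "1 \<le> \<nu>"
    and "disjoint_family_on A {1..\<nu>} \<Longrightarrow> (\<Union>i\<in>{1..\<nu>}. A i) = {1..m} \<Longrightarrow> \<exists>i\<in>{1..\<nu>}. A i \<in> K"
proof -
  let ?P = "\<lambda>\<nu>. 1 \<le> \<nu> \<and> (\<forall>A. disjoint_family_on A {1..\<nu>} \<and> (\<Union>i\<in>{1..\<nu>}. A i) = {1..m} \<longrightarrow>
    (\<exists>i\<in>{1..\<nu>}. A i \<in> K))"
  \<comment> \<open>Among \<open>m + 1\<close> disjoint subsets of \<open>[m]\<close> one is empty, hence a face.\<close>
  have "\<exists>i\<in>{1..m + 1}. A i \<in> K"
    if A: "disjoint_family_on A {1..m + 1}" "(\<Union>i\<in>{1..m + 1}. A i) = {1..m}" for A :: "nat \<Rightarrow> nat set"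
  proof (rule ccontr)
    assume "\<not> ?thesis"
    then have ne: "A i \<noteq> {}" if "i \<in> {1..m + 1}" for i
      using K that by (metis abstract_complex_def)
    have fin: "finite (A i)" if "i \<in> {1..m + 1}" for i
    proof (rule finite_subset)
      show "A i \<subseteq> {1..m}" using A(2) that by blast
    qed simp
    have "m + 1 = (\<Sum>i\<in>{1..m + 1}. 1)" by simp
    also have "\<dots> \<le> (\<Sum>i\<in>{1..m + 1}. card (A i))"
    proof (rule sum_mono)
      fix i assume "i \<in> {1..m + 1}"
      then show "1 \<le> card (A i)" using ne fin by (simp add: Suc_le_eq card_gt_0_iff)
    qed
    also have "\<dots> = card (\<Union>i\<in>{1..m + 1}. A i)"
      using A(1) fin by (intro card_UN_disjoint'[symmetric]) auto
    also have "\<dots> = m" using A(2) by simp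
    finally show False by simp
  qed
  then have "?P (m + 1)" by simp
  then have "?P \<nu>" unfolding \<nu>_def partition_number_def by (rule LeastI)
  then show "1 \<le> \<nu>"
    "disjoint_family_on A {1..\<nu>} \<Longrightarrow> (\<Union>i\<in>{1..\<nu>}. A i) = {1..m} \<Longrightarrow> \<exists>i\<in>{1..\<nu>}. A i \<in> K"
    by blast+
qed

theorem corollary3p15:
  fixes K :: "nat set set" and m r p k :: nat
    and \<phi> :: "(nat \<Rightarrow> int) \<Rightarrow> nat \<Rightarrow> nat"
  assumes "abstract_complex K"
    and "Vert K \<subseteq> {1..m}"
    and "r = partition_number m K"
    and "r = p ^ k"
    and "Factorial_Ring.prime p"
    and "k \<ge> 1"
    and "free_action (Zp_power p k) {1..r} \<phi>"
  shows "equivariant_index (Zp_power p k)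
      (geometric_realization (deleted_join r K)) (deleted_join_action \<phi>)
    \<ge> ereal (real m - real (partition_number m K))"
proof -
  let ?G = "Zp_power p k"
  let ?g = "genus ?G (geometric_realization (deleted_join r K)) (deleted_join_action \<phi>)"
  interpret elementary_abelian ?G p by (rule elementary_abelian_Zp_power) (rule assms(5))
  have "card {1..r} = card (carrier ?G)"
    using assms(4) prime_gt_0_nat[OF assms(5)] by (simp add: card_carrier_Zp_power)
  then have trans: "\<exists>g\<in>carrier ?G. \<phi> g i = j" if "i \<in> {1..r}" "j \<in> {1..r}" for i j
    using that by (intro free_action_transitive[OF is_group finite_carrier assms(7)]) auto
  have bound: "m + 1 \<le> n + r"
    if "\<forall>i\<in>{1..n}. subgroup (H i) ?G \<and> H i \<noteq> carrier ?G"
      "continuous_map (geometric_realization (deleted_join r K)) (orbit_join ?G n H) f"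
      "equivariant_on (carrier ?G) (deleted_join_action \<phi>) (orbit_join_action ?G)
        (topspace (geometric_realization (deleted_join r K))) f" for n H f
  proof (rule orbit_join_bound)
    show "abstract_complex K" "Vert K \<subseteq> {1..m}" by (fact assms)+
    show "1 \<le> r" unfolding assms(3) by (rule partition_number_property(1)[OF assms(1)])
    show "\<exists>i\<in>{1..r}. A i \<in> K"
      if "disjoint_family_on A {1..r}" "(\<Union>i\<in>{1..r}. A i) = {1..m}" for A
      using that unfolding assms(3) by (rule partition_number_property(2)[OF assms(1)])
    show "group_action ?G {1..r} \<phi>" using assms(7) by (simp add: free_action_def)
    show "\<exists>g\<in>carrier ?G. \<phi> g i = j" if "i \<in> {1..r}" "j \<in> {1..r}" for i j
      using that by (rule trans)
    show "subgroup (H i) ?G \<and> H i \<noteq> carrier ?G" if "i \<in> {1..n}" for i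
      using that \<open>\<forall>i\<in>{1..n}. subgroup (H i) ?G \<and> H i \<noteq> carrier ?G\<close> by blast
  qed (use that in auto)
  have "enat (m + 1 - r) \<le> ?g"
    unfolding genus_def
  proof (rule Inf_greatest)
    fix N assume "N \<in> {enat n | n. \<exists>H f. (\<forall>i\<in>{1..n}. subgroup (H i) ?G \<and> H i \<noteq> carrier ?G) \<and>
      continuous_map (geometric_realization (deleted_join r K)) (orbit_join ?G n H) f \<and>
      equivariant_on (carrier ?G) (deleted_join_action \<phi>) (orbit_join_action ?G)
        (topspace (geometric_realization (deleted_join r K))) f}"
    then obtain n H f where "N = enat n"
      "\<forall>i\<in>{1..n}. subgroup (H i) ?G \<and> H i \<noteq> carrier ?G"
      "continuous_map (geometric_realization (deleted_join r K)) (orbit_join ?G n H) f"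
      "equivariant_on (carrier ?G) (deleted_join_action \<phi>) (orbit_join_action ?G)
        (topspace (geometric_realization (deleted_join r K))) f" by blast
    then show "enat (m + 1 - r) \<le> N" using bound[of n H f] by simp
  qed
  then have "ereal_of_enat (enat (m + 1 - r)) \<le> ereal_of_enat ?g"
    by (simp only: ereal_of_enat_le_iff)
  then have "ereal (real (m + 1 - r)) - 1 \<le> ereal_of_enat ?g - 1"
    by (intro ereal_minus_mono) simp_all
  moreover have "ereal (real m - real r) \<le> ereal (real (m + 1 - r)) - 1"
    by (simp add: one_ereal_def of_nat_diff_if)
  ultimately show ?thesis unfolding equivariant_index_def assms(3)[symmetric]
    by (rule order_trans[rotated])
qed

end
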